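(* Let $\mathfrak{g}$ be a Fricke Lie algebra, and let $H$ be a group acting on $\mathfrak{g}$ by homogeneous automorphisms. Then for any $h\in H$ the following identity of formal power series in $p,q$ holds: $$\sum_{k=1}^\infty\frac1k\left(\sum_{m,n=1}^\infty\mathrm{Tr}(h\mid\mathfrak{g}_{1,m+n-1})\cdot\mathrm{Tr}(h\mid\mathfrak{g}_{1,-1})^{m-1}p^mq^n\right)^k=\sum_{m,n=1}^\infty\sum_{k=1}^\infty\frac1k\,\mathrm{Tr}(h^k\mid\mathfrak{g}_{m,n})\,p^{km}q^{kn}.$$
   Context: Borcherds-Kac-Moody algebras. A generalized Cartan matrix is a real matrix $A=(a_{i,j})_{i,j\in I}$, $I$ countable, that is symmetrizable (there is a diagonal matrix $Q$ with positive real diagonal entries such that $QA$ is symmetric), with $a_{i,j}\le 0$ for $i\ne j$, and such that if $a_{i,i}>0$ then $a_{i,i}=2$ and $a_{i,j}\in\mathbb{Z}$ for all $j$. $\mathfrak{g}(A)$ is the complex Lie algebra generated by $\{h_i,e_i,f_i\}_{i\in I}$ with relations $[h_i,e_k]=a_{i,k}e_k$, $[h_i,f_k]=-a_{i,k}f_k$, $[e_i,f_j]=\delta_{i,j}h_i$; $\mathrm{ad}(e_i)^{1-a_{i,j}}(e_j)=\mathrm{ad}(f_i)^{1-a_{i,j}}(f_j)=0$ if $a_{i,i}>0$, $i\neq j$; $[e_i,e_j]=[f_i,f_j]=0$ if $a_{i,j}=0$. A Borcherds-Kac-Moody algebra is a Lie algebra of the form $(\mathfrak{g}(A)/C).D$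 with $C$ a central ideal and $D$ a commutative Lie algebra of outer derivations. Fricke Lie algebras. A Lie algebra is Fricke if it is Borcherds-Kac-Moody of rank 2 (Cartan subalgebra 2-dimensional), has exactly one real (positive norm) simple root, has no norm zero simple roots, admits a norm zero Weyl vector $\rho$ (all simple roots $r$ satisfy $(r,\rho)=-r^2$, with the convention $r^2=\frac12(r,r)$), and for any $B>0$ has only finitely many simple roots $r$ (counted with multiplicity) with $(r,r)>-B$. A Fricke Lie algebra has a $\mathbb{Z}\times\mathbb{Z}$-grading $\mathfrak{g}=\bigoplus\mathfrak{g}_{m,n}$ by roots (with $\mathfrak{g}_{0,0}$ the Cartan subalgebra) in which the real simple root has degree $(1,-1)$ and the imaginary simple roots have degrees $(1,n)$, $n\ge1$, with finite multiplicity. A homogeneous automorphism is a Lie algebra automorphism preserving each graded piece. *)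

theory Defs
  imports
    Complex_Main
    "HOL-Library.Countable"
    "HOL-Library.Groups_Big_Fun"
    "HOL-Computational_Algebra.Formal_Power_Series"
    "HOL-Algebra.Group_Action"
begin

section \<open>Complex Lie algebras\<close>

class complex_lie_algebra = ab_group_add +
  fixes scaleC :: "complex \<Rightarrow> 'a \<Rightarrow> 'a"  (infixr \<open>*\<^sub>C\<close> 75)
    and lie :: "'a \<Rightarrow> 'a \<Rightarrow> 'a"
  assumes scaleC_add_right: "a *\<^sub>C (x + y) = a *\<^sub>C x + a *\<^sub>C y"
    and scaleC_add_left: "(a + b) *\<^sub>C x = a *\<^sub>C x + b *\<^sub>C x"
    and scaleC_scaleC: "a *\<^sub>C b *\<^sub>C x = (a * b) *\<^sub>C x"
    and scaleC_one: "1 *\<^sub>C x = x"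
    and lie_add_left: "lie (x + y) z = lie x z + lie y z"
    and lie_add_right: "lie x (y + z) = lie x y + lie x z"
    and lie_scaleC_left: "lie (a *\<^sub>C x) y = a *\<^sub>C lie x y"
    and lie_scaleC_right: "lie x (a *\<^sub>C y) = a *\<^sub>C lie x y"
    and lie_self: "lie x x = 0"
    and jacobi: "lie x (lie y z) + lie y (lie z x) + lie z (lie x y) = 0"

global_interpretation complex_vs:
  vector_space "scaleC :: complex \<Rightarrow> 'a :: complex_lie_algebra \<Rightarrow> 'a"
  by unfold_locales
    (simp_all add: scaleC_add_right scaleC_add_left scaleC_scaleC scaleC_one)

definition lie_ideal :: "'a :: complex_lie_algebra set \<Rightarrow> bool" where
  "lie_ideal J \<longleftrightarrow> complex_vs.subspace J \<and> (\<forall>x. \<forall>y\<in>J. lie x y \<in> J)"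

definition lie_ideal_hull :: "'a :: complex_lie_algebra set \<Rightarrow> 'a set" where
  "lie_ideal_hull S = \<Inter>{J. lie_ideal J \<and> S \<subseteq> J}"

definition lie_hom :: "('a :: complex_lie_algebra \<Rightarrow> 'b :: complex_lie_algebra) \<Rightarrow> bool" where
  "lie_hom \<phi> \<longleftrightarrow> Vector_Spaces.linear scaleC scaleC \<phi> \<and> (\<forall>x y. \<phi> (lie x y) = lie (\<phi> x) (\<phi> y))"

text \<open>The trace of \<open>T\<close> on a finite-dimensional \<open>T\<close>-invariant subspace \<open>V\<close>: the sum of the
  diagonal entries with respect to some basis of \<open>V\<close>.\<close>

definition trace_on :: "'a :: complex_lie_algebra set \<Rightarrow> ('a \<Rightarrow> 'a) \<Rightarrow> complex" where
  "trace_on V T =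
     (let B = (SOME B. complex_vs.independent B \<and> complex_vs.span B = V)
      in \<Sum>b\<in>B. complex_vs.representation B (T b) b)"


section \<open>The free complex Lie algebra\<close>

text \<open>Formal Lie expressions in the generators modulo the least congruence that enforces the
  axioms of a complex Lie algebra.\<close>

datatype 'x lie_term =
    TGen 'x
  | TZero
  | TAdd "'x lie_term" "'x lie_term"
  | TScale complex "'x lie_term"
  | TLie "'x lie_term" "'x lie_term"

inductive lie_eq :: "'x lie_term \<Rightarrow> 'x lie_term \<Rightarrow> bool" where
  refl: "lie_eq s s"
| sym: "lie_eq s t \<Longrightarrow> lie_eq t s"
| trans: "lie_eq s t \<Longrightarrow> lie_eq t u \<Longrightarrow> lie_eq s u"
| cong_add: "lie_eq s s' \<Longrightarrow> lie_eq t t' \<Longrightarrow> lie_eq (TAdd s t) (TAdd s' t')"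
| cong_scale: "lie_eq s s' \<Longrightarrow> lie_eq (TScale a s) (TScale a s')"
| cong_lie: "lie_eq s s' \<Longrightarrow> lie_eq t t' \<Longrightarrow> lie_eq (TLie s t) (TLie s' t')"
| add_assoc: "lie_eq (TAdd (TAdd s t) u) (TAdd s (TAdd t u))"
| add_commute: "lie_eq (TAdd s t) (TAdd t s)"
| add_zero: "lie_eq (TAdd TZero s) s"
| add_neg: "lie_eq (TAdd (TScale (- 1) s) s) TZero"
| scale_add_right: "lie_eq (TScale a (TAdd s t)) (TAdd (TScale a s) (TScale a t))"
| scale_add_left: "lie_eq (TScale (a + b) s) (TAdd (TScale a s) (TScale b s))"
| scale_scale: "lie_eq (TScale a (TScale b s)) (TScale (a * b) s)"
| scale_one: "lie_eq (TScale 1 s) s"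
| lie_add_left: "lie_eq (TLie (TAdd s t) u) (TAdd (TLie s u) (TLie t u))"
| lie_add_right: "lie_eq (TLie s (TAdd t u)) (TAdd (TLie s t) (TLie s u))"
| lie_scale_left: "lie_eq (TLie (TScale a s) t) (TScale a (TLie s t))"
| lie_scale_right: "lie_eq (TLie s (TScale a t)) (TScale a (TLie s t))"
| lie_self: "lie_eq (TLie s s) TZero"
| jacobi: "lie_eq (TAdd (TAdd (TLie s (TLie t u)) (TLie t (TLie u s))) (TLie u (TLie s t))) TZero"

quotient_type 'x free_lie = "'x lie_term" / lie_eq
  by (intro equivpI reflpI sympI transpI) (blast intro: lie_eq.intros)+

lift_definition free_gen :: "'x \<Rightarrow> 'x free_lie" is TGen .

instantiation free_lie :: (type) complex_lie_algebra
begin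

lift_definition zero_free_lie :: "'a free_lie" is TZero .

lift_definition plus_free_lie :: "'a free_lie \<Rightarrow> 'a free_lie \<Rightarrow> 'a free_lie" is TAdd
  by (rule lie_eq.cong_add)

lift_definition uminus_free_lie :: "'a free_lie \<Rightarrow> 'a free_lie" is "TScale (- 1)"
  by (rule lie_eq.cong_scale)

lift_definition minus_free_lie :: "'a free_lie \<Rightarrow> 'a free_lie \<Rightarrow> 'a free_lie"
  is "\<lambda>s t. TAdd s (TScale (- 1) t)"
  by (intro lie_eq.cong_add lie_eq.cong_scale)

lift_definition scaleC_free_lie :: "complex \<Rightarrow> 'a free_lie \<Rightarrow> 'a free_lie" is TScale
  by (rule lie_eq.cong_scale)

lift_definition lie_free_lie :: "'a free_lie \<Rightarrow> 'a free_lie \<Rightarrow> 'a free_lie" is TLie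
  by (rule lie_eq.cong_lie)

instance
  by standard (transfer, blast intro: lie_eq.intros)+

end


section \<open>Borcherds-Kac-Moody algebras\<close>

text \<open>The index set \<open>I\<close> of a generalized Cartan matrix is the countable type \<open>'i\<close>.\<close>

definition symmetrizer :: "('i \<Rightarrow> real) \<Rightarrow> ('i \<Rightarrow> 'i \<Rightarrow> real) \<Rightarrow> bool" where
  "symmetrizer q A \<longleftrightarrow> (\<forall>i. 0 < q i) \<and> (\<forall>i j. q i * A i j = q j * A j i)"

definition generalized_cartan_matrix :: "('i :: countable \<Rightarrow> 'i \<Rightarrow> real) \<Rightarrow> bool" where
  "generalized_cartan_matrix A \<longleftrightarrow>
     (\<exists>q. symmetrizer q A) \<and>
     (\<forall>i j. i \<noteq> j \<longrightarrow> A i j \<le> 0) \<and>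
     (\<forall>i. 0 < A i i \<longrightarrow> A i i = 2 \<and> (\<forall>j. A i j \<in> \<int>))"

datatype 'i bkm_gen = GenH 'i | GenE 'i | GenF 'i

abbreviation gen_h :: "'i \<Rightarrow> 'i bkm_gen free_lie" where "gen_h i \<equiv> free_gen (GenH i)"
abbreviation gen_e :: "'i \<Rightarrow> 'i bkm_gen free_lie" where "gen_e i \<equiv> free_gen (GenE i)"
abbreviation gen_f :: "'i \<Rightarrow> 'i bkm_gen free_lie" where "gen_f i \<equiv> free_gen (GenF i)"

definition bkm_relations :: "('i :: countable \<Rightarrow> 'i \<Rightarrow> real) \<Rightarrow> 'i bkm_gen free_lie set" where
  "bkm_relations A =
     {lie (gen_h i) (gen_e k) - complex_of_real (A i k) *\<^sub>C gen_e k | i k. True}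
   \<union> {lie (gen_h i) (gen_f k) + complex_of_real (A i k) *\<^sub>C gen_f k | i k. True}
   \<union> {lie (gen_e i) (gen_f j) - (if i = j then gen_h i else 0) | i j. True}
   \<union> {(lie (gen_e i) ^^ nat \<lfloor>1 - A i j\<rfloor>) (gen_e j) | i j. 0 < A i i \<and> i \<noteq> j}
   \<union> {(lie (gen_f i) ^^ nat \<lfloor>1 - A i j\<rfloor>) (gen_f j) | i j. 0 < A i i \<and> i \<noteq> j}
   \<union> {lie (gen_e i) (gen_e j) | i j. A i j = 0}
   \<union> {lie (gen_f i) (gen_f j) | i j. A i j = 0}"

text \<open>\<open>\<gg>(A)\<close> is the free Lie algebra on the \<open>h\<^sub>i, e\<^sub>i, f\<^sub>i\<close> modulo the following ideal.\<close>

definition bkm_ideal :: "('i :: countable \<Rightarrow> 'i \<Rightarrow> real) \<Rightarrow> 'i bkm_gen free_lie set" where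
  "bkm_ideal A = lie_ideal_hull (bkm_relations A)"

text \<open>The Lie algebra \<open>'g\<close> is of the form \<open>(\<gg>(A)/C).D\<close>. The homomorphism \<open>\<pi>\<close> factors
  through \<open>\<gg>(A)\<close> (\<open>relations\<close>), and the kernel \<open>C\<close> of the induced map \<open>\<gg>(A) \<rightarrow> 'g\<close> is central
  (\<open>central\<close>), so that \<open>range \<pi>\<close> is a copy of \<open>\<gg>(A)/C\<close>. It is an ideal with the commutative
  subalgebra \<open>D\<close> as a complement, and no nonzero element of \<open>D\<close> acts on it as an inner
  derivation.\<close>

locale borcherds_kac_moody_algebra =
  fixes A :: "'i :: countable \<Rightarrow> 'i \<Rightarrow> real"
    and \<pi> :: "'i bkm_gen free_lie \<Rightarrow> 'g :: complex_lie_algebra"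
    and D :: "'g set"
  assumes cartan_matrix: "generalized_cartan_matrix A"
    and hom: "lie_hom \<pi>"
    and relations: "x \<in> bkm_ideal A \<Longrightarrow> \<pi> x = 0"
    and central: "\<pi> x = 0 \<Longrightarrow> lie y x \<in> bkm_ideal A"
    and ideal_range: "lie_ideal (range \<pi>)"
    and subspace_D: "complex_vs.subspace D"
    and commutative_D: "d \<in> D \<Longrightarrow> d' \<in> D \<Longrightarrow> lie d d' = 0"
    and sum_D: "\<exists>x. \<exists>d\<in>D. z = \<pi> x + d"
    and disjoint_D: "range \<pi> \<inter> D = {0}"
    and outer_D: "d \<in> D \<Longrightarrow> d \<noteq> 0 \<Longrightarrow> \<not> (\<exists>x\<in>range \<pi>. \<forall>y\<in>range \<pi>. lie d y = lie x y)"
begin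

definition h :: "'i \<Rightarrow> 'g" where "h i = \<pi> (gen_h i)"
definition e :: "'i \<Rightarrow> 'g" where "e i = \<pi> (gen_e i)"
definition f :: "'i \<Rightarrow> 'g" where "f i = \<pi> (gen_f i)"

definition cartan :: "'g set" where
  "cartan = complex_vs.span (range h \<union> D)"

end


section \<open>Fricke Lie algebras\<close>

text \<open>
  With respect to the symmetrization \<open>q\<close> the simple roots satisfy \<open>(\<alpha>\<^sub>i, \<alpha>\<^sub>j) = q\<^sub>i a\<^sub>i\<^sub>j\<close>. Roots are
  identified with elements of the Cartan subalgebra by means of the bilinear form: \<open>r\<close> stands for
  the functional \<open>y \<mapsto> (r, y)\<close>. As \<open>[h\<^sub>i, e\<^sub>k] = a\<^sub>i\<^sub>k e\<^sub>k\<close>, the simple root \<open>\<alpha>\<^sub>i\<close> becomes \<open>q\<^sub>i h\<^sub>i\<close>. Simple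
  roots are counted with multiplicity by counting indices \<open>i\<close>. Only the restriction of \<open>form\<close>
  to the Cartan subalgebra matters.
\<close>

locale fricke_lie_algebra = borcherds_kac_moody_algebra A \<pi> D
  for A :: "'i :: countable \<Rightarrow> 'i \<Rightarrow> real"
    and \<pi> :: "'i bkm_gen free_lie \<Rightarrow> 'g :: complex_lie_algebra"
    and D :: "'g set" +
  fixes q :: "'i \<Rightarrow> real"
    and form :: "'g \<Rightarrow> 'g \<Rightarrow> complex"
    and \<rho> :: 'g
  assumes symmetrizer: "symmetrizer q A"
    and rank: "complex_vs.dim cartan = 2"
    and form_commute: "x \<in> cartan \<Longrightarrow> y \<in> cartan \<Longrightarrow> form x y = form y x"
    and form_add: "x \<in> cartan \<Longrightarrow> y \<in> cartan \<Longrightarrow> z \<in> cartan \<Longrightarrow> form (x + y) z = form x z + form y z"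
    and form_scaleC: "x \<in> cartan \<Longrightarrow> y \<in> cartan \<Longrightarrow> form (a *\<^sub>C x) y = a * form x y"
    and form_simple_roots:
      "form (complex_of_real (q i) *\<^sub>C h i) (complex_of_real (q j) *\<^sub>C h j) = complex_of_real (q i * A i j)"
    and cartan_e: "y \<in> cartan \<Longrightarrow> lie y (e i) = form (complex_of_real (q i) *\<^sub>C h i) y *\<^sub>C e i"
    and cartan_f: "y \<in> cartan \<Longrightarrow> lie y (f i) = - (form (complex_of_real (q i) *\<^sub>C h i) y *\<^sub>C f i)"
    and one_real_simple_root: "\<exists>!i. 0 < q i * A i i"
    and no_null_simple_root: "q i * A i i \<noteq> 0"
    and weyl_vector_cartan: "\<rho> \<in> cartan"
    and weyl_vector_null: "form \<rho> \<rho> = 0"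
    and weyl_vector: "form (complex_of_real (q i) *\<^sub>C h i) \<rho> = - complex_of_real (q i * A i i) / 2"
    and finitely_many_simple_roots: "0 < B \<Longrightarrow> finite {i. - B < q i * A i i}"
begin

definition simple_root :: "'i \<Rightarrow> 'g" where
  "simple_root i = complex_of_real (q i) *\<^sub>C h i"

definition real_index :: 'i where
  "real_index = (THE i. 0 < q i * A i i)"

text \<open>The \<open>\<int> \<times> \<int>\<close>-grading by roots is normalized by placing the real simple root in degree
  \<open>(1, -1)\<close> and \<open>-\<rho>\<close> in degree \<open>(1, 0)\<close>; \<open>simple_root_degree\<close> below shows that then the imaginary
  simple roots are in degrees \<open>(1, n)\<close> with \<open>n \<ge> 1\<close>.\<close>

definition degree_root :: "int \<Rightarrow> int \<Rightarrow> 'g" where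
  "degree_root m n = of_int (m + n) *\<^sub>C (- \<rho>) - of_int n *\<^sub>C simple_root real_index"

definition graded_piece :: "int \<Rightarrow> int \<Rightarrow> 'g set" where
  "graded_piece m n = {x. \<forall>y\<in>cartan. lie y x = form (degree_root m n) y *\<^sub>C x}"

definition homogeneous_automorphism :: "('g \<Rightarrow> 'g) \<Rightarrow> bool" where
  "homogeneous_automorphism \<phi> \<longleftrightarrow>
     lie_hom \<phi> \<and> bij \<phi> \<and> (\<forall>m n. \<phi> ` graded_piece m n = graded_piece m n)"

lemma simple_root_cartan: "simple_root i \<in> cartan"
  unfolding simple_root_def cartan_def
  by (intro complex_vs.span_scale complex_vs.span_base) auto

lemma real_simple_root_degree: "degree_root 1 (- 1) = simple_root real_index"
  by (simp add: degree_root_def scaleC_one)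

lemma simple_root_degree:
  assumes i: "i \<noteq> real_index"
  obtains n :: nat
  where "1 \<le> n" and "simple_root i = degree_root 1 (int n)" and "e i \<in> graded_piece 1 (int n)"
proof -
  let ?r = "simple_root real_index" and ?c = "q real_index * A real_index real_index"
  have real: "0 < ?c"
    unfolding real_index_def using one_real_simple_root by (rule theI')
  have imag: "q i * A i i < 0"
    using one_real_simple_root real i no_null_simple_root[of i] by (metis linorder_neqE_linordered_idom)
  have q: "0 < q real_index" using symmetrizer by (simp add: symmetrizer_def)
  have Arr: "0 < A real_index real_index" using real q by (simp add: zero_less_mult_iff)
  then have A2: "A real_index real_index = 2" and Aint: "A real_index i \<in> \<int>"
    using cartan_matrix by (auto simp: generalized_cartan_matrix_def)
  have Ale: "A real_index i \<le> 0"
    using cartan_matrix i by (auto simp: generalized_cartan_matrix_def)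
  have sub: "complex_vs.subspace cartan" by (simp add: cartan_def)
  note inH = complex_vs.subspace_add[OF sub] complex_vs.subspace_scale[OF sub]
    simple_root_cartan weyl_vector_cartan
  have form0: "form 0 x = 0" if "x \<in> cartan" for x
    using form_scaleC[of \<rho> x 0] that weyl_vector_cartan by simp
  have scale2: "form z (a *\<^sub>C x) = a * form z x" if "x \<in> cartan" "z \<in> cartan" for x z a
    using that form_scaleC[of x z a] by (metis form_commute inH(2))
  have add2: "form z (x + y) = form z x + form z y"
    if "x \<in> cartan" "y \<in> cartan" "z \<in> cartan" for x y z
    using that by (metis form_commute form_add inH(1))
  have srho: "form (simple_root j) \<rho> = - complex_of_real (q j * A j j) / 2" for j
    using weyl_vector by (simp add: simple_root_def)
  have ss: "form (simple_root j) (simple_root k) = complex_of_real (q j * A j k)" for j k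
    using form_simple_roots by (simp add: simple_root_def)
  have rho_nz: "\<rho> \<noteq> 0"
    using srho[of real_index] form0[OF simple_root_cartan[of real_index]] real
      form_commute[OF simple_root_cartan[of real_index] weyl_vector_cartan] by auto
  have not_in: "?r \<notin> complex_vs.span {\<rho>}"
  proof
    assume "?r \<in> complex_vs.span {\<rho>}"
    then obtain k where "?r = k *\<^sub>C \<rho>" by (auto simp: complex_vs.span_singleton)
    then have "form ?r \<rho> = 0" by (simp add: form_scaleC weyl_vector_cartan weyl_vector_null)
    then show False using srho[of real_index] real by auto
  qed
  then have indep: "complex_vs.independent {?r, \<rho>}" and ne: "?r \<noteq> \<rho>"
    using rho_nz by (auto simp: complex_vs.independent_insert intro: complex_vs.span_base)
  have span: "cartan \<subseteq> complex_vs.span {?r, \<rho>}"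
  proof -
    obtain B where B: "B \<subseteq> cartan" "complex_vs.independent B" "cartan \<subseteq> complex_vs.span B" "card B = 2"
      using complex_vs.basis_exists[of cartan] rank by metis
    have fB: "finite B" using B(4) by (metis card.infinite zero_neq_numeral)
    show ?thesis
    proof (rule ccontr)
      assume "\<not> ?thesis"
      then obtain v where v: "v \<in> cartan" "v \<notin> complex_vs.span {?r, \<rho>}" by blast
      have "complex_vs.independent {v, ?r, \<rho>}"
        using v(2) indep rho_nz by (simp add: complex_vs.independent_insert)
      moreover have "{v, ?r, \<rho>} \<subseteq> complex_vs.span B"
        using B(3) v(1) simple_root_cartan weyl_vector_cartan by blast
      ultimately have "card {v, ?r, \<rho>} \<le> card B"
        using complex_vs.independent_span_bound[OF fB] by blast
      moreover have "v \<noteq> ?r" "v \<noteq> \<rho>" using v(2) by (auto intro: complex_vs.span_base)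
      ultimately show False using ne B(4) by simp
    qed
  qed
  from span simple_root_cartan[of i] have "simple_root i \<in> complex_vs.span {?r, \<rho>}" by blast
  then obtain a b where ab: "simple_root i = b *\<^sub>C ?r + a *\<^sub>C \<rho>"
    by (auto simp: complex_vs.span_insert complex_vs.span_singleton algebra_simps)
  let ?C = "complex_of_real ?c" and ?N = "complex_of_real (q i * A i i)"
  have C0: "?C \<noteq> 0" and N0: "?N \<noteq> 0" using real imag by (metis less_irrefl of_real_eq_0_iff)+
  have rr: "form ?r ?r = ?C" and rw: "form ?r \<rho> = - ?C / 2" and wr: "form \<rho> ?r = - ?C / 2"
    using ss srho form_commute[OF simple_root_cartan weyl_vector_cartan] by metis+
  have 1: "- ?N / 2 = b * (- ?C / 2)"
    unfolding srho[of i, symmetric] ab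
    by (simp only: form_add form_scaleC inH rw weyl_vector_null) simp
  have 2: "?N = b * (b * ?C + a * (- ?C / 2)) + a * (b * (- ?C / 2))"
    unfolding ss[of i i, symmetric] ab
    by (simp only: form_add form_scaleC add2 scale2 inH rr rw wr weyl_vector_null) simp
  have 3: "complex_of_real (q real_index * A real_index i) = b * ?C + a * (- ?C / 2)"
    unfolding ss[of real_index i, symmetric] ab
    by (simp only: add2 scale2 inH rr rw)
  from 1 have N: "?N = b * ?C" by simp
  with N0 have b0: "b \<noteq> 0" by auto
  from 2 N have "b * ?C = b * ((b - a) * ?C)" by (simp add: algebra_simps)
  then have "1 * ?C = (b - a) * ?C" using b0 by (metis mult_cancel_left mult_1)
  then have "1 = b - a" using C0 by (metis mult_cancel_right)
  then have a: "a = b - 1" by (simp add: algebra_simps)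
  have "complex_of_real (A real_index i) = b + 1"
  proof -
    have "complex_of_real (q real_index) * complex_of_real (A real_index i)
        = complex_of_real (q real_index) * (b + 1)"
      using 3 unfolding a A2 by (simp add: algebra_simps)
    then show ?thesis using q by simp
  qed
  then have b: "b = complex_of_real (A real_index i) - 1" by simp
  obtain k :: int where k: "A real_index i = of_int k" using Aint by (auto elim: Ints_cases)
  define n where "n = nat (1 - k)"
  have k0: "k \<le> 0" using Ale k by simp
  then have n: "int n = 1 - k" by (simp add: n_def)
  have b_n: "b = - of_int (int n)" unfolding b k n by simp
  have eq: "simple_root i = degree_root 1 (int n)"
    unfolding ab degree_root_def a b_n
    by (simp add: complex_vs.scale_minus_left complex_vs.scale_minus_right
        complex_vs.scale_left_diff_distrib algebra_simps)
  have "e i \<in> graded_piece 1 (int n)"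
    unfolding graded_piece_def using cartan_e by (auto simp: eq[symmetric] simple_root_def)
  moreover have "1 \<le> n" using n k0 by simp
  ultimately show ?thesis using that eq by blast
qed

end


section \<open>Formal power series in two variables\<close>

unbundle fps_syntax

text \<open>A formal power series in \<open>p, q\<close> is an element of \<open>\<complex>[[q]][[p]]\<close>; the coefficient of
  \<open>p\<^sup>a q\<^sup>b\<close> in \<open>S\<close> is \<open>S $ a $ b\<close>.\<close>

type_synonym fps2 = "complex fps fps"

definition monomial2 :: "complex \<Rightarrow> nat \<Rightarrow> nat \<Rightarrow> fps2" where
  "monomial2 c a b = fps_const (fps_const c * fps_X ^ b) * fps_X ^ a"

text \<open>An infinite sum of formal power series makes sense if each coefficient receives only
  finitely many nonzero contributions. \<open>Sum_any\<close> adds up a function of finite support.\<close>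

definition formal_summable :: "'j set \<Rightarrow> ('j \<Rightarrow> fps2) \<Rightarrow> bool" where
  "formal_summable J F \<longleftrightarrow> (\<forall>a b. finite {j \<in> J. F j $ a $ b \<noteq> 0})"

definition formal_sum :: "'j set \<Rightarrow> ('j \<Rightarrow> fps2) \<Rightarrow> fps2" where
  "formal_sum J F = Abs_fps (\<lambda>a. Abs_fps (\<lambda>b. \<Sum>j. if j \<in> J then F j $ a $ b else 0))"

lemma monomial2_nth: "monomial2 c a b $ a' $ b' = (if a' = a \<and> b' = b then c else 0)"
  by (auto simp: monomial2_def fps_X_power_mult_right_nth fps_X_power_iff)

text \<open>The infinite sums in the twisted denominator identity are all well defined:\<close>

lemma formal_summable_monomials:
  "formal_summable J (\<lambda>(m, n). monomial2 (c m n) m n)"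
  unfolding formal_summable_def
proof (intro allI)
  fix a b
  show "finite {j \<in> J. (case j of (m, n) \<Rightarrow> monomial2 (c m n) m n) $ a $ b \<noteq> 0}"
    by (rule finite_subset[of _ "{(a, b)}"]) (auto simp: monomial2_nth split: if_splits)
qed

lemma formal_summable_powers:
  assumes "S $ 0 = 0"
  shows "formal_summable {1..} (\<lambda>k. fps_const (fps_const (1 / of_nat k)) * S ^ k)"
  unfolding formal_summable_def
proof (intro allI)
  fix a b
  show "finite {k \<in> {1..}. (fps_const (fps_const (1 / of_nat k)) * S ^ k) $ a $ b \<noteq> 0}"
  proof (rule finite_subset[of _ "{..a}"])
    show "{k \<in> {1..}. (fps_const (fps_const (1 / of_nat k)) * S ^ k) $ a $ b \<noteq> 0} \<subseteq> {..a}"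
    proof clarsimp
      fix k assume *: "(S ^ k) $ a $ b \<noteq> 0"
      show "k \<le> a"
      proof (rule ccontr)
        assume "\<not> k \<le> a"
        then have "(S ^ k) $ a = 0"
          using startsby_zero_power_prefix[OF assms, of k] by simp
        with * show False by simp
      qed
    qed
  qed simp
qed

lemma formal_summable_power_monomials:
  assumes "1 \<le> m"
  shows "formal_summable {1..} (\<lambda>k. monomial2 (c k) (k * m) (k * n))"
  unfolding formal_summable_def
proof (intro allI)
  fix a b
  show "finite {k \<in> {1..}. monomial2 (c k) (k * m) (k * n) $ a $ b \<noteq> 0}"
    by (rule finite_subset[of _ "{..a}"]) (use assms in \<open>auto simp: monomial2_nth split: if_splits\<close>)
qed

lemma formal_summable_double_sum:
  "formal_summable ({1..} \<times> {1..})
     (\<lambda>(m, n). formal_sum {1..} (\<lambda>k. monomial2 (c m n k) (k * m) (k * n)))"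
  unfolding formal_summable_def
proof (intro allI)
  fix a b :: nat
  let ?F = "\<lambda>m n. formal_sum {1..} (\<lambda>k::nat. monomial2 (c m n k) (k * m) (k * n))"
  have zero: "?F m n $ a $ b = 0" if "1 \<le> m" "1 \<le> n" "\<not> (m \<le> a \<and> n \<le> b)" for m n
  proof -
    have "(if k \<in> {1..} then monomial2 (c m n k) (k * m) (k * n) $ a $ b else 0) = 0" for k
      using that by (auto simp: monomial2_nth)
    then show ?thesis by (simp only: formal_sum_def fps_nth_Abs_fps Sum_any.neutral)
  qed
  show "finite {j \<in> {1..} \<times> {1..}. (case j of (m, n) \<Rightarrow> ?F m n) $ a $ b \<noteq> 0}"
    by (rule finite_subset[of _ "{..a} \<times> {..b}"]) (use zero in fastforce)+
qed

end

theory Submission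
  imports Defs "HOL-Library.Poly_Mapping" "HOL-Library.Nat_Bijection" "HOL-Library.Multiset"
    "HOL-Computational_Algebra.Fundamental_Theorem_Algebra"
begin

text \<open>
  The root spaces of degree \<open>(m, n)\<close> with \<open>m, n \<ge> 1\<close> span a free Lie algebra on the strings
  \<open>ad(e\<^sub>r)\<^sup>k e\<^sub>i\<close>, where \<open>e\<^sub>r\<close> belongs to the real simple root, \<open>e\<^sub>i\<close> to an imaginary simple root of
  degree \<open>(1, n)\<close>, and \<open>k < n\<close>. That these elements satisfy no relation is seen on the module
  induced from the trivial module of the parabolic subalgebra generated by \<open>e\<^sub>r\<close> and all \<open>f\<^sub>i\<close> and
  \<open>h\<^sub>i\<close>: its space is the free associative algebra on the strings, which act by left multiplication.

  For a free Lie algebra with generating series \<open>v\<close>, Lazard elimination of one generator of weight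
  \<open>w\<close> leaves a free Lie algebra with generating series \<open>v'\<close>, where \<open>1 - v = (1 - w) (1 - v')\<close>.
  Eliminating all generators of low degree gives a basis and \<open>- log (1 - v) = \<Sum> - log (1 - w)\<close>, the
  sum being over the weights \<open>w\<close> of the basis elements. If the automorphism is triangular on the
  generators, it is triangular in this basis, and its powers have traces the power sums of the
  eigenvalues in the weights.
\<close>

text \<open>Relations say which brackets vanish; that no others vanish needs a model, and the kernel
  of \<open>\<pi>\<close> is known only to be central modulo the relations. An element killed by
  \<open>\<pi>\<close> might thus act nontrivially on the module. A weight argument shows that its
  value at the empty word is 0, and this value is all that an evaluation of the free algebra uses.
  The left-hand side comes from the strings. For a root of degree (1, n),
  \<open>A r i = 1 - n\<close>, so the string has exactly n members, of degrees (k + 1, n - k).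
  Those of degree (m, n) thus stem from degree (1, m + n - 1) with k = m - 1, and each of the k
  factors \<open>e r\<close> contributes the eigenvalue of h on the piece of degree (1, -1). The
  automorphism need not be diagonalizable. Hence its eigenvalues are attached to multidegrees, on
  which they are multiplicative, and not to vectors. One elimination step supplies independence,
  spanning and the factor 1 - w at once, in place of the Poincare-Birkhoff-Witt theorem and a
  dimension formula.\<close>

lemmas bracket_add_left = complex_lie_algebra_class.lie_add_left
  and bracket_add_right = complex_lie_algebra_class.lie_add_right
  and bracket_self = complex_lie_algebra_class.lie_self
  and bracket_jacobi = complex_lie_algebra_class.jacobi

section \<open>Elementary identities for the bracket\<close>

lemma lie_zero_left [simp]: "lie 0 (y :: 'a :: complex_lie_algebra) = 0"
  using bracket_add_left[of 0 0 y] by simp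

lemma lie_zero_right [simp]: "lie (y :: 'a :: complex_lie_algebra) 0 = 0"
  using bracket_add_right[of y 0 0] by simp

lemma lie_anticommute: "lie x y = - lie y (x :: 'a :: complex_lie_algebra)"
proof -
  have "lie x y + lie y x = 0"
    using bracket_self[of "x + y", unfolded bracket_add_left bracket_add_right]
    by (simp add: bracket_self add.commute)
  then show ?thesis by (simp add: eq_neg_iff_add_eq_0)
qed

lemma lie_minus_left [simp]: "lie (- x) y = - lie x (y :: 'a :: complex_lie_algebra)"
  using bracket_add_left[of x "- x" y] by (simp add: eq_neg_iff_add_eq_0 add.commute)

lemma lie_minus_right [simp]: "lie x (- y) = - lie x (y :: 'a :: complex_lie_algebra)"
  using bracket_add_right[of x y "- y"] by (simp add: eq_neg_iff_add_eq_0 add.commute)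

lemma lie_diff_left: "lie (x - y) z = lie x z - lie y (z :: 'a :: complex_lie_algebra)"
  using bracket_add_left[of x "- y" z] by simp

lemma lie_diff_right: "lie x (y - z) = lie x y - lie x (z :: 'a :: complex_lie_algebra)"
  using bracket_add_right[of x y "- z"] by simp

lemma lie_lie_left: "lie (lie x y) z = lie x (lie y z) - lie y (lie x (z :: 'a :: complex_lie_algebra))"
proof -
  have "lie (lie x y) z = - lie z (lie x y)" by (rule lie_anticommute)
  also have "\<dots> = lie x (lie y z) + lie y (lie z x)"
    using bracket_jacobi[of x y z] by (metis eq_neg_iff_add_eq_0 minus_minus)
  also have "lie y (lie z x) = - lie y (lie x z)" by (subst lie_anticommute[of z x]) simp
  finally show ?thesis by simp
qed

lemma lie_derivation: "lie x (lie y z) = lie (lie x y) z + lie y (lie x (z :: 'a :: complex_lie_algebra))"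
  by (simp add: lie_lie_left)

abbreviation lin :: "('a :: complex_lie_algebra \<Rightarrow> 'b :: complex_lie_algebra) \<Rightarrow> bool" where
  "lin \<equiv> Vector_Spaces.linear scaleC scaleC"

section \<open>Linear maps and spans\<close>

lemma lin_iff: "lin f \<longleftrightarrow> (\<forall>x y. f (x + y) = f x + f y) \<and> (\<forall>c x. f (c *\<^sub>C x) = c *\<^sub>C f x)"
  by (simp add: Vector_Spaces.linear_iff complex_vs.vector_space_axioms)

lemma lin_add: "lin f \<Longrightarrow> f (x + y) = f x + f y"
  and lin_scale: "lin f \<Longrightarrow> f (c *\<^sub>C x) = c *\<^sub>C f x"
  by (simp_all add: lin_iff)

lemma lin_0: "lin f \<Longrightarrow> f 0 = 0"
  using lin_scale[of f 0 0] by simp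

lemma lin_neg: "lin f \<Longrightarrow> f (- x) = - f x"
  using lin_scale[of f "-1" x] by (simp add: complex_vs.scale_minus_left)

lemma lin_diff: "lin f \<Longrightarrow> f (x - y) = f x - f y"
  using lin_add[of f x "- y"] by (simp add: lin_neg)

lemma lin_sum: "lin f \<Longrightarrow> f (sum g S) = (\<Sum>s\<in>S. f (g s))"
  by (induction S rule: infinite_finite_induct) (simp_all add: lin_0 lin_add)

lemma lin_lie: "lin (lie x)"
  by (simp add: lin_iff bracket_add_right lie_scaleC_right)

lemma lin_mem_span:
  assumes "lin f" "\<And>x. x \<in> S \<Longrightarrow> f x \<in> complex_vs.span T" "v \<in> complex_vs.span S"
  shows "f v \<in> complex_vs.span T"
  using assms(3)
proof (induction rule: complex_vs.span_induct_alt)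
  case base
  then show ?case by (simp add: lin_0[OF assms(1)] complex_vs.span_zero)
next
  case (step c x y)
  then show ?case
    by (simp add: lin_add[OF assms(1)] lin_scale[OF assms(1)] complex_vs.span_add
        complex_vs.span_scale assms(2))
qed

lemma lie_mem_span:
  assumes "\<And>x y. x \<in> S \<Longrightarrow> y \<in> T \<Longrightarrow> lie x y \<in> complex_vs.span U"
    and "v \<in> complex_vs.span S" "w \<in> complex_vs.span T"
  shows "lie v w \<in> complex_vs.span U"
proof -
  have "lie w v \<in> complex_vs.span U"
  proof (rule lin_mem_span[OF lin_lie _ assms(2)])
    fix x assume "x \<in> S"
    then have "lie x w \<in> complex_vs.span U"
      by (intro lin_mem_span[OF lin_lie _ assms(3)] assms(1))
    then show "lie w x \<in> complex_vs.span U"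
      by (subst lie_anticommute) (rule complex_vs.span_neg)
  qed
  then show ?thesis by (subst lie_anticommute) (rule complex_vs.span_neg)
qed

section \<open>Operators\<close>

text \<open>Operators get a type of their own because the universal property of the free Lie algebra
  produces homomorphisms into a type of class \<open>complex_lie_algebra\<close>. The bracket below
  is the commutator.\<close>

typedef (overloaded) 'm linop = "{f :: 'm :: complex_lie_algebra \<Rightarrow> 'm. lin f}"
  morphisms app Linop
  by (rule exI[of _ "\<lambda>x. x"]) (simp add: lin_iff)

setup_lifting type_definition_linop

lemma lin_app [simp]: "lin (app X)"
  using app by blast

lemma linop_eqI: "(\<And>x. app X x = app Y x) \<Longrightarrow> X = Y"
  by (simp add: app_inject[symmetric] fun_eq_iff)

lemmas app_add = lin_add[OF lin_app] and app_scale = lin_scale[OF lin_app]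
  and app_0 = lin_0[OF lin_app] and app_neg = lin_neg[OF lin_app] and app_diff = lin_diff[OF lin_app]

instantiation linop :: (complex_lie_algebra) complex_lie_algebra
begin

lift_definition zero_linop :: "'a linop" is "\<lambda>x. 0" by (simp add: lin_iff)

lift_definition plus_linop :: "'a linop \<Rightarrow> 'a linop \<Rightarrow> 'a linop" is "\<lambda>f g x. f x + g x"
  by (simp add: lin_iff scaleC_add_right algebra_simps)

lift_definition uminus_linop :: "'a linop \<Rightarrow> 'a linop" is "\<lambda>f x. - f x"
  by (simp add: lin_iff complex_vs.scale_minus_right)

lift_definition minus_linop :: "'a linop \<Rightarrow> 'a linop \<Rightarrow> 'a linop" is "\<lambda>f g x. f x - g x"
  by (simp add: lin_iff complex_vs.scale_right_diff_distrib algebra_simps)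

lift_definition scaleC_linop :: "complex \<Rightarrow> 'a linop \<Rightarrow> 'a linop" is "\<lambda>c f x. c *\<^sub>C f x"
  by (simp add: lin_iff scaleC_add_right scaleC_scaleC mult.commute)

lift_definition lie_linop :: "'a linop \<Rightarrow> 'a linop \<Rightarrow> 'a linop" is "\<lambda>f g x. f (g x) - g (f x)"
  by (simp add: lin_iff complex_vs.scale_right_diff_distrib algebra_simps)

instance
proof
  fix X Y Z :: "'a linop" and a b :: complex
  note app_simps = plus_linop.rep_eq zero_linop.rep_eq uminus_linop.rep_eq minus_linop.rep_eq
    scaleC_linop.rep_eq lie_linop.rep_eq app_add app_scale app_0 app_neg app_diff
  show "X + Y + Z = X + (Y + Z)" "X + Y = Y + X" "0 + X = X" "- X + X = 0" "X - Y = X + - Y"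
    "a *\<^sub>C (X + Y) = a *\<^sub>C X + a *\<^sub>C Y" "(a + b) *\<^sub>C X = a *\<^sub>C X + b *\<^sub>C X"
    "a *\<^sub>C b *\<^sub>C X = (a * b) *\<^sub>C X" "1 *\<^sub>C X = X"
    "lie (X + Y) Z = lie X Z + lie Y Z" "lie X (Y + Z) = lie X Y + lie X Z"
    "lie (a *\<^sub>C X) Y = a *\<^sub>C lie X Y" "lie X (a *\<^sub>C Y) = a *\<^sub>C lie X Y"
    "lie X X = 0" "lie X (lie Y Z) + lie Y (lie Z X) + lie Z (lie X Y) = 0"
    by (rule linop_eqI; simp add: app_simps scaleC_add_right scaleC_add_left scaleC_scaleC
        scaleC_one complex_vs.scale_right_diff_distrib algebra_simps)+
qed

end

lemmas app_simps = plus_linop.rep_eq zero_linop.rep_eq uminus_linop.rep_eq minus_linop.rep_eq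
    scaleC_linop.rep_eq lie_linop.rep_eq app_add app_scale app_0 app_neg app_diff

lift_definition id_op :: "'m :: complex_lie_algebra linop" is "\<lambda>x. x"
  by (simp add: lin_iff)

lift_definition comp_op :: "'m :: complex_lie_algebra linop \<Rightarrow> 'm linop \<Rightarrow> 'm linop" is "\<lambda>f g x. f (g x)"
  by (simp add: lin_iff)

section \<open>Free modules\<close>

text \<open>Coefficients and formal linear combinations enter the class as abelian Lie algebras, so
  that linearity, spans and the operators \<open>linop\<close> are available for modules as
  well.\<close>

instantiation complex :: complex_lie_algebra
begin

definition scaleC_complex :: "complex \<Rightarrow> complex \<Rightarrow> complex" where
  "scaleC_complex a x = a * x"

definition lie_complex :: "complex \<Rightarrow> complex \<Rightarrow> complex" where
  "lie_complex x y = 0"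

instance
  by standard (simp_all add: scaleC_complex_def lie_complex_def algebra_simps)

end

instantiation poly_mapping :: (type, complex_lie_algebra) complex_lie_algebra
begin

lift_definition scaleC_poly_mapping :: "complex \<Rightarrow> ('a \<Rightarrow>\<^sub>0 'b) \<Rightarrow> 'a \<Rightarrow>\<^sub>0 'b"
  is "\<lambda>c f x. c *\<^sub>C f x"
  by (rule finite_subset) auto

definition lie_poly_mapping :: "('a \<Rightarrow>\<^sub>0 'b) \<Rightarrow> ('a \<Rightarrow>\<^sub>0 'b) \<Rightarrow> 'a \<Rightarrow>\<^sub>0 'b" where
  "lie_poly_mapping x y = 0"

instance
  by standard (auto intro!: poly_mapping_eqI simp: lie_poly_mapping_def scaleC_poly_mapping.rep_eq
      lookup_add scaleC_add_right scaleC_add_left scaleC_scaleC scaleC_one)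

end

abbreviation coef :: "('w \<Rightarrow>\<^sub>0 'b :: zero) \<Rightarrow> 'w \<Rightarrow> 'b" where "coef \<equiv> Poly_Mapping.lookup"
abbreviation supp :: "('w \<Rightarrow>\<^sub>0 'b :: zero) \<Rightarrow> 'w set" where "supp \<equiv> Poly_Mapping.keys"

type_synonym 'w free_mod = "'w \<Rightarrow>\<^sub>0 complex"

definition bas :: "'w \<Rightarrow> 'w free_mod" where
  "bas w = Poly_Mapping.single w 1"

lemma lookup_bas: "coef (bas w) v = (if v = w then 1 else 0)"
  by (simp add: bas_def lookup_single when_def eq_commute)

lemma lookup_scaleC: "coef (c *\<^sub>C t) w = c * coef t w" for t :: "'w free_mod"
  by (simp add: scaleC_poly_mapping.rep_eq scaleC_complex_def)

lemma free_mod_expand: "t = (\<Sum>w\<in>supp t. coef t w *\<^sub>C bas w)"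
proof (rule poly_mapping_eqI)
  fix v
  have "(\<Sum>w\<in>supp t. coef t w * coef (bas w) v) = (\<Sum>w\<in>supp t. if w = v then coef t v else 0)"
    by (rule sum.cong) (auto simp: lookup_bas)
  also have "\<dots> = coef t v" by (simp add: in_keys_iff)
  finally show "coef t v = coef (\<Sum>w\<in>supp t. coef t w *\<^sub>C bas w) v"
    by (simp add: lookup_sum lookup_scaleC)
qed

definition lin_ext :: "('w \<Rightarrow> 'm :: complex_lie_algebra) \<Rightarrow> 'w free_mod \<Rightarrow> 'm" where
  "lin_ext \<phi> t = (\<Sum>w\<in>supp t. coef t w *\<^sub>C \<phi> w)"

lemma lin_ext_superset:
  assumes "finite S" "supp t \<subseteq> S"
  shows "lin_ext \<phi> t = (\<Sum>w\<in>S. coef t w *\<^sub>C \<phi> w)"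
  unfolding lin_ext_def using assms
  by (intro sum.mono_neutral_left) (auto simp: in_keys_iff)

lemma lin_lin_ext: "lin (lin_ext \<phi>)"
  unfolding lin_iff
proof (intro conjI allI)
  fix t u :: "'a free_mod" and c
  let ?S = "supp t \<union> supp u"
  have "lin_ext \<phi> (t + u) = (\<Sum>w\<in>?S. coef (t + u) w *\<^sub>C \<phi> w)"
    by (rule lin_ext_superset) (auto simp: keys_add)
  also have "\<dots> = (\<Sum>w\<in>?S. coef t w *\<^sub>C \<phi> w) + (\<Sum>w\<in>?S. coef u w *\<^sub>C \<phi> w)"
    by (simp add: lookup_add scaleC_add_left sum.distrib)
  also have "\<dots> = lin_ext \<phi> t + lin_ext \<phi> u"
    by (subst (1 2) lin_ext_superset[of ?S]) auto
  finally show "lin_ext \<phi> (t + u) = lin_ext \<phi> t + lin_ext \<phi> u" .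
  have "lin_ext \<phi> (c *\<^sub>C t) = (\<Sum>w\<in>supp t. coef (c *\<^sub>C t) w *\<^sub>C \<phi> w)"
    by (rule lin_ext_superset) (auto simp: in_keys_iff lookup_scaleC)
  also have "\<dots> = c *\<^sub>C lin_ext \<phi> t"
    unfolding lookup_scaleC lin_ext_def complex_vs.scale_sum_right scaleC_scaleC ..
  finally show "lin_ext \<phi> (c *\<^sub>C t) = c *\<^sub>C lin_ext \<phi> t" .
qed

lemma lin_ext_bas [simp]: "lin_ext \<phi> (bas w) = \<phi> w"
  by (subst lin_ext_superset[of "{w}"]) (auto simp: lookup_bas in_keys_iff scaleC_one split: if_splits)

lemma lin_eq_on_bas:
  assumes "lin f" "lin g" "\<And>w. f (bas w) = g (bas w)"
  shows "f t = g t"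
  by (subst (1 2) free_mod_expand) (simp add: lin_sum assms lin_scale)

definition bas_op :: "('w \<Rightarrow> 'w free_mod) \<Rightarrow> 'w free_mod linop" where
  "bas_op \<phi> = Linop (lin_ext \<phi>)"

lemma app_bas_op [simp]: "app (bas_op \<phi>) (bas w) = \<phi> w"
  by (simp add: bas_op_def Linop_inverse lin_lin_ext)

lemma linop_eq_on_bas: "(\<And>w. app X (bas w) = app Y (bas w)) \<Longrightarrow> X = Y"
  by (rule linop_eqI, rule lin_eq_on_bas) auto

section \<open>Lie subalgebras\<close>

inductive_set lie_gen :: "'a :: complex_lie_algebra set \<Rightarrow> 'a set" for S where
  lie_gen_base: "x \<in> S \<Longrightarrow> x \<in> lie_gen S"
| lie_gen_zero: "0 \<in> lie_gen S"
| lie_gen_add: "x \<in> lie_gen S \<Longrightarrow> y \<in> lie_gen S \<Longrightarrow> x + y \<in> lie_gen S"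
| lie_gen_scale: "x \<in> lie_gen S \<Longrightarrow> c *\<^sub>C x \<in> lie_gen S"
| lie_gen_lie: "x \<in> lie_gen S \<Longrightarrow> y \<in> lie_gen S \<Longrightarrow> lie x y \<in> lie_gen S"

definition subalgebra :: "'a :: complex_lie_algebra set \<Rightarrow> bool" where
  "subalgebra K \<longleftrightarrow> complex_vs.subspace K \<and> (\<forall>x\<in>K. \<forall>y\<in>K. lie x y \<in> K)"

lemma subalgebra_lie_gen: "subalgebra (lie_gen S)"
  by (auto simp: subalgebra_def complex_vs.subspace_def intro: lie_gen.intros)

lemma lie_gen_least: "subalgebra K \<Longrightarrow> S \<subseteq> K \<Longrightarrow> lie_gen S \<subseteq> K"
proof
  fix x assume K: "subalgebra K" "S \<subseteq> K" and "x \<in> lie_gen S"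
  from this(3) show "x \<in> K"
    by induction (use K in \<open>auto simp: subalgebra_def complex_vs.subspace_def\<close>)
qed

lemma lie_gen_ad_pow: "x \<in> lie_gen S \<Longrightarrow> y \<in> lie_gen S \<Longrightarrow> (lie x ^^ k) y \<in> lie_gen S"
  by (induction k) (auto intro: lie_gen.intros)

definition lie_hom_on :: "'a :: complex_lie_algebra set \<Rightarrow> ('a \<Rightarrow> 'b :: complex_lie_algebra) \<Rightarrow> bool" where
  "lie_hom_on K \<Phi> \<longleftrightarrow> (\<forall>x\<in>K. \<forall>y\<in>K. \<Phi> (x + y) = \<Phi> x + \<Phi> y \<and> \<Phi> (lie x y) = lie (\<Phi> x) (\<Phi> y))
     \<and> (\<forall>c. \<forall>x\<in>K. \<Phi> (c *\<^sub>C x) = c *\<^sub>C \<Phi> x)"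

lemma lie_hom_on_add: "lie_hom_on K \<Phi> \<Longrightarrow> x \<in> K \<Longrightarrow> y \<in> K \<Longrightarrow> \<Phi> (x + y) = \<Phi> x + \<Phi> y"
  and lie_hom_on_lie: "lie_hom_on K \<Phi> \<Longrightarrow> x \<in> K \<Longrightarrow> y \<in> K \<Longrightarrow> \<Phi> (lie x y) = lie (\<Phi> x) (\<Phi> y)"
  and lie_hom_on_scale: "lie_hom_on K \<Phi> \<Longrightarrow> x \<in> K \<Longrightarrow> \<Phi> (c *\<^sub>C x) = c *\<^sub>C \<Phi> x"
  by (auto simp: lie_hom_on_def)

lemma lie_hom_on_0:
  assumes "lie_hom_on K \<Phi>" "subalgebra K"
  shows "\<Phi> 0 = 0"
  using lie_hom_on_scale[OF assms(1), of 0 0] assms(2)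
  by (simp add: subalgebra_def complex_vs.subspace_def)

lemma lie_hom_on_subset: "lie_hom_on K \<Phi> \<Longrightarrow> K' \<subseteq> K \<Longrightarrow> lie_hom_on K' \<Phi>"
  unfolding lie_hom_on_def by blast

lemma lie_hom_iff: "lie_hom \<Phi> \<longleftrightarrow> lie_hom_on UNIV \<Phi>"
  by (auto simp: lie_hom_def lie_hom_on_def lin_iff)

lemma lie_hom_ad_pow:
  assumes "lie_hom \<Phi>"
  shows "\<Phi> ((lie x ^^ k) y) = (lie (\<Phi> x) ^^ k) (\<Phi> y)"
  using assms by (induction k) (auto simp: lie_hom_def)

lemma lie_hom_on_ad_pow:
  assumes "lie_hom_on K \<Phi>" "subalgebra K" "x \<in> K" "y \<in> K"
  shows "(lie x ^^ k) y \<in> K \<and> \<Phi> ((lie x ^^ k) y) = (lie (\<Phi> x) ^^ k) (\<Phi> y)"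
  using assms by (induction k) (auto simp: lie_hom_on_lie subalgebra_def)

section \<open>The universal property\<close>

primrec term_ext :: "('x \<Rightarrow> 'b :: complex_lie_algebra) \<Rightarrow> 'x lie_term \<Rightarrow> 'b" where
  "term_ext g (TGen x) = g x"
| "term_ext g TZero = 0"
| "term_ext g (TAdd s t) = term_ext g s + term_ext g t"
| "term_ext g (TScale c s) = c *\<^sub>C term_ext g s"
| "term_ext g (TLie s t) = lie (term_ext g s) (term_ext g t)"

lemma term_ext_cong: "lie_eq s t \<Longrightarrow> term_ext g s = term_ext g t"
proof (induction rule: lie_eq.induct)
  case (jacobi s t u)
  then show ?case by (simp add: bracket_jacobi)
qed (simp_all add: scaleC_add_right scaleC_add_left scaleC_scaleC scaleC_one bracket_add_left
    bracket_add_right lie_scaleC_left lie_scaleC_right bracket_self complex_vs.scale_minus_left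
    add.assoc add.commute)

lift_definition free_ext :: "('x \<Rightarrow> 'b :: complex_lie_algebra) \<Rightarrow> 'x free_lie \<Rightarrow> 'b" is term_ext
  by (rule term_ext_cong)

lemma lie_hom_free_ext: "lie_hom (free_ext g)"
  unfolding lie_hom_def lin_iff by (intro conjI allI; transfer; simp)

lemma free_ext_gen [simp]: "free_ext g (free_gen x) = g x"
  by transfer simp

lemma free_lie_gen: "x \<in> lie_gen (range free_gen)"
proof (induction x rule: free_lie.abs_induct)
  case (1 t)
  then show ?case
  proof (induction t)
    case (TGen x)
    then show ?case by (metis free_gen.abs_eq lie_gen_base rangeI)
  next
    case TZero
    then show ?case by (metis zero_free_lie.abs_eq lie_gen_zero)
  next
    case (TAdd s t)
    then show ?case by (metis plus_free_lie.abs_eq lie_gen_add)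
  next
    case (TScale c s)
    then show ?case by (metis scaleC_free_lie.abs_eq lie_gen_scale)
  next
    case (TLie s t)
    then show ?case by (metis lie_free_lie.abs_eq lie_gen_lie)
  qed
qed

lemma lie_hom_kernel_ideal:
  assumes "lie_hom \<Phi>" "\<And>x. x \<in> S \<Longrightarrow> \<Phi> x = 0" "x \<in> lie_ideal_hull S"
  shows "\<Phi> x = 0"
proof -
  have "lie_ideal {x. \<Phi> x = 0}"
    using assms(1) by (auto simp: lie_ideal_def lie_hom_def complex_vs.subspace_def lin_add lin_scale lin_0)
  moreover have "S \<subseteq> {x. \<Phi> x = 0}" using assms(2) by blast
  ultimately show ?thesis using assms(3) unfolding lie_ideal_hull_def by blast
qed

section \<open>Free families\<close>

definition push :: "'a \<Rightarrow> 'a list free_mod linop" where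
  "push a = bas_op (\<lambda>w. bas (a # w))"

lemma app_push_bas [simp]: "app (push a) (bas w) = bas (a # w)"
  by (simp add: push_def)

text \<open>Applying \<open>lie Z (push a)\<close> to the word w gives the value of Z at
  \<open>a # w\<close> minus the letter times the value at w, so induction on words applies. The
  relations of the module below are reduced in this way to commutators with single letters.\<close>

lemma word_op_zeroI:
  assumes "app Z (bas []) = 0" "\<And>a. lie Z (push a) = 0"
  shows "Z = 0"
proof (rule linop_eq_on_bas)
  fix w
  show "app Z (bas w) = app 0 (bas w)"
  proof (induction w)
    case Nil
    then show ?case using assms(1) by (simp add: app_simps)
  next
    case (Cons a w)
    have "app (lie Z (push a)) (bas w) = 0" using assms(2) by (simp add: app_simps)
    then show ?case using Cons by (simp add: app_simps)
  qed
qed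

lemma word_op_eqI:
  assumes "app Y (bas []) = app Z (bas [])" "\<And>a. lie Y (push a) = lie Z (push a)"
  shows "Y = Z"
  using word_op_zeroI[of "Y - Z"] assms by (simp add: app_simps lie_diff_left)

text \<open>The derivation of the free associative algebra that sends the letter \<open>a\<close> to
  \<open>c a\<close> times the letter \<open>g a\<close>.\<close>

primrec word_deriv :: "('a \<Rightarrow> complex) \<Rightarrow> ('a \<Rightarrow> 'a) \<Rightarrow> 'a list \<Rightarrow> 'a list free_mod" where
  "word_deriv c g [] = 0"
| "word_deriv c g (a # w) = c a *\<^sub>C bas (g a # w) + app (push a) (word_deriv c g w)"

definition deriv_op :: "('a \<Rightarrow> complex) \<Rightarrow> ('a \<Rightarrow> 'a) \<Rightarrow> 'a list free_mod linop" where
  "deriv_op c g = bas_op (word_deriv c g)"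

lemma deriv_op_Nil [simp]: "app (deriv_op c g) (bas []) = 0"
  by (simp add: deriv_op_def)

lemma lie_deriv_push: "lie (deriv_op c g) (push a) = c a *\<^sub>C push (g a)"
  by (rule linop_eq_on_bas) (simp add: app_simps deriv_op_def)

text \<open>The homomorphism from the free associative algebra on the letters to operators that
  sends a letter \<open>a\<close> to \<open>A a\<close>.\<close>

definition word_eval :: "('a \<Rightarrow> 'm :: complex_lie_algebra linop) \<Rightarrow> 'a list free_mod \<Rightarrow> 'm linop" where
  "word_eval A = lin_ext (\<lambda>w. foldr (\<lambda>a. comp_op (A a)) w id_op)"

lemma lin_word_eval: "lin (word_eval A)"
  by (simp add: word_eval_def lin_lin_ext)

lemma word_eval_Nil [simp]: "word_eval A (bas []) = id_op"
  by (simp add: word_eval_def)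

text \<open>These operators on words become left multiplications after \<open>word_eval A\<close>.
  They include the letters and are closed under brackets, so \<open>op_eval A\<close> is a
  homomorphism on the whole Lie algebra generated by the letters, without first identifying that
  algebra as free.\<close>

definition evaluable :: "('a \<Rightarrow> 'm :: complex_lie_algebra linop) \<Rightarrow> 'a list free_mod linop set" where
  "evaluable A = {X. \<exists>B. \<forall>t. word_eval A (app X t) = comp_op B (word_eval A t)}"

definition op_eval :: "('a \<Rightarrow> 'm :: complex_lie_algebra linop) \<Rightarrow> 'a list free_mod linop \<Rightarrow> 'm linop" where
  "op_eval A X = word_eval A (app X (bas []))"

lemma comp_op_simps:
  "comp_op X id_op = X" "comp_op (comp_op X Y) Z = comp_op X (comp_op Y Z)"
  "comp_op (X + Y) Z = comp_op X Z + comp_op Y Z" "comp_op X (Y + Z) = comp_op X Y + comp_op X Z"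
  "comp_op (X - Y) Z = comp_op X Z - comp_op Y Z"
  "comp_op (c *\<^sub>C X) Z = c *\<^sub>C comp_op X Z" "comp_op X (c *\<^sub>C Z) = c *\<^sub>C comp_op X Z"
  "comp_op 0 Z = 0"
  by (rule linop_eqI; simp add: app_simps comp_op.rep_eq id_op.rep_eq)+

lemma lie_comp_op: "lie X Y = comp_op X Y - comp_op Y X"
  by (rule linop_eqI) (simp add: app_simps comp_op.rep_eq)

text \<open>For the empty word the defining equation of \<open>evaluable\<close> says that the
  multiplier \<open>B\<close> is \<open>op_eval A X\<close>.\<close>

lemma word_eval_app:
  assumes "X \<in> evaluable A"
  shows "word_eval A (app X t) = comp_op (op_eval A X) (word_eval A t)"
  using assms unfolding evaluable_def op_eval_def by (auto simp: comp_op_simps)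

lemma subalgebra_evaluable: "subalgebra (evaluable A)"
  unfolding subalgebra_def complex_vs.subspace_def
proof (intro conjI ballI allI)
  note [simp] = lin_word_eval[THEN lin_add] lin_word_eval[THEN lin_diff] lin_word_eval[THEN lin_scale]
    lin_word_eval[THEN lin_0]
  show "0 \<in> evaluable A"
    unfolding evaluable_def by (auto simp: app_simps comp_op_simps intro!: exI[of _ 0])
  fix X assume X: "X \<in> evaluable A"
  show "c *\<^sub>C X \<in> evaluable A" for c
    unfolding evaluable_def
    by (auto simp: app_simps comp_op_simps word_eval_app[OF X] intro!: exI[of _ "c *\<^sub>C op_eval A X"])
  fix Y assume Y: "Y \<in> evaluable A"
  show "X + Y \<in> evaluable A"
    unfolding evaluable_def
    by (auto simp: app_simps comp_op_simps word_eval_app[OF X] word_eval_app[OF Y]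
        intro!: exI[of _ "op_eval A X + op_eval A Y"])
  show "lie X Y \<in> evaluable A"
    unfolding evaluable_def
    by (auto simp: app_simps comp_op_simps lie_comp_op[of "op_eval A X"] word_eval_app[OF X] word_eval_app[OF Y]
        intro!: exI[of _ "lie (op_eval A X) (op_eval A Y)"])
qed

lemma lie_hom_on_op_eval: "lie_hom_on (evaluable A) (op_eval A)"
proof -
  note [simp] = lin_word_eval[THEN lin_add] lin_word_eval[THEN lin_diff] lin_word_eval[THEN lin_scale]
  have "op_eval A (lie X Y) = lie (op_eval A X) (op_eval A Y)"
    if X: "X \<in> evaluable A" and Y: "Y \<in> evaluable A" for X Y
  proof -
    have "op_eval A (lie X Y) = word_eval A (app X (app Y (bas []))) - word_eval A (app Y (app X (bas [])))"
      unfolding op_eval_def by (simp add: app_simps)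
    then show ?thesis
      by (simp add: word_eval_app[OF X] word_eval_app[OF Y] comp_op_simps lie_comp_op)
  qed
  then show ?thesis
    unfolding lie_hom_on_def by (auto simp: op_eval_def app_simps)
qed

lemma push_evaluable: "push a \<in> evaluable A"
proof -
  have "word_eval A (app (push a) t) = comp_op (A a) (word_eval A t)" for t
    by (rule lin_eq_on_bas)
      (auto simp: lin_iff app_simps comp_op_simps lin_word_eval[THEN lin_add]
        lin_word_eval[THEN lin_scale], simp add: word_eval_def)
  then show ?thesis unfolding evaluable_def by blast
qed

lemma op_eval_push [simp]: "op_eval A (push a) = A a"
  by (simp add: op_eval_def word_eval_def comp_op_simps)

text \<open>The operators act on one fixed space, which is large enough to contain the free associative
  algebra on the indices of the family and so makes the condition equivalent to freeness.\<close>

definition free_family :: "(nat \<Rightarrow> 'a :: complex_lie_algebra) \<Rightarrow> nat set \<Rightarrow> bool" where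
  "free_family x J \<longleftrightarrow> (\<forall>A :: nat \<Rightarrow> nat list free_mod linop.
     \<exists>\<Phi>. lie_hom_on (lie_gen (x ` J)) \<Phi> \<and> (\<forall>j\<in>J. \<Phi> (x j) = A j))"

lemma lie_hom_on_image_mem:
  assumes \<Phi>: "lie_hom_on (lie_gen S) \<Phi>" and K: "subalgebra K"
    and S: "\<And>x. x \<in> S \<Longrightarrow> \<Phi> x \<in> K" and x: "x \<in> lie_gen S"
  shows "\<Phi> x \<in> K"
  using x
proof induction
  case lie_gen_zero
  then show ?case
    using lie_hom_on_0[OF \<Phi> subalgebra_lie_gen] K by (simp add: subalgebra_def complex_vs.subspace_0)
qed (use \<Phi> K S in \<open>auto simp: lie_hom_on_add lie_hom_on_scale lie_hom_on_lie subalgebra_def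
      complex_vs.subspace_def\<close>)

lemma lie_hom_on_comp:
  assumes "lie_hom_on K \<Phi>" "lie_hom_on K' \<Psi>" "\<And>x. x \<in> K \<Longrightarrow> \<Phi> x \<in> K'"
  shows "lie_hom_on K (\<lambda>x. \<Psi> (\<Phi> x))"
  using assms unfolding lie_hom_on_def by auto

text \<open>Letters are the universal choice: any other family of operators is obtained from them by
  composing with \<open>op_eval\<close>.\<close>

lemma free_familyI_push:
  assumes \<Phi>: "lie_hom_on (lie_gen (x ` J)) \<Phi>" and push: "\<And>j. j \<in> J \<Longrightarrow> \<Phi> (x j) = push j"
  shows "free_family x J"
  unfolding free_family_def
proof
  fix A :: "nat \<Rightarrow> nat list free_mod linop"
  have "\<Phi> y \<in> evaluable A" if "y \<in> lie_gen (x ` J)" for y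
    by (rule lie_hom_on_image_mem[OF \<Phi> subalgebra_evaluable _ that]) (auto simp: push push_evaluable)
  then have "lie_hom_on (lie_gen (x ` J)) (\<lambda>y. op_eval A (\<Phi> y))"
    by (rule lie_hom_on_comp[OF \<Phi> lie_hom_on_op_eval])
  moreover have "\<forall>j\<in>J. op_eval A (\<Phi> (x j)) = A j" by (simp add: push)
  ultimately show "\<exists>\<Phi>. lie_hom_on (lie_gen (x ` J)) \<Phi> \<and> (\<forall>j\<in>J. \<Phi> (x j) = A j)" by blast
qed

section \<open>Lazard elimination\<close>

text \<open>The pair (j, k) stands for k-fold bracketing of \<open>x j\<close> with
  \<open>x i\<close>. Coding pairs as natural numbers keeps the index type, so that eliminations can
  be iterated.\<close>

definition elim_index :: "nat \<Rightarrow> nat set \<Rightarrow> nat set" where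
  "elim_index i J = prod_encode ` ((J - {i}) \<times> UNIV)"

text \<open>The binary operation is a parameter: with \<open>lie\<close> this gives the new
  generators, with addition their weights.\<close>

definition elim :: "('a \<Rightarrow> 'a \<Rightarrow> 'a) \<Rightarrow> nat \<Rightarrow> (nat \<Rightarrow> 'a) \<Rightarrow> nat \<Rightarrow> 'a" where
  "elim b i x = (\<lambda>l. case prod_decode l of (j, k) \<Rightarrow> (b (x i) ^^ k) (x j))"

lemma elim_encode [simp]: "elim b i x (prod_encode (j, k)) = (b (x i) ^^ k) (x j)"
  by (simp add: elim_def)

lemma elim_gen_subset:
  assumes "i \<in> J"
  shows "lie_gen (elim lie i x ` elim_index i J) \<subseteq> lie_gen (x ` J)"
proof (rule lie_gen_least[OF subalgebra_lie_gen])
  show "elim lie i x ` elim_index i J \<subseteq> lie_gen (x ` J)"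
    unfolding elim_index_def
    using assms lie_gen_ad_pow[OF lie_gen_base lie_gen_base, of "x i" "x ` J"] by auto
qed

text \<open>On words in the letters (j, k), the derivation that takes (j, k) to (j, k + 1) serves as
  the image of \<open>x i\<close>, and the letter (j, 0) as the image of \<open>x j\<close>. Then
  the new generator with index (j, k) becomes the letter (j, k).\<close>

lemma free_family_elim:
  assumes free: "free_family x J" and i: "i \<in> J"
  shows "free_family (elim lie i x) (elim_index i J)"
proof -
  define shift :: "nat \<Rightarrow> nat" where "shift = (\<lambda>l. case prod_decode l of (j, k) \<Rightarrow> prod_encode (j, Suc k))"
  let ?D = "deriv_op (\<lambda>_. 1) shift"
  obtain \<Phi> where \<Phi>: "lie_hom_on (lie_gen (x ` J)) \<Phi>"
    and \<Phi>x: "\<And>j. j \<in> J \<Longrightarrow> \<Phi> (x j) = (if j = i then ?D else push (prod_encode (j, 0)))"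
    using free[unfolded free_family_def, rule_format, of "\<lambda>j. if j = i then ?D else push (prod_encode (j, 0))"]
    by blast
  have D: "(lie ?D ^^ k) (push (prod_encode (j, 0))) = push (prod_encode (j, k))" for j k
    by (induction k) (simp_all add: lie_deriv_push shift_def scaleC_one)
  show ?thesis
  proof (rule free_familyI_push)
    show "lie_hom_on (lie_gen (elim lie i x ` elim_index i J)) \<Phi>"
      by (rule lie_hom_on_subset[OF \<Phi> elim_gen_subset[OF i]])
    fix l assume "l \<in> elim_index i J"
    then obtain j k where l: "l = prod_encode (j, k)" and j: "j \<in> J" "j \<noteq> i"
      by (auto simp: elim_index_def)
    have "\<Phi> ((lie (x i) ^^ k) (x j)) = (lie (\<Phi> (x i)) ^^ k) (\<Phi> (x j))"
      using lie_hom_on_ad_pow[OF \<Phi> subalgebra_lie_gen, of "x i" "x j"] i j by (simp add: lie_gen_base)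
    then show "\<Phi> (elim lie i x l) = push l"
      using i j by (simp add: l \<Phi>x D)
  qed
qed

text \<open>Send \<open>x i\<close> to the identity operator and all other generators to 0. Every
  new generator contains some \<open>x j\<close> with \<open>j \<noteq> i\<close> and is killed,
  whereas the identity is not 0.\<close>

lemma not_in_elim_gen:
  assumes free: "free_family x J" and i: "i \<in> J"
  shows "x i \<notin> lie_gen (elim lie i x ` elim_index i J)"
proof
  assume mem: "x i \<in> lie_gen (elim lie i x ` elim_index i J)"
  obtain \<Phi> :: "_ \<Rightarrow> nat list free_mod linop" where \<Phi>: "lie_hom_on (lie_gen (x ` J)) \<Phi>"
    and \<Phi>x: "\<And>j. j \<in> J \<Longrightarrow> \<Phi> (x j) = (if j = i then id_op else 0)"
    using free[unfolded free_family_def, rule_format, of "\<lambda>j. if j = i then id_op else 0"] by blast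
  have "\<Phi> y \<in> {0}" if "y \<in> lie_gen (elim lie i x ` elim_index i J)" for y
  proof (rule lie_hom_on_image_mem[OF _ _ _ that])
    show "lie_hom_on (lie_gen (elim lie i x ` elim_index i J)) \<Phi>"
      by (rule lie_hom_on_subset[OF \<Phi> elim_gen_subset[OF i]])
    show "subalgebra {0 :: nat list free_mod linop}"
      by (auto simp: subalgebra_def complex_vs.subspace_def)
    fix y assume "y \<in> elim lie i x ` elim_index i J"
    then obtain j k where y: "y = (lie (x i) ^^ k) (x j)" and j: "j \<in> J" "j \<noteq> i"
      by (force simp: elim_index_def)
    have "(lie id_op ^^ k) 0 = (0 :: nat list free_mod linop)" by (induction k) auto
    moreover have "\<Phi> y = (lie (\<Phi> (x i)) ^^ k) (\<Phi> (x j))"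
      unfolding y using lie_hom_on_ad_pow[OF \<Phi> subalgebra_lie_gen, of "x i" "x j"] i j
      by (simp add: lie_gen_base)
    ultimately show "\<Phi> y \<in> {0}" using i j by (simp add: \<Phi>x)
  qed
  then have "id_op = (0 :: nat list free_mod linop)" using mem \<Phi>x[OF i] by auto
  then have "app id_op (bas []) = (app 0 (bas []) :: nat list free_mod)" by simp
  then have "bas [] = (0 :: nat list free_mod)" by (simp add: id_op.rep_eq app_simps)
  from arg_cong[OF this, of "\<lambda>t. coef t []"]
  show False by (simp add: lookup_bas)
qed

section \<open>A faithful module\<close>

text \<open>
  The letter \<open>(i, k)\<close> stands, up to a scalar, for \<open>ad(e\<^sub>r)\<^sup>k e\<^sub>i\<close>. The letters \<open>(i, 0), \<dots>, (i, s i)\<close> span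
  an irreducible module for the copy of \<open>sl\<^sub>2\<close> of the real root, and the other letters are killed
  by it. On words \<open>E\<close>, \<open>Fr\<close> and \<open>H j\<close> act as derivations.
\<close>

locale one_real_root =
  fixes A :: "'i :: countable \<Rightarrow> 'i \<Rightarrow> real" and r :: 'i and s :: "'i \<Rightarrow> nat" and \<mu> :: "'i \<Rightarrow> real"
  assumes A_rr: "A r r = 2"
    and A_ri: "i \<noteq> r \<Longrightarrow> A r i = - real (s i)"
    and A_ir: "i \<noteq> r \<Longrightarrow> A i r = - \<mu> i * real (s i)"
    and A_neg: "i \<noteq> r \<Longrightarrow> j \<noteq> r \<Longrightarrow> A i j < 0"
    and \<mu>_pos: "i \<noteq> r \<Longrightarrow> 0 < \<mu> i"
begin

definition valid :: "'i \<times> nat \<Rightarrow> bool" where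
  "valid = (\<lambda>(i, k). i \<noteq> r \<and> k \<le> s i)"

text \<open>Coefficients of the sl(2)-module with lowest vector (i, 0): if lowering multiplies by k,
  raising can multiply by s i - k. The factor 0 at k = s i ends the string.\<close>

definition E :: "('i \<times> nat) list free_mod linop" where
  "E = deriv_op (\<lambda>(i, k). if valid (i, k) then of_nat (s i - k) else 0) (\<lambda>(i, k). (i, Suc k))"

definition Fr :: "('i \<times> nat) list free_mod linop" where
  "Fr = deriv_op (\<lambda>(i, k). if valid (i, k) then of_nat k else 0) (\<lambda>(i, k). (i, k - 1))"

definition H :: "'i \<Rightarrow> ('i \<times> nat) list free_mod linop" where
  "H j = deriv_op (\<lambda>(i, k). if valid (i, k) then of_real (A j i + real k * A j r) else 0) (\<lambda>a. a)"

text \<open>The commutator of \<open>f\<^sub>i\<close> with a letter. It vanishes beyond \<open>k = 1\<close>, because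
  \<open>[f\<^sub>i, ad(e\<^sub>r)\<^sup>k e\<^sub>i] = - ad(e\<^sub>r)\<^sup>k h\<^sub>i\<close>.\<close>

definition \<beta> :: "'i \<Rightarrow> 'i \<times> nat \<Rightarrow> ('i \<times> nat) list free_mod linop" where
  "\<beta> i a = (if a = (i, 0) \<and> valid a then - H i
     else if a = (i, 1) \<and> valid a then - (of_real (\<mu> i) *\<^sub>C E) else 0)"

text \<open>\<open>F i\<close> is determined by killing the empty word and having the commutators
  \<open>\<beta> i a\<close> with the letters. It is no derivation: these commutators are operators
  acting on the rest of the word.\<close>

primrec lowering :: "'i \<Rightarrow> ('i \<times> nat) list \<Rightarrow> ('i \<times> nat) list free_mod" where
  "lowering i [] = 0"
| "lowering i (a # w) = app (push a) (lowering i w) + app (\<beta> i a) (bas w)"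

definition F :: "'i \<Rightarrow> ('i \<times> nat) list free_mod linop" where
  "F i = bas_op (lowering i)"

section \<open>Commutation relations of the module\<close>

lemma vac [simp]: "app E (bas []) = 0" "app Fr (bas []) = 0" "app (H j) (bas []) = 0" "app (F i) (bas []) = 0"
  by (simp_all add: E_def Fr_def H_def F_def)

lemma lie_push:
  "lie E (push (i, k)) = (if valid (i, k) then of_nat (s i - k) else 0) *\<^sub>C push (i, Suc k)"
  "lie Fr (push (i, k)) = (if valid (i, k) then of_nat k else 0) *\<^sub>C push (i, k - 1)"
  "lie (H j) (push (i, k)) = (if valid (i, k) then of_real (A j i + real k * A j r) else 0) *\<^sub>C push (i, k)"
  by (simp_all add: E_def Fr_def H_def lie_deriv_push)

lemma lie_F_push: "lie (F i) (push a) = \<beta> i a"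
  by (rule linop_eq_on_bas) (simp add: app_simps F_def)

lemmas scale_merge = complex_vs.scale_left_diff_distrib[symmetric]
  scaleC_add_left[symmetric]

lemma scale_cong: "a = b \<Longrightarrow> a *\<^sub>C x = b *\<^sub>C (x :: 'm :: complex_lie_algebra)"
  by simp

text \<open>On the letter (i, k), k (s i - k + 1) - (s i - k) (k + 1) = 2 k - s i, which is its
  weight for \<open>H r\<close>.\<close>

lemma lie_E_Fr: "lie E Fr = H r"
proof (rule word_op_eqI)
  fix a :: "'i \<times> nat"
  obtain i k where a: "a = (i, k)" by force
  show "lie (lie E Fr) (push a) = lie (H r) (push a)"
  proof (cases "valid (i, k)")
    case False
    then show ?thesis by (simp add: a lie_lie_left lie_push)
  next
    case True
    have "lie E (lie Fr (push a)) = (of_nat k * (of_nat (s i) - of_nat k + 1)) *\<^sub>C push a"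
      using True by (cases k) (auto simp: a lie_push lie_scaleC_right scaleC_scaleC valid_def of_nat_diff)
    moreover have "lie Fr (lie E (push a)) = ((of_nat (s i) - of_nat k) * (of_nat k + 1)) *\<^sub>C push a"
      using True
      by (cases "k = s i") (auto simp: a lie_push lie_scaleC_right scaleC_scaleC valid_def of_nat_diff bracket_add_right lie_diff_right algebra_simps)
    moreover have "lie (H r) (push a) = (2 * of_nat k - of_nat (s i)) *\<^sub>C push a"
      using True by (simp add: a lie_push A_rr A_ri valid_def)
    ultimately show ?thesis
      unfolding lie_lie_left by (simp only: scale_merge, intro scale_cong, simp add: bracket_add_right lie_diff_right algebra_simps)
  qed
qed (simp add: app_simps)

lemma lie_H_H: "lie (H i) (H j) = 0"
proof (rule word_op_eqI)
  fix a show "lie (lie (H i) (H j)) (push a) = lie 0 (push a)"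
    by (cases a) (simp add: lie_lie_left lie_push lie_scaleC_right scaleC_scaleC mult.commute)
qed (simp add: app_simps)

lemma lie_H_E: "lie (H j) E = complex_of_real (A j r) *\<^sub>C E"
proof (rule word_op_eqI)
  fix a :: "'i \<times> nat"
  obtain i k where a: "a = (i, k)" by force
  show "lie (lie (H j) E) (push a) = lie (complex_of_real (A j r) *\<^sub>C E) (push a)"
  proof (cases "valid (i, k) \<and> k < s i")
    case True
    then have "valid (i, Suc k)" by (auto simp: valid_def)
    with True show ?thesis
      by (simp add: a lie_lie_left lie_push lie_scaleC_right lie_scaleC_left scaleC_scaleC
          bracket_add_right lie_diff_right algebra_simps)
  next
    case False
    then have "lie E (push a) = 0" by (auto simp: a lie_push valid_def)
    then show ?thesis
      by (auto simp: lie_lie_left lie_scaleC_left) (auto simp: a lie_push lie_scaleC_right)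
  qed
qed (simp add: app_simps)

lemma lie_H_Fr: "lie (H j) Fr = - (complex_of_real (A j r) *\<^sub>C Fr)"
proof (rule word_op_eqI)
  fix a :: "'i \<times> nat"
  obtain i k where a: "a = (i, k)" by force
  show "lie (lie (H j) Fr) (push a) = lie (- (complex_of_real (A j r) *\<^sub>C Fr)) (push a)"
  proof (cases "valid (i, k) \<and> 0 < k")
    case True
    then have "valid (i, k - 1)" by (auto simp: valid_def)
    with True show ?thesis
      by (simp add: a lie_lie_left lie_push lie_scaleC_right lie_scaleC_left scaleC_scaleC
          bracket_add_right lie_diff_right algebra_simps of_nat_diff)
  next
    case False
    then have "lie Fr (push a) = 0" by (auto simp: a lie_push)
    then show ?thesis
      by (auto simp: lie_lie_left lie_scaleC_left) (auto simp: a lie_push lie_scaleC_right)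
  qed
qed (simp add: app_simps)

lemma lie_H_F:
  assumes i: "i \<noteq> r"
  shows "lie (H j) (F i) = - (complex_of_real (A j i) *\<^sub>C F i)"
proof (rule word_op_eqI)
  fix a :: "'i \<times> nat"
  obtain l k where a: "a = (l, k)" by force
  have v: "valid (i, 0)" using i by (simp add: valid_def)
  \<comment> \<open>The letter (i, 0) has weight \<open>A j i\<close> and goes to a multiple of
    \<open>H i\<close>, of weight 0. The letter (i, 1) has weight \<open>A j i + A j r\<close> and
    goes to a multiple of \<open>E\<close>, of weight \<open>A j r\<close>. Either way
    \<open>F i\<close> lowers the weight by \<open>A j i\<close>.\<close>
  have ji: "- lie (H j) (lie (F i) (push a)) + lie (F i) (lie (H j) (push a)) = complex_of_real (A j i) *\<^sub>C \<beta> i a"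
    using v by (auto simp: a lie_push lie_F_push \<beta>_def lie_H_H lie_H_E lie_scaleC_right
        scaleC_scaleC bracket_add_right lie_diff_right algebra_simps complex_vs.scale_minus_right)
  show "lie (lie (H j) (F i)) (push a) = lie (- (complex_of_real (A j i) *\<^sub>C F i)) (push a)"
    using arg_cong[OF ji, of uminus] by (simp add: lie_lie_left lie_scaleC_left lie_F_push bracket_add_right lie_diff_right algebra_simps)
qed (simp add: app_simps)

text \<open>This relation explains the second value of \<open>\<beta>\<close>: on the letter (i, 0)
  it says that s i times \<open>\<beta> i (i, 1)\<close> equals the bracket of \<open>E\<close> with
  \<open>- H i\<close>, which is -\<mu> i s i times \<open>E\<close>.\<close>

lemma lie_E_F:
  assumes i: "i \<noteq> r"
  shows "lie E (F i) = 0"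
proof (rule word_op_eqI)
  fix a :: "'i \<times> nat"
  obtain l k where a: "a = (l, k)" by force
  have v: "valid (i, 0)" using i by (simp add: valid_def)
  have EH: "lie E (H i) = complex_of_real (\<mu> i * real (s i)) *\<^sub>C E"
    using lie_H_E[of i] lie_anticommute[of E "H i"] i by (simp add: A_ir complex_vs.scale_minus_left)
  have 1: "valid (i, 1) \<longleftrightarrow> 1 \<le> s i" using i by (simp add: valid_def)
  show "lie (lie E (F i)) (push a) = lie 0 (push a)"
  proof (cases "l = i")
    case False
    then show ?thesis by (simp add: a lie_lie_left lie_push lie_F_push \<beta>_def lie_scaleC_right)
  next
    case True
    consider "k = 0" | "k = 1" | "2 \<le> k" by linarith
    then show ?thesis
    proof cases
      case 1
      then show ?thesis using True v \<open>valid (i, 1) \<longleftrightarrow> 1 \<le> s i\<close>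
        by (cases "s i = 0")
          (auto simp: a lie_lie_left lie_push lie_F_push \<beta>_def lie_scaleC_right EH scaleC_scaleC
            complex_vs.scale_minus_right mult.commute)
    qed (use True in \<open>auto simp: a lie_lie_left lie_push lie_F_push \<beta>_def lie_scaleC_right bracket_self\<close>)
  qed
qed (simp add: app_simps)

text \<open>The scalar is a falling factorial. For k > s i it contains the factor with l = s i,
  which is 0, so the formula also covers the end of the string.\<close>

lemma ad_E_push:
  assumes "i \<noteq> r"
  shows "(lie E ^^ k) (push (i, 0)) = complex_of_nat (\<Prod>l<k. s i - l) *\<^sub>C push (i, k)"
proof (induction k)
  case 0
  then show ?case by (simp add: scaleC_one)
next
  case (Suc k)
  show ?case
  proof (cases "k \<le> s i")
    case True
    then show ?thesis using Suc assms by (simp add: lie_scaleC_right lie_push scaleC_scaleC valid_def mult.commute)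
  next
    case False
    then have p: "(\<Prod>l<k. s i - l) = 0" by auto
    show ?thesis unfolding funpow.simps o_def Suc p prod.lessThan_Suc by simp
  qed
qed

section \<open>The Serre relation for the lowering operators\<close>

lemma lie_Fr_E: "lie Fr E = - H r"
  using lie_E_Fr lie_anticommute[of Fr E] by simp

lemma lie_Fr_H: "lie Fr (H j) = complex_of_real (A j r) *\<^sub>C Fr"
  using lie_H_Fr[of j] lie_anticommute[of Fr "H j"] by simp

lemma ad_Fr_vac: "app ((lie Fr ^^ k) (F i)) (bas []) = 0"
  by (induction k) (simp_all add: app_simps)

text \<open>The commutator of \<open>ad(f\<^sub>r)\<^sup>k f\<^sub>i\<close> with the letter \<open>(i, j)\<close> up to sign and \<open>k!\<close>. At \<open>k = s i + 1\<close>
  the only term with \<open>j \<le> s i\<close> has the factor \<open>s i - k + 1 = 0\<close>; this is the Serre relation.\<close>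

definition \<gamma> :: "'i \<Rightarrow> nat \<Rightarrow> nat \<Rightarrow> ('i \<times> nat) list free_mod linop" where
  "\<gamma> i k j = (if j \<le> s i then
     (if Suc j = k then complex_of_real (\<mu> i * (real (s i) - real k + 1)) *\<^sub>C Fr
      else if j = k then H i + complex_of_real (real k * \<mu> i) *\<^sub>C H r
      else if j = Suc k then complex_of_real (real (Suc k) * \<mu> i) *\<^sub>C E else 0) else 0)"

text \<open>The recursion that the Jacobi identity imposes on the commutators of the iterated
  brackets of \<open>Fr\<close> and \<open>F i\<close> with the letters. The values -1, 0, 1, 2 of j
  - k are those for which some \<gamma> in it can be nonzero.\<close>

lemma \<gamma>_step:
  assumes i: "i \<noteq> r" and j: "j \<le> s i"
  shows "lie Fr (\<gamma> i k j) - of_nat j *\<^sub>C \<gamma> i k (j - 1) = - (of_nat (Suc k) *\<^sub>C \<gamma> i (Suc k) j)"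
proof -
  consider "j = k" | "j = Suc k" | "j = Suc (Suc k)" | "Suc j = k" | "Suc j < k" | "Suc (Suc k) < j"
    by linarith
  then show ?thesis
  proof cases
    case 1
    then show ?thesis using i j
      by (cases k) (auto simp: \<gamma>_def lie_scaleC_right lie_Fr_H A_rr A_ir
          scaleC_scaleC bracket_add_right lie_diff_right algebra_simps,
        simp only: scale_merge, rule scale_cong, simp)
  next
    case 2
    then show ?thesis using i j
      by (auto simp: \<gamma>_def lie_scaleC_right lie_Fr_E scaleC_add_right complex_vs.scale_minus_right
          scaleC_scaleC bracket_add_right lie_diff_right algebra_simps)
  next
    case 3
    then show ?thesis using i j
      by (auto simp: \<gamma>_def scaleC_scaleC bracket_add_right lie_diff_right algebra_simps)
  next
    case 4
    then show ?thesis using i j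
      by (cases j) (auto simp: \<gamma>_def lie_scaleC_right bracket_self)
  qed (use j in \<open>auto simp: \<gamma>_def\<close>)
qed

text \<open>Each step of the induction brings the factor -(k + 1) of \<open>\<gamma>_step\<close>,
  hence the sign and the factorial.\<close>

lemma lie_ad_Fr_F_push:
  assumes i: "i \<noteq> r"
  shows "lie ((lie Fr ^^ k) (F i)) (push (l, j)) =
    (if l = i then - ((- 1) ^ k * of_nat (fact k)) *\<^sub>C \<gamma> i k j else 0)"
proof (induction k arbitrary: j)
  case 0
  then show ?case using i
    by (auto simp: lie_F_push \<beta>_def \<gamma>_def valid_def complex_vs.scale_minus_left scaleC_one)
next
  case (Suc k)
  let ?Z = "(lie Fr ^^ k) (F i)" and ?c = "- ((- 1) ^ k * complex_of_nat (fact k))"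
  have step: "lie ((lie Fr ^^ Suc k) (F i)) (push (l, j)) = lie Fr (lie ?Z (push (l, j))) - lie ?Z (lie Fr (push (l, j)))"
    by (simp add: lie_lie_left)
  show ?case
  proof (cases "l = i")
    case False
    then show ?thesis unfolding step by (simp add: Suc lie_push lie_scaleC_right)
  next
    case True
    then have IH: "lie ?Z (push (i, j)) = ?c *\<^sub>C \<gamma> i k j" for j
      using Suc[of j] by simp
    show ?thesis
    proof (cases "j \<le> s i")
      case False
      then have "\<gamma> i k' j = 0" for k' by (simp add: \<gamma>_def)
      then show ?thesis unfolding step using True False by (simp add: IH lie_push valid_def)
    next
      case j: True
      then have v: "valid (i, j)" using i by (simp add: valid_def)
      have "lie ((lie Fr ^^ Suc k) (F i)) (push (l, j)) = ?c *\<^sub>C (lie Fr (\<gamma> i k j) - of_nat j *\<^sub>C \<gamma> i k (j - 1))"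
        unfolding step using True v
        by (simp add: IH lie_push lie_scaleC_right complex_vs.scale_right_diff_distrib scaleC_scaleC mult.commute)
      also have "\<dots> = - ((- 1) ^ Suc k * of_nat (fact (Suc k))) *\<^sub>C \<gamma> i (Suc k) j"
        unfolding \<gamma>_step[OF i j]
        by (simp add: complex_vs.scale_minus_right complex_vs.scale_minus_left scaleC_scaleC bracket_add_right lie_diff_right algebra_simps)
      finally show ?thesis using True by simp
    qed
  qed
qed

lemma ad_Fr_F:
  assumes i: "i \<noteq> r"
  shows "(lie Fr ^^ Suc (s i)) (F i) = 0"
proof (rule word_op_eqI)
  have 0: "\<gamma> i (Suc (s i)) j = 0" for j by (auto simp: \<gamma>_def)
  fix a show "lie ((lie Fr ^^ Suc (s i)) (F i)) (push a) = lie 0 (push a)"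
    using lie_ad_Fr_F_push[OF i, of "Suc (s i)"] by (cases a) (simp only: 0, simp)
qed (simp only: ad_Fr_vac, simp add: app_simps)

section \<open>The representation and the defining relations\<close>

definition rep :: "'i bkm_gen free_lie \<Rightarrow> ('i \<times> nat) list free_mod linop" where
  "rep = free_ext (\<lambda>g. case g of GenH i \<Rightarrow> H i | GenE i \<Rightarrow> if i = r then E else push (i, 0)
     | GenF i \<Rightarrow> if i = r then Fr else F i)"

lemma lie_hom_rep: "lie_hom rep"
  by (simp add: rep_def lie_hom_free_ext)

lemma rep_gen: "rep (gen_h i) = H i" "rep (gen_e i) = (if i = r then E else push (i, 0))"
  "rep (gen_f i) = (if i = r then Fr else F i)"
  by (simp_all add: rep_def)

lemma rep_lin: "lin rep"
  and rep_lie: "rep (lie x y) = lie (rep x) (rep y)"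
  using lie_hom_rep by (simp_all add: lie_hom_def)

lemma rep_relations:
  assumes x: "x \<in> bkm_relations A"
  shows "rep x = 0"
proof -
  note simps = lin_diff[OF rep_lin] lin_add[OF rep_lin] lin_scale[OF rep_lin] lin_0[OF rep_lin] rep_gen
    rep_lie lie_hom_ad_pow[OF lie_hom_rep]
  have valid0: "valid (i, 0) \<longleftrightarrow> i \<noteq> r" for i by (simp add: valid_def)
  consider (he) i k where "x = lie (gen_h i) (gen_e k) - complex_of_real (A i k) *\<^sub>C gen_e k"
    | (hf) i k where "x = lie (gen_h i) (gen_f k) + complex_of_real (A i k) *\<^sub>C gen_f k"
    | (ef) i j where "x = lie (gen_e i) (gen_f j) - (if i = j then gen_h i else 0)"
    | (see) i j where "x = (lie (gen_e i) ^^ nat \<lfloor>1 - A i j\<rfloor>) (gen_e j)" "0 < A i i" "i \<noteq> j"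
    | (sff) i j where "x = (lie (gen_f i) ^^ nat \<lfloor>1 - A i j\<rfloor>) (gen_f j)" "0 < A i i" "i \<noteq> j"
    | (ee) i j where "x = lie (gen_e i) (gen_e j)" "A i j = 0"
    | (ff) i j where "x = lie (gen_f i) (gen_f j)" "A i j = 0"
    using x unfolding bkm_relations_def by (elim UnE CollectE exE conjE) (rule that; assumption)+
  then show ?thesis
  proof cases
    case he
    then show ?thesis by (auto simp: simps lie_H_E lie_push valid0)
  next
    case hf
    then show ?thesis by (auto simp: simps lie_H_Fr lie_H_F)
  next
    case ef
    have "lie (push (i, 0)) Fr = 0"
      using lie_anticommute[of "push (i, 0)" Fr] by (simp add: lie_push)
    moreover have "i \<noteq> r \<Longrightarrow> lie (push (i, 0)) (F j) = (if i = j then H i else 0)"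
      using lie_anticommute[of "push (i, 0)" "F j"] by (auto simp: lie_F_push \<beta>_def valid0)
    ultimately show ?thesis using ef by (auto simp: simps lie_E_Fr lie_E_F)
  next
    case see
    then have "i = r" using A_neg[of i i] by (metis less_asym)
    moreover from this see have "nat \<lfloor>1 - A i j\<rfloor> = Suc (s j)"
      by (simp add: A_ri)
    moreover have "(\<Prod>l<Suc (s j). s j - l) = 0" by simp
    ultimately show ?thesis using see ad_E_push[of j "Suc (s j)"] by (simp add: simps del: funpow.simps prod.lessThan_Suc)
  next
    case sff
    then have "i = r" using A_neg[of i i] by (metis less_asym)
    moreover from this sff have "nat \<lfloor>1 - A i j\<rfloor> = Suc (s j)"
      by (simp add: A_ri)
    ultimately show ?thesis using sff ad_Fr_F[of j] by (simp add: simps del: funpow.simps)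
  next
    case ee
    \<comment> \<open>Entries between imaginary roots are negative and \<open>A r r = 2\<close>, so
      a zero entry pairs \<open>r\<close> with an imaginary root whose string has a single member (s
      = 0).\<close>
    consider "i = r" "j \<noteq> r" "s j = 0" | "j = r" "i \<noteq> r" "s i = 0"
      using ee(2) A_neg[of i j] A_ri[of j] A_ir[of i] \<mu>_pos[of i] A_rr by fastforce
    then show ?thesis
    proof cases
      case 1
      then show ?thesis using ee by (simp add: simps lie_push)
    next
      case 2
      then show ?thesis using ee lie_anticommute[of "push (i, 0)" E] by (simp add: simps lie_push)
    qed
  next
    case ff
    consider "i = r" "j \<noteq> r" "s j = 0" | "j = r" "i \<noteq> r" "s i = 0"
      using ff(2) A_neg[of i j] A_ri[of j] A_ir[of i] \<mu>_pos[of i] A_rr by fastforce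
    then show ?thesis
    proof cases
      case 1
      then show ?thesis using ff ad_Fr_F[of j] by (simp add: simps)
    next
      case 2
      then show ?thesis using ff ad_Fr_F[of i] lie_anticommute[of "F i" Fr] by (simp add: simps)
    qed
  qed
qed

lemma rep_ideal: "x \<in> bkm_ideal A \<Longrightarrow> rep x = 0"
  unfolding bkm_ideal_def by (rule lie_hom_kernel_ideal[OF lie_hom_rep rep_relations])

end

section \<open>Logarithms of power series\<close>

text \<open>This is - log (1 - v). The coefficient at k = 0 is 1 / 0 = 0, which leaves the sum over
  k \<ge> 1.\<close>

definition log_series :: "fps2 \<Rightarrow> fps2" where
  "log_series v = fps_compose (Abs_fps (\<lambda>k. fps_const (1 / of_nat k))) v"

lemma log_series_nth_0 [simp]: "log_series v $ 0 = 0"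
  by (simp add: log_series_def)

lemma fps_power_nth_eq_0: "v $ 0 = 0 \<Longrightarrow> a < k \<Longrightarrow> (v ^ k) $ a = (0 :: complex fps)" for v :: fps2
  using startsby_zero_power_prefix[of v k] by simp

text \<open>The power v^k starts in degree k with respect to p, so any bound N \<ge> a truncates
  correctly.\<close>

lemma log_series_nth:
  assumes v: "v $ 0 = 0" and "a \<le> N"
  shows "log_series v $ a $ c = (\<Sum>k\<in>{1..N}. (v ^ k) $ a $ c / of_nat k)"
proof -
  have "log_series v $ a $ c = (\<Sum>k\<in>{0..a}. (v ^ k) $ a $ c / of_nat k)"
    by (simp add: log_series_def fps_compose_nth fps_sum_nth)
  also have "\<dots> = (\<Sum>k\<in>{1..N}. (v ^ k) $ a $ c / of_nat k)"
  proof (rule sum.mono_neutral_cong)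
    show "(v ^ k) $ a $ c / of_nat k = 0" if "k \<in> {1..N} - {0..a}" for k
      using that fps_power_nth_eq_0[OF v] by auto
  qed (use assms in auto)
  finally show ?thesis .
qed

lemma formal_sum_powers:
  assumes v: "v $ 0 = 0"
  shows "formal_sum {1..} (\<lambda>k::nat. fps_const (fps_const (1 / of_nat k)) * v ^ k) = log_series v"
proof (intro fps_ext)
  fix a c
  let ?g = "\<lambda>k::nat. if k \<in> {1..} then (fps_const (fps_const (1 / of_nat k)) * v ^ k) $ a $ c else 0"
  have "Sum_any ?g = (\<Sum>k\<in>{1..a}. ?g k)"
    using fps_power_nth_eq_0[OF v] by (intro Sum_any.expand_superset) (auto intro!: leI)
  also have "\<dots> = log_series v $ a $ c"
    by (simp add: log_series_nth[OF v order_refl])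
  finally show "formal_sum {1..} (\<lambda>k::nat. fps_const (fps_const (1 / of_nat k)) * v ^ k) $ a $ c = log_series v $ a $ c"
    by (simp add: formal_sum_def)
qed

text \<open>The derivative is the one in p. The outer series differentiates to the geometric series,
  whose composite with v is inverse to 1 - v.\<close>

lemma deriv_log_series:
  assumes v: "v $ 0 = 0"
  shows "(1 - v) * fps_deriv (log_series v) = fps_deriv v"
proof -
  let ?l = "Abs_fps (\<lambda>k. fps_const (1 / of_nat k)) :: fps2" and ?g = "Abs_fps (\<lambda>_. 1) :: fps2"
  have "fps_deriv ?l = ?g"
  proof (rule fps_ext)
    fix n
    have "complex_of_nat (n + 1) * (1 / of_nat (n + 1)) = 1" by (simp del: of_nat_add of_nat_Suc)
    then have "fps_const (complex_of_nat (n + 1) * (1 / of_nat (n + 1))) = 1" by simp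
    then show "fps_deriv ?l $ n = ?g $ n"
      unfolding fps_deriv_nth fps_nth_Abs_fps fps_const_mult[symmetric] fps_of_nat .
  qed
  moreover have "(1 - fps_X) * ?g = 1"
    by (rule fps_ext) (simp add: algebra_simps fps_X_mult_nth)
  then have "((1 - fps_X) * ?g) oo v = 1 oo v" by simp
  then have "(1 - v) * (?g oo v) = 1"
    by (simp add: fps_compose_mult_distrib[OF v] fps_compose_sub_distrib fps_X_fps_compose_startby0[OF v])
  ultimately show ?thesis
    by (simp add: log_series_def fps_compose_deriv[OF v] mult.assoc[symmetric])
qed

text \<open>Multiplied by 1 - v, both sides have the same derivative in p; 1 - v is a nonzero
  element of an integral domain and cancels. Both constant terms are 0.\<close>

lemma log_series_mult:
  assumes v: "v $ 0 = 0" and w: "w $ 0 = 0" and v': "v' $ 0 = 0"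
    and eq: "1 - v = (1 - w) * (1 - v')"
  shows "log_series v = log_series w + log_series v'"
proof -
  have "fps_deriv v = fps_deriv (1 - (1 - v))" by simp
  also have "\<dots> = (1 - v') * fps_deriv w + (1 - w) * fps_deriv v'"
    unfolding eq by (simp add: algebra_simps)
  also have "\<dots> = (1 - v) * fps_deriv (log_series w + log_series v')"
    unfolding eq deriv_log_series[OF w, symmetric] deriv_log_series[OF v', symmetric]
    by (simp add: algebra_simps)
  finally have "(1 - v) * (fps_deriv (log_series v) - fps_deriv (log_series w + log_series v')) = 0"
    using deriv_log_series[OF v] by (simp add: right_diff_distrib)
  moreover have "(1 - v) $ 0 = 1" using v by simp
  then have "1 - v \<noteq> 0" by auto
  ultimately have "fps_deriv (log_series v) = fps_deriv (log_series w + log_series v')" by simp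
  then have "log_series v = fps_const (log_series v $ 0 - (log_series w + log_series v') $ 0)
      + (log_series w + log_series v')"
    by (simp only: fps_deriv_eq_iff)
  then show ?thesis by simp
qed

lemma log_series_eq_0:
  assumes v: "v $ 0 = 0" and low: "\<And>a c. a + c \<le> N \<Longrightarrow> v $ a $ c = 0" and "a + c \<le> N"
  shows "log_series v $ a $ c = 0"
proof -
  have "(u * v) $ a $ c = 0" if "a + c \<le> N" for u a c
  proof -
    have "v $ (a - i) $ (c - j) = 0" for i j using low that by auto
    then show ?thesis by (simp add: fps_mult_nth fps_sum_nth)
  qed
  then have "(v ^ k) $ a $ c = 0" if "1 \<le> k" for k
    using that \<open>a + c \<le> N\<close> by (cases k) (auto simp: power_Suc2 simp del: power_Suc)
  then show ?thesis by (simp add: log_series_nth[OF v order_refl])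
qed

lemma monomial2_mult: "monomial2 x a c * monomial2 y a' c' = monomial2 (x * y) (a + a') (c + c')"
  by (simp only: monomial2_def fps_const_mult[symmetric] power_add mult_ac)

lemma monomial2_one: "monomial2 1 0 0 = 1"
  by (simp add: monomial2_def)

lemma monomial2_power: "monomial2 x a c ^ k = monomial2 (x ^ k) (k * a) (k * c)"
  by (induction k) (simp_all add: monomial2_one monomial2_mult)

lemma log_series_monomial:
  assumes "1 \<le> m" "a \<le> N"
  shows "log_series (monomial2 x m n) $ a $ c
    = (\<Sum>k\<in>{1..N}. if k * m = a \<and> k * n = c then x ^ k / of_nat k else 0)"
proof -
  have "monomial2 x m n $ 0 = 0"
    using assms(1) by (intro fps_ext) (simp add: monomial2_nth)
  then show ?thesis
    using assms(2) by (auto simp: log_series_nth monomial2_power monomial2_nth intro!: sum.cong)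
qed

section \<open>Linear algebra\<close>

abbreviation lspan :: "'a :: complex_lie_algebra set \<Rightarrow> 'a set" where
  "lspan \<equiv> complex_vs.span"

text \<open>Subtracting \<open>\<mu> y\<close> from \<open>f\<close> kills \<open>y\<close> and
  multiplies \<open>v\<close> by the nonzero scalar \<open>c - \<mu> y\<close>, so \<open>v\<close>
  already lies in the span of the remaining vectors.\<close>

lemma eigenvector_in_span_eq_0:
  assumes f: "lin f" and "finite F" and ev: "\<And>y. y \<in> F \<Longrightarrow> f y = \<mu> y *\<^sub>C y" "\<And>y. y \<in> F \<Longrightarrow> \<mu> y \<noteq> c"
    and v: "v \<in> lspan F" "f v = c *\<^sub>C v"
  shows "v = 0"
  using assms(2-)
proof (induction F rule: finite_induct)
  case empty
  then show ?case by simp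
next
  case (insert y F)
  have "f x - \<mu> y *\<^sub>C x \<in> lspan F" if "x \<in> lspan (insert y F)" for x
  proof (rule lin_mem_span[OF _ _ that])
    show "lin (\<lambda>x. f x - \<mu> y *\<^sub>C x)"
      by (simp add: lin_iff lin_add[OF f] lin_scale[OF f] scaleC_add_right scaleC_scaleC
          complex_vs.scale_right_diff_distrib mult.commute)
    fix x assume "x \<in> insert y F"
    then have x: "f x = \<mu> x *\<^sub>C x" "x = y \<or> x \<in> F" using insert.prems(1) by auto
    have "(\<mu> x - \<mu> y) *\<^sub>C x \<in> lspan F"
      using x(2) complex_vs.span_scale[OF complex_vs.span_base, of x F] by (auto simp: complex_vs.span_zero)
    then show "f x - \<mu> y *\<^sub>C x \<in> lspan F"
      by (simp add: x(1) complex_vs.scale_left_diff_distrib)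
  qed
  from this[OF insert.prems(3)] have "(c - \<mu> y) *\<^sub>C v \<in> lspan F"
    using insert.prems(4) by (simp add: complex_vs.scale_left_diff_distrib)
  then have "inverse (c - \<mu> y) *\<^sub>C (c - \<mu> y) *\<^sub>C v \<in> lspan F"
    by (rule complex_vs.span_scale)
  then have "v \<in> lspan F"
    using insert.prems(2)[of y] by (simp add: scaleC_scaleC scaleC_one)
  then show ?case using insert by auto
qed

text \<open>In an expansion of \<open>v\<close> the terms with eigenvalue different from c add up to
  a vector that \<open>f\<close> multiplies by c, and \<open>eigenvector_in_span_eq_0\<close> makes
  it 0.\<close>

lemma eigenvector_in_span:
  assumes f: "lin f" and ev: "\<And>y. y \<in> Y \<Longrightarrow> f y = \<mu> y *\<^sub>C y" and v: "v \<in> lspan Y" "f v = c *\<^sub>C v"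
  shows "v \<in> lspan {y \<in> Y. \<mu> y = c}"
proof -
  obtain F u where F: "finite F" "F \<subseteq> Y" and vF: "v = (\<Sum>y\<in>F. u y *\<^sub>C y)"
    using v(1) unfolding complex_vs.span_explicit by blast
  let ?P = "{y \<in> F. \<mu> y = c}" and ?Q = "{y \<in> F. \<mu> y \<noteq> c}"
  let ?p = "\<Sum>y\<in>?P. u y *\<^sub>C y" and ?q = "\<Sum>y\<in>?Q. u y *\<^sub>C y"
  have "F = ?P \<union> ?Q" by auto
  then have split: "v = ?p + ?q"
    unfolding vF using F(1) by (subst sum.union_disjoint[symmetric]) auto
  have "f ?p = c *\<^sub>C ?p"
    unfolding lin_sum[OF f] complex_vs.scale_sum_right
    using F(2) ev by (intro sum.cong) (auto simp: lin_scale[OF f] scaleC_scaleC mult.commute)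
  then have "f ?q = c *\<^sub>C ?q"
    using v(2) split by (simp add: lin_add[OF f] scaleC_add_right)
  moreover have "?q \<in> lspan ?Q"
    by (intro complex_vs.span_sum complex_vs.span_scale complex_vs.span_base)
  ultimately have "?q = 0"
    using F ev by (intro eigenvector_in_span_eq_0[OF f, of ?Q \<mu> c]) auto
  moreover have "?p \<in> lspan {y \<in> Y. \<mu> y = c}"
    using F(2) by (intro complex_vs.span_sum complex_vs.span_scale complex_vs.span_base) auto
  ultimately show ?thesis using split by simp
qed

text \<open>The basis in \<open>trace_on\<close> is chosen by \<open>SOME\<close>. Expanding each of
  two bases in the other and interchanging the sums is the identity tr(PQ) = tr(QP).\<close>

lemma trace_on_basis:
  assumes f: "lin f" and inv: "\<And>x. x \<in> V \<Longrightarrow> f x \<in> V"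
    and C: "finite C" "complex_vs.independent C" "lspan C = V"
  shows "trace_on V f = (\<Sum>c\<in>C. complex_vs.representation C (f c) c)"
proof -
  let ?R = "complex_vs.representation"
  define B where "B = (SOME B. complex_vs.independent B \<and> lspan B = V)"
  have B: "complex_vs.independent B" "lspan B = V"
    unfolding B_def using someI[of "\<lambda>B. complex_vs.independent B \<and> lspan B = V" C] C by auto
  have fB: "finite B"
    using complex_vs.independent_span_bound[OF C(1) B(1)] B(2) C(3) complex_vs.span_superset[of B] by auto
  have expand: "x = (\<Sum>b\<in>S. ?R S x b *\<^sub>C b)" if "finite S" "complex_vs.independent S" "x \<in> lspan S" for S x
    using complex_vs.sum_representation_eq[OF that(2,3) that(1) order_refl] by simp
  have BV: "b \<in> V" if "b \<in> B" for b using that B complex_vs.span_base by blast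
  have CV: "c \<in> V" if "c \<in> C" for c using that C complex_vs.span_base by blast
  have rep_sum: "?R S (\<Sum>i\<in>I. u i *\<^sub>C x i) b = (\<Sum>i\<in>I. u i * ?R S (x i) b)"
    if "complex_vs.independent S" "\<And>i. i \<in> I \<Longrightarrow> x i \<in> lspan S"
    for S b and I :: "'a set" and u and x :: "'a \<Rightarrow> 'a"
    using that by (simp add: complex_vs.representation_sum complex_vs.representation_scale complex_vs.span_scale)
  have "trace_on V f = (\<Sum>b\<in>B. ?R B (f b) b)"
    by (simp add: trace_on_def B_def Let_def)
  also have "\<dots> = (\<Sum>b\<in>B. \<Sum>c\<in>C. ?R C b c * ?R B (f c) b)"
  proof (rule sum.cong[OF HOL.refl])
    fix b assume "b \<in> B"
    then have "f b = (\<Sum>c\<in>C. ?R C b c *\<^sub>C f c)"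
      using arg_cong[OF expand[OF C(1,2), of b], of f] BV C(3)
      by (simp add: lin_sum[OF f] lin_scale[OF f])
    then show "?R B (f b) b = (\<Sum>c\<in>C. ?R C b c * ?R B (f c) b)"
      using rep_sum[OF B(1), of C "\<lambda>c. f c" "?R C b"] inv CV B(2) by simp
  qed
  also have "\<dots> = (\<Sum>c\<in>C. \<Sum>b\<in>B. ?R B (f c) b * ?R C b c)"
    by (subst sum.swap) (simp add: mult.commute)
  also have "\<dots> = (\<Sum>c\<in>C. ?R C (f c) c)"
  proof (rule sum.cong[OF HOL.refl])
    fix c assume "c \<in> C"
    then have "f c = (\<Sum>b\<in>B. ?R B (f c) b *\<^sub>C b)"
      using expand[OF fB B(1), of "f c"] inv CV B(2) by simp
    then show "(\<Sum>b\<in>B. ?R B (f c) b * ?R C b c) = ?R C (f c) c"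
      using rep_sum[OF C(2), of B "\<lambda>b. b" "?R B (f c)" c] BV C(3) by simp
  qed
  finally show ?thesis .
qed

text \<open>The height \<open>t\<close> orders the basis in such a way that \<open>f\<close> becomes triangular.\<close>

lemma trace_on_triangular:
  assumes f: "lin f" and C: "finite C" "complex_vs.independent C" "lspan C = V"
    and tri: "\<And>c. c \<in> C \<Longrightarrow> f c - lam c *\<^sub>C c \<in> lspan {c' \<in> C. t c' < (t c :: nat)}"
  shows "trace_on V f = (\<Sum>c\<in>C. lam c)"
proof -
  have mem: "f c \<in> V" if "c \<in> C" for c
  proof -
    have "f c - lam c *\<^sub>C c \<in> V"
      using tri[OF that] complex_vs.span_mono[of "{c' \<in> C. t c' < t c}" C] C(3) by auto
    then have "(f c - lam c *\<^sub>C c) + lam c *\<^sub>C c \<in> V"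
      unfolding C(3)[symmetric]
      by (rule complex_vs.span_add[OF _ complex_vs.span_scale[OF complex_vs.span_base[OF that]]])
    then show ?thesis by simp
  qed
  have inv: "f x \<in> V" if "x \<in> V" for x
    unfolding C(3)[symmetric] by (rule lin_mem_span[OF f _ that[folded C(3)]]) (simp add: mem C(3))
  have "complex_vs.representation C (f c) c = lam c" if c: "c \<in> C" for c
  proof -
    let ?L = "{c' \<in> C. t c' < t c}" and ?d = "f c - lam c *\<^sub>C c"
    have "complex_vs.representation C ?d c = complex_vs.representation ?L ?d c"
      using complex_vs.representation_extend[OF C(2) tri[OF c]] by auto
    also have "\<dots> = 0"
      using complex_vs.representation_ne_zero[of ?L ?d c] by auto
    finally have "complex_vs.representation C ?d c = 0" .
    moreover have "complex_vs.representation C ?d c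
        = complex_vs.representation C (f c) c - lam c * complex_vs.representation C c c"
      using C(2) c mem[OF c, folded C(3)]
      by (simp add: complex_vs.representation_diff complex_vs.representation_scale
          complex_vs.span_base complex_vs.span_scale)
    ultimately show ?thesis using C(2) c by (simp add: complex_vs.representation_basis)
  qed
  then show ?thesis using trace_on_basis[OF f inv C] by simp
qed

text \<open>The vectors of smaller height span an \<open>f\<close>-invariant subspace, modulo which
  \<open>f\<close> multiplies \<open>c\<close> by \<open>lam c\<close>.\<close>

lemma triangular_power:
  assumes f: "lin f" and c: "c \<in> C"
    and tri: "\<And>c. c \<in> C \<Longrightarrow> f c - lam c *\<^sub>C c \<in> lspan {c' \<in> C. t c' < (t c :: nat)}"
  shows "(f ^^ k) c - (lam c ^ k) *\<^sub>C c \<in> lspan {c' \<in> C. t c' < t c}"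
proof (induction k)
  case 0
  then show ?case by (simp add: scaleC_one complex_vs.span_zero)
next
  case (Suc k)
  let ?L = "{c' \<in> C. t c' < t c}"
  have inv: "f x \<in> lspan ?L" if "x \<in> lspan ?L" for x
  proof (rule lin_mem_span[OF f _ that])
    fix b assume b: "b \<in> ?L"
    have "f b - lam b *\<^sub>C b \<in> lspan ?L"
    proof (rule subsetD[OF complex_vs.span_mono])
      show "{c' \<in> C. t c' < t b} \<subseteq> ?L" using b by auto
    qed (use tri[of b] b in auto)
    then have "(f b - lam b *\<^sub>C b) + lam b *\<^sub>C b \<in> lspan ?L"
      by (rule complex_vs.span_add[OF _ complex_vs.span_scale[OF complex_vs.span_base[OF b]]])
    then show "f b \<in> lspan ?L" by simp
  qed
  have "f ((f ^^ k) c - (lam c ^ k) *\<^sub>C c) + (lam c ^ k) *\<^sub>C (f c - lam c *\<^sub>C c) \<in> lspan ?L"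
    by (intro complex_vs.span_add complex_vs.span_scale inv Suc tri c)
  then show ?case
    by (simp add: lin_diff[OF f] lin_scale[OF f] complex_vs.scale_right_diff_distrib scaleC_scaleC mult.commute)
qed

section \<open>Triangularization over the complex numbers\<close>

definition poly_app :: "('a :: complex_lie_algebra \<Rightarrow> 'a) \<Rightarrow> complex poly \<Rightarrow> 'a \<Rightarrow> 'a" where
  "poly_app f p v = (\<Sum>i\<le>degree p. coeff p i *\<^sub>C (f ^^ i) v)"

lemma poly_app_superset: "degree p \<le> n \<Longrightarrow> poly_app f p v = (\<Sum>i\<le>n. coeff p i *\<^sub>C (f ^^ i) v)"
  unfolding poly_app_def
  by (rule sum.mono_neutral_left) (auto simp: coeff_eq_0)

lemma poly_app_linear_factor:
  assumes f: "lin f"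
  shows "poly_app f ([:- a, 1:] * p) v = f (poly_app f p v) - a *\<^sub>C poly_app f p v"
proof -
  have deg: "degree ([:- a, 1:] * p) \<le> Suc (degree p)"
    using degree_mult_le[of "[:- a, 1:]" p] by simp
  have "poly_app f ([:- a, 1:] * p) v
      = (\<Sum>i\<le>Suc (degree p). (coeff (pCons 0 p) i - a * coeff p i) *\<^sub>C (f ^^ i) v)"
    unfolding poly_app_superset[OF deg] by simp
  also have "\<dots> = (\<Sum>i\<le>Suc (degree p). coeff (pCons 0 p) i *\<^sub>C (f ^^ i) v)
      - a *\<^sub>C (\<Sum>i\<le>Suc (degree p). coeff p i *\<^sub>C (f ^^ i) v)"
    by (simp only: complex_vs.scale_left_diff_distrib sum_subtractf complex_vs.scale_sum_right scaleC_scaleC)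
  also have "(\<Sum>i\<le>Suc (degree p). coeff p i *\<^sub>C (f ^^ i) v) = poly_app f p v"
    using poly_app_superset[of p "Suc (degree p)" f v] by simp
  also have "(\<Sum>i\<le>Suc (degree p). coeff (pCons 0 p) i *\<^sub>C (f ^^ i) v) = f (poly_app f p v)"
    unfolding sum.atMost_Suc_shift by (simp add: poly_app_def lin_sum[OF f] lin_scale[OF f])
  finally show ?thesis .
qed

text \<open>The n + 1 vectors v, f v, ..., f^n v with n = card S cannot be independent. Since
  independence is a property of sets, a repetition among them is treated apart; it gives the
  polynomial X^j - X^i.\<close>

lemma exists_poly_app_eq_0:
  assumes f: "lin f" and inv: "\<And>x. x \<in> lspan S \<Longrightarrow> f x \<in> lspan S" and S: "finite S" and v: "v \<in> lspan S"
  shows "\<exists>p. p \<noteq> 0 \<and> poly_app f p v = 0"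
proof (cases "inj_on (\<lambda>i. (f ^^ i) v) {..card S}")
  case True
  let ?K = "(\<lambda>i. (f ^^ i) v) ` {..card S}"
  have "(f ^^ i) v \<in> lspan S" for i by (induction i) (auto simp: v inv)
  then have "complex_vs.dependent ?K"
    using complex_vs.independent_span_bound[OF S, of ?K] True by (auto simp: card_image)
  then obtain u w where u: "w \<in> ?K" "u w \<noteq> 0" "(\<Sum>x\<in>?K. u x *\<^sub>C x) = 0"
    using complex_vs.dependent_finite[of ?K] by auto
  define p where "p = (\<Sum>i\<le>card S. monom (u ((f ^^ i) v)) i)"
  have coeff: "coeff p i = (if i \<le> card S then u ((f ^^ i) v) else 0)" for i
    by (simp add: p_def coeff_sum)
  then have "degree p \<le> card S" by (intro degree_le) auto
  then have "poly_app f p v = (\<Sum>i\<le>card S. u ((f ^^ i) v) *\<^sub>C (f ^^ i) v)"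
    by (simp add: poly_app_superset coeff)
  also have "\<dots> = 0" using u(3) True by (simp add: sum.reindex)
  finally have "poly_app f p v = 0" .
  moreover have "p \<noteq> 0" using u(1,2) coeff by (metis (no_types, lifting) atMost_iff coeff_0 imageE)
  ultimately show ?thesis by blast
next
  case False
  then obtain i j where ij: "i < j" "(f ^^ i) v = (f ^^ j) v"
    unfolding inj_on_def by (metis linorder_neqE_nat)
  define p :: "complex poly" where "p = monom 1 j - monom 1 i"
  have "degree p \<le> j" unfolding p_def using ij(1) by (intro degree_diff_le) (auto simp: degree_monom_eq)
  then have "poly_app f p v = (\<Sum>k\<le>j. ((if k = j then 1 else 0) - (if k = i then 1 else 0)) *\<^sub>C (f ^^ k) v)"
    by (auto simp: poly_app_superset p_def intro!: sum.cong)
  also have "\<dots> = (\<Sum>k\<le>j. if k = j then (f ^^ k) v else 0) - (\<Sum>k\<le>j. if k = i then (f ^^ k) v else 0)"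
    unfolding sum_subtractf[symmetric]
    by (rule sum.cong) (auto simp: complex_vs.scale_left_diff_distrib scaleC_one)
  also have "\<dots> = 0" using ij by simp
  finally have "poly_app f p v = 0" .
  moreover have "coeff p j = 1" using ij(1) by (simp add: p_def)
  then have "p \<noteq> 0" by auto
  ultimately show ?thesis by blast
qed

text \<open>Let p be nonzero of least degree with p(f) v in W. It is not constant, as v is not in W.
  Splitting off a root a, p = (X - a) p', the vector p'(f) v is outside W by minimality, and f - a
  maps it into W.\<close>

lemma exists_eigenvector_mod:
  assumes f: "lin f" and inv: "\<And>x. x \<in> lspan S \<Longrightarrow> f x \<in> lspan S" and S: "finite S"
    and v: "v \<in> lspan S" "v \<notin> W" and W: "complex_vs.subspace W"
  obtains u a where "u \<in> lspan S" "u \<notin> W" "f u - a *\<^sub>C u \<in> W"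
proof -
  let ?P = "\<lambda>n. \<exists>p. p \<noteq> 0 \<and> poly_app f p v \<in> W \<and> degree p = n"
  obtain p0 where "p0 \<noteq> 0" "poly_app f p0 v = 0" using exists_poly_app_eq_0[OF f inv S v(1)] by blast
  then have "?P (degree p0)" using complex_vs.subspace_0[OF W] by metis
  then have "?P (LEAST n. ?P n)" by (rule LeastI)
  then obtain p where p: "p \<noteq> 0" "poly_app f p v \<in> W" and deg: "degree p = (LEAST n. ?P n)" by blast
  have min: "degree p \<le> degree p'" if "p' \<noteq> 0" "poly_app f p' v \<in> W" for p'
    unfolding deg using that by (intro Least_le) blast
  have "degree p \<noteq> 0"
  proof
    assume "degree p = 0"
    then obtain c where c: "p = [:c:]" by (rule degree_eq_zeroE)
    with p have "c \<noteq> 0" "c *\<^sub>C v \<in> W" by (auto simp: poly_app_def)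
    then have "inverse c *\<^sub>C c *\<^sub>C v \<in> W" using complex_vs.subspace_scale[OF W] by blast
    then show False using v(2) \<open>c \<noteq> 0\<close> by (simp add: scaleC_scaleC scaleC_one)
  qed
  then obtain a where "poly p a = 0"
    using fundamental_theorem_of_algebra[of p] by (auto simp: constant_degree)
  then obtain p' where p': "p = [:- a, 1:] * p'" by (auto simp: poly_eq_0_iff_dvd)
  then have p'0: "p' \<noteq> 0" using p(1) by auto
  then have "degree p = Suc (degree p')" unfolding p' by (subst degree_mult_eq) auto
  then have "poly_app f p' v \<notin> W" using min[OF p'0] by auto
  moreover have "(f ^^ i) v \<in> lspan S" for i by (induction i) (auto simp: v(1) inv)
  then have "poly_app f p' v \<in> lspan S"
    unfolding poly_app_def by (intro complex_vs.span_sum complex_vs.span_scale)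
  moreover have "f (poly_app f p' v) - a *\<^sub>C poly_app f p' v \<in> W"
    using p(2) unfolding p' poly_app_linear_factor[OF f] .
  ultimately show ?thesis using that by blast
qed

text \<open>A list is extended by an eigenvector modulo its span until it spans everything; the
  order in the list records the triangularity.\<close>

lemma exists_triangular_basis:
  assumes f: "lin f" and inv: "\<And>x. x \<in> lspan S \<Longrightarrow> f x \<in> lspan S" and S: "finite S"
  shows "\<exists>us lam. distinct us \<and> complex_vs.independent (set us) \<and> lspan (set us) = lspan S
    \<and> (\<forall>j<length us. f (us ! j) - lam j *\<^sub>C us ! j \<in> lspan ((!) us ` {..<j}))"
proof -
  let ?good = "\<lambda>us lam. distinct us \<and> complex_vs.independent (set us) \<and> set us \<subseteq> lspan S
    \<and> (\<forall>j<length us. f (us ! j) - lam j *\<^sub>C us ! j \<in> lspan ((!) us ` {..<j}))"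
  have "\<exists>us lam. ?good us lam \<and> (lspan (set us) = lspan S \<or> length us = n)" for n
  proof (induction n)
    case 0
    show ?case by (intro exI[of _ "[]"]) (simp add: complex_vs.independent_empty)
  next
    case (Suc n)
    then obtain us lam where good: "?good us lam" and alt: "lspan (set us) = lspan S \<or> length us = n" by blast
    show ?case
    proof (cases "lspan (set us) = lspan S")
      case True
      then show ?thesis using good by blast
    next
      case False
      have sub: "lspan (set us) \<subseteq> lspan S"
        using good by (intro complex_vs.span_minimal complex_vs.subspace_span) auto
      with False obtain v where v: "v \<in> lspan S" "v \<notin> lspan (set us)" by blast
      obtain u a where u: "u \<in> lspan S" "u \<notin> lspan (set us)" "f u - a *\<^sub>C u \<in> lspan (set us)"
        by (rule exists_eigenvector_mod[OF f inv S v complex_vs.subspace_span]) auto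
      have img: "(!) (us @ [u]) ` {..<j} = (!) us ` {..<j}" if "j \<le> length us" for j
        using that by (intro image_cong) (auto simp: nth_append)
      have set_us: "(!) us ` {..<length us} = set us" by (auto simp: set_conv_nth)
      have "f ((us @ [u]) ! j) - (lam(length us := a)) j *\<^sub>C (us @ [u]) ! j \<in> lspan ((!) (us @ [u]) ` {..<j})"
        if "j < length (us @ [u])" for j
      proof (cases "j = length us")
        case True
        then show ?thesis using u(3) img[of j] set_us by simp
      next
        case False
        then have "j < length us" using that by simp
        then show ?thesis using good img[of j] by (simp add: nth_append)
      qed
      then have "?good (us @ [u]) (lam(length us := a))"
        using good u complex_vs.span_base[of u "set us"]
        by (auto simp: complex_vs.independent_insert)
      moreover have "length (us @ [u]) = Suc n" using alt False by simp
      ultimately show ?thesis by blast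
    qed
  qed
  \<comment> \<open>Independent vectors in \<open>lspan S\<close> number at most
    \<open>card S\<close>, so asking for one more excludes the second alternative.\<close>
  then obtain us lam where good: "?good us lam" and alt: "lspan (set us) = lspan S \<or> length us = Suc (card S)"
    by blast
  have "length us \<le> card S"
    using complex_vs.independent_span_bound[OF S, of "set us"] good by (simp add: distinct_card)
  with alt good show ?thesis by (metis Suc_n_not_le_n)
qed

section \<open>Graded bases of free Lie algebras\<close>

text \<open>The weight belongs to the bracket expression rather than to the vector, so one vector
  (0, for instance) can carry several weights.\<close>

inductive lie_monomial ::
  "(nat \<Rightarrow> 'a :: complex_lie_algebra) \<Rightarrow> (nat \<Rightarrow> 'w :: comm_monoid_add) \<Rightarrow> nat set \<Rightarrow> 'w \<Rightarrow> 'a \<Rightarrow> bool"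
  for x wt J where
  lie_monomial_gen: "j \<in> J \<Longrightarrow> lie_monomial x wt J (wt j) (x j)"
| lie_monomial_lie: "lie_monomial x wt J w a \<Longrightarrow> lie_monomial x wt J w' b \<Longrightarrow> lie_monomial x wt J (w + w') (lie a b)"

lemma lie_monomial_in_gen: "lie_monomial x wt J w y \<Longrightarrow> y \<in> lie_gen (x ` J)"
  by (induction rule: lie_monomial.induct) (auto intro: lie_gen_base lie_gen_lie)

lemma lie_monomial_elim_imp:
  assumes i: "i \<in> J" and y: "lie_monomial (elim lie i x) (elim (+) i wt) (elim_index i J) w y"
  shows "lie_monomial x wt J w y"
  using y
proof induction
  case (lie_monomial_gen l)
  then obtain j k where l: "l = prod_encode (j, k)" and j: "j \<in> J"
    by (auto simp: elim_index_def)
  have "lie_monomial x wt J (((+) (wt i) ^^ k) (wt j)) ((lie (x i) ^^ k) (x j))"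
    using i j by (induction k) (auto intro: lie_monomial.intros)
  then show ?case by (simp add: l)
qed (rule lie_monomial_lie)

text \<open>As a derivation, bracketing with \<open>x i\<close> moves the generator (j, k) to (j, k
  + 1), so monomials in the new generators go to sums of such monomials.\<close>

lemma ad_lie_monomial_elim:
  fixes x :: "nat \<Rightarrow> 'a :: complex_lie_algebra"
  assumes "lie_monomial (elim lie i x) (elim (+) i wt) (elim_index i J) w y"
  shows "lie (x i) y \<in> lspan {z. lie_monomial (elim lie i x) (elim (+) i wt) (elim_index i J) (wt i + w) z}"
  using assms
proof induction
  case (lie_monomial_gen l)
  then obtain j k where l: "l = prod_encode (j, k)" and j: "j \<in> J" "j \<noteq> i"
    by (force simp: elim_index_def)
  then have "prod_encode (j, Suc k) \<in> elim_index i J" by (auto simp: elim_index_def)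
  from lie_monomial.intros(1)[OF this, of "elim lie i x" "elim (+) i wt"] show ?case
    by (intro complex_vs.span_base) (simp add: l)
next
  case (lie_monomial_lie w a w' b)
  let ?m = "\<lambda>w. {z. lie_monomial (elim lie i x) (elim (+) i wt) (elim_index i J) w z}"
  have "lie (lie (x i) a) b \<in> lspan (?m (wt i + (w + w')))"
    by (rule lie_mem_span[OF _ lie_monomial_lie.IH(1) complex_vs.span_base[of b "{b}"]])
      (auto intro!: complex_vs.span_base intro: lie_monomial.intros(2)[of _ _ _ "wt i + w", OF _ lie_monomial_lie.hyps(2)]
        simp: add.assoc[symmetric])
  moreover have "lie a (lie (x i) b) \<in> lspan (?m (wt i + (w + w')))"
    by (rule lie_mem_span[OF _ complex_vs.span_base[of a "{a}"] lie_monomial_lie.IH(2)])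
      (auto intro!: complex_vs.span_base intro: lie_monomial.intros(2)[OF lie_monomial_lie.hyps(1)]
        simp: add.left_commute)
  ultimately show ?case
    unfolding lie_derivation[of "x i" a b] by (rule complex_vs.span_add)
qed

text \<open>The line of \<open>x i\<close> and the monomials in the new generators are together
  closed under brackets: \<open>x i\<close> commutes with itself and acts on the others by
  \<open>ad_lie_monomial_elim\<close>.\<close>

lemma lie_monomial_elim_span:
  fixes x :: "nat \<Rightarrow> 'a :: complex_lie_algebra"
  assumes i: "i \<in> J" and y: "lie_monomial x wt J w y"
  shows "y \<in> lspan ({z. z = x i \<and> w = wt i}
    \<union> {z. lie_monomial (elim lie i x) (elim (+) i wt) (elim_index i J) w z})"
  using y
proof induction
  case (lie_monomial_gen j)
  show ?case
  proof (cases "j = i")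
    case True
    then show ?thesis by (auto intro: complex_vs.span_base)
  next
    case False
    then have "prod_encode (j, 0) \<in> elim_index i J"
      using lie_monomial_gen by (auto simp: elim_index_def)
    from lie_monomial.intros(1)[OF this, of "elim lie i x" "elim (+) i wt"] show ?thesis
      by (auto intro: complex_vs.span_base)
  qed
next
  case (lie_monomial_lie w a w' b)
  let ?m = "\<lambda>w. {z. lie_monomial (elim lie i x) (elim (+) i wt) (elim_index i J) w z}"
  let ?p = "\<lambda>w. {z. z = x i \<and> w = wt i}"
  show ?case
  proof (rule lie_mem_span[OF _ lie_monomial_lie.IH])
    fix y z assume y: "y \<in> ?p w \<union> ?m w" and z: "z \<in> ?p w' \<union> ?m w'"
    have "lie y z \<in> lspan (?m (w + w'))" if ne: "\<not> (y = x i \<and> z = x i)"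
    proof (cases "y \<in> ?m w \<and> z \<in> ?m w'")
      case True
      then show ?thesis by (auto intro!: complex_vs.span_base lie_monomial.intros(2))
    next
      case False
      then consider "y = x i" "w = wt i" "z \<in> ?m w'" | "z = x i" "w' = wt i" "y \<in> ?m w"
        using y z ne by blast
      then show ?thesis
      proof cases
        case 1
        then show ?thesis using ad_lie_monomial_elim[of i x wt J w' z] by simp
      next
        case 2
        then have "lie z y \<in> lspan (?m (w + w'))"
          using ad_lie_monomial_elim[of i x wt J w y] by (simp add: add.commute)
        then show ?thesis by (subst lie_anticommute) (rule complex_vs.span_neg)
      qed
    qed
    moreover have "lie y z = 0" if "y = x i \<and> z = x i" using that by (simp add: bracket_self)
    moreover have "lspan (?m (w + w')) \<subseteq> lspan (?p (w + w') \<union> ?m (w + w'))"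
      by (rule complex_vs.span_mono) simp
    ultimately show "lie y z \<in> lspan (?p (w + w') \<union> ?m (w + w'))"
      using complex_vs.span_zero by (cases "y = x i \<and> z = x i") auto
  qed
qed

text \<open>The new generator (j, k) has weight k \<open>wt i\<close> + \<open>wt j\<close>. With
  the bidegree additive and \<open>lam\<close> multiplicative, its term in the generating series is
  the k-th power of the term of \<open>x i\<close> times the term of \<open>x j\<close>.\<close>

locale weights =
  fixes md nd :: "'w :: comm_monoid_add \<Rightarrow> nat" and lam :: "'w \<Rightarrow> complex"
  assumes md_add: "md (v + w) = md v + md w" and nd_add: "nd (v + w) = nd v + nd w"
    and lam_add: "lam (v + w) = lam v * lam w"
begin

definition deg :: "'w \<Rightarrow> nat" where "deg w = md w + nd w"

lemma deg_add: "deg (v + w) = deg v + deg w"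
  by (simp add: deg_def md_add nd_add)

lemma deg_funpow: "deg (((+) v ^^ k) w) = deg w + k * deg v"
  by (induction k) (simp_all add: deg_add)

lemma md_funpow: "md (((+) v ^^ k) w) = md w + k * md v"
  by (induction k) (simp_all add: md_add)

text \<open>The condition on \<open>md\<close> removes the constant term in p of the generating
  series, so that its logarithm makes sense, and makes bracketing with a generator raise the total
  degree.\<close>

definition locally_finite :: "(nat \<Rightarrow> 'w) \<Rightarrow> nat set \<Rightarrow> bool" where
  "locally_finite wt J \<longleftrightarrow> (\<forall>N. finite {j \<in> J. deg (wt j) \<le> N}) \<and> (\<forall>j\<in>J. 1 \<le> md (wt j))"

definition slice :: "(nat \<Rightarrow> 'w) \<Rightarrow> nat set \<Rightarrow> nat \<Rightarrow> nat \<Rightarrow> nat set" where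
  "slice wt J a c = {j \<in> J. md (wt j) = a \<and> nd (wt j) = c}"

definition gen_fun :: "(nat \<Rightarrow> 'w) \<Rightarrow> nat set \<Rightarrow> fps2" where
  "gen_fun wt J = Abs_fps (\<lambda>a. Abs_fps (\<lambda>c. \<Sum>j\<in>slice wt J a c. lam (wt j)))"

abbreviation weight_series :: "'w \<Rightarrow> fps2" where
  "weight_series w \<equiv> monomial2 (lam w) (md w) (nd w)"

lemma gen_fun_nth: "gen_fun wt J $ a $ c = (\<Sum>j\<in>slice wt J a c. lam (wt j))"
  by (simp add: gen_fun_def)

lemma finite_slice: "locally_finite wt J \<Longrightarrow> finite (slice wt J a c)"
  unfolding locally_finite_def
  by (rule finite_subset[of _ "{j \<in> J. deg (wt j) \<le> a + c}"]) (auto simp: slice_def deg_def)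

lemma gen_fun_nth_0: "locally_finite wt J \<Longrightarrow> gen_fun wt J $ 0 = 0"
  by (rule fps_ext) (force simp: gen_fun_nth slice_def locally_finite_def intro!: sum.neutral)

lemma locally_finite_elim:
  assumes J: "locally_finite wt J" and i: "i \<in> J"
  shows "locally_finite (elim (+) i wt) (elim_index i J)"
  unfolding locally_finite_def
proof (intro conjI allI ballI)
  fix N
  have di: "1 \<le> deg (wt i)" using J i by (auto simp: locally_finite_def deg_def)
  have "{l \<in> elim_index i J. deg (elim (+) i wt l) \<le> N} \<subseteq> prod_encode ` ({j \<in> J. deg (wt j) \<le> N} \<times> {..N})"
  proof
    fix l assume "l \<in> {l \<in> elim_index i J. deg (elim (+) i wt l) \<le> N}"
    then obtain j k where l: "l = prod_encode (j, k)" and j: "j \<in> J" and "deg (wt j) + k * deg (wt i) \<le> N"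
      by (auto simp: elim_index_def deg_funpow)
    moreover have "k \<le> k * deg (wt i)" using di by simp
    ultimately have "deg (wt j) \<le> N" "k \<le> N" by linarith+
    then show "l \<in> prod_encode ` ({j \<in> J. deg (wt j) \<le> N} \<times> {..N})" using l j by auto
  qed
  moreover have "finite {j \<in> J. deg (wt j) \<le> N}" using J by (simp add: locally_finite_def)
  ultimately show "finite {l \<in> elim_index i J. deg (elim (+) i wt l) \<le> N}"
    by (meson finite_SigmaI finite_atMost finite_imageI finite_subset)
next
  fix l assume "l \<in> elim_index i J"
  then show "1 \<le> md (elim (+) i wt l)"
    using J by (auto simp: elim_index_def md_funpow locally_finite_def intro: trans_le_add1)
qed

lemma monomial2_mult_nth:
  "(monomial2 x m n * S) $ a $ c = (if m \<le> a \<and> n \<le> c then x * S $ (a - m) $ (c - n) else 0)"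
proof -
  have "(monomial2 x m n * S) $ a = (if a < m then 0 else (fps_const x * fps_X ^ n) * S $ (a - m))"
    unfolding monomial2_def by (simp add: mult.assoc fps_X_power_mult_nth)
  then show ?thesis by (simp add: mult.assoc fps_X_power_mult_nth)
qed

text \<open>The new generators (j, 0) contribute v - w, and the passage from (j, k) to (j, k + 1)
  multiplies by w. Hence v' = (v - w) + w v'.\<close>

lemma gen_fun_elim:
  assumes J: "locally_finite wt J" and i: "i \<in> J"
  shows "1 - gen_fun wt J = (1 - weight_series (wt i)) * (1 - gen_fun (elim (+) i wt) (elim_index i J))"
proof -
  let ?wt = "elim (+) i wt" and ?J = "elim_index i J"
  let ?m = "md (wt i)" and ?n = "nd (wt i)" and ?l = "lam (wt i)"
  let ?suc = "\<lambda>l. case prod_decode l of (j, k) \<Rightarrow> prod_encode (j, Suc k)"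
  have "gen_fun ?wt ?J = (gen_fun wt J - weight_series (wt i)) + weight_series (wt i) * gen_fun ?wt ?J"
  proof (intro fps_ext)
    fix a c
    let ?R = "if ?m \<le> a \<and> ?n \<le> c then ?suc ` slice ?wt ?J (a - ?m) (c - ?n) else {}"
    let ?S = "(\<lambda>j. prod_encode (j, 0)) ` (slice wt J a c - {i})"
    have fin: "finite (slice ?wt ?J a' c')" for a' c'
      by (rule finite_slice[OF locally_finite_elim[OF J i]])
    have split: "slice ?wt ?J a c = ?S \<union> ?R"
    proof (intro equalityI subsetI)
      fix l assume l: "l \<in> slice ?wt ?J a c"
      then obtain j k where jk: "l = prod_encode (j, k)" "j \<in> J" "j \<noteq> i"
        by (force simp: slice_def elim_index_def)
      show "l \<in> ?S \<union> ?R"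
      proof (cases k)
        case 0
        then show ?thesis using l jk by (auto simp: slice_def)
      next
        case (Suc k')
        then have "?m \<le> a \<and> ?n \<le> c" "prod_encode (j, k') \<in> slice ?wt ?J (a - ?m) (c - ?n)"
          using l jk by (auto simp: slice_def elim_index_def md_add nd_add)
        moreover have "l = ?suc (prod_encode (j, k'))" by (simp add: jk Suc)
        ultimately show ?thesis by (auto simp del: prod_encode_inverse)
      qed
    next
      fix l assume "l \<in> ?S \<union> ?R"
      then show "l \<in> slice ?wt ?J a c"
        by (auto simp: slice_def elim_index_def md_add nd_add split: if_splits)
    qed
    have disj: "?S \<inter> ?R = {}" by (auto split: prod.splits)
    have inj: "inj_on ?suc X" for X
      by (auto simp: inj_on_def split: prod.splits) (metis prod_decode_inverse)
    have lam_suc: "lam (?wt (?suc l)) = ?l * lam (?wt l)" for l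
      by (cases "prod_decode l") (auto simp: elim_def lam_add)
    have "(\<Sum>l\<in>?S. lam (?wt l)) = (\<Sum>j\<in>slice wt J a c - {i}. lam (wt j))"
      by (subst sum.reindex) (auto simp: inj_on_def)
    also have "\<dots> = (gen_fun wt J - weight_series (wt i)) $ a $ c"
      using i finite_slice[OF J, of a c]
      by (auto simp: gen_fun_nth monomial2_nth sum_diff1) (auto simp: slice_def)
    finally have S: "(\<Sum>l\<in>?S. lam (?wt l)) = (gen_fun wt J - weight_series (wt i)) $ a $ c" .
    have R: "(\<Sum>l\<in>?R. lam (?wt l)) = (weight_series (wt i) * gen_fun ?wt ?J) $ a $ c"
      by (simp add: monomial2_mult_nth gen_fun_nth sum.reindex[OF inj] lam_suc sum_distrib_left)
    have "gen_fun ?wt ?J $ a $ c = (\<Sum>l\<in>?S. lam (?wt l)) + (\<Sum>l\<in>?R. lam (?wt l))"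
      unfolding gen_fun_nth split using disj fin finite_slice[OF J]
      by (intro sum.union_disjoint) auto
    then show "gen_fun ?wt ?J $ a $ c
      = ((gen_fun wt J - weight_series (wt i)) + weight_series (wt i) * gen_fun ?wt ?J) $ a $ c"
      by (simp only: S R fps_add_nth)
  qed
  then show ?thesis by (simp add: algebra_simps)
qed

text \<open>The statement is truncated at total degree N, where finitely many eliminations suffice.
  Weights are recorded with the basis vectors, and spanning is required within each weight: this is
  what keeps the automorphism triangular in the basis.\<close>

definition has_basis :: "(nat \<Rightarrow> 'a :: complex_lie_algebra) \<Rightarrow> (nat \<Rightarrow> 'w) \<Rightarrow> nat set \<Rightarrow> nat \<Rightarrow> bool" where
  "has_basis x wt J N \<longleftrightarrow> (\<exists>bs. distinct (map fst bs) \<and> complex_vs.independent (fst ` set bs)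
     \<and> (\<forall>(b, w)\<in>set bs. lie_monomial x wt J w b)
     \<and> (\<forall>w y. lie_monomial x wt J w y \<longrightarrow> deg w \<le> N \<longrightarrow> y \<in> lspan {b. (b, w) \<in> set bs})
     \<and> (\<forall>a c. a + c \<le> N \<longrightarrow> log_series (gen_fun wt J) $ a $ c
         = (\<Sum>(b, w)\<leftarrow>bs. log_series (weight_series w) $ a $ c)))"

text \<open>No monomial has degree at most N, so the empty list is a basis.\<close>

lemma has_basis_high_degree:
  assumes J: "locally_finite wt J" and high: "\<And>j. j \<in> J \<Longrightarrow> N < deg (wt j)"
  shows "has_basis x wt J N"
  unfolding has_basis_def
proof (intro exI[of _ "[]"] conjI allI impI)
  have "N < deg w" if "lie_monomial x wt J w y" for w y
    using that by induction (auto simp: high deg_add)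
  then show "y \<in> lspan {b. (b, w) \<in> set []}" if "lie_monomial x wt J w y" "deg w \<le> N" for w y
    using that by force
  fix a c assume "a + c \<le> N"
  have "slice wt J a' c' = {}" if "a' + c' \<le> N" for a' c'
    using high that by (fastforce simp: slice_def deg_def)
  then have "gen_fun wt J $ a' $ c' = 0" if "a' + c' \<le> N" for a' c'
    using that by (simp add: gen_fun_nth)
  then show "log_series (gen_fun wt J) $ a $ c = (\<Sum>(b, w)\<leftarrow>[]. log_series (weight_series w) $ a $ c)"
    using log_series_eq_0[OF gen_fun_nth_0[OF J], of N a c] \<open>a + c \<le> N\<close> by simp
qed (auto simp: complex_vs.independent_empty)

text \<open>The eliminated generator joins the basis. It is independent of the rest, which lies in
  the subalgebra of \<open>not_in_elim_gen\<close>, and the logarithms add up by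
  \<open>gen_fun_elim\<close>.\<close>

lemma has_basis_elim:
  assumes free: "free_family x J" and J: "locally_finite wt J" and i: "i \<in> J"
    and basis: "has_basis (elim lie i x) (elim (+) i wt) (elim_index i J) N"
  shows "has_basis x wt J N"
proof -
  let ?x = "elim lie i x" and ?wt = "elim (+) i wt" and ?J = "elim_index i J"
  obtain bs where bs: "distinct (map fst bs)" "complex_vs.independent (fst ` set bs)"
    "\<And>b w. (b, w) \<in> set bs \<Longrightarrow> lie_monomial ?x ?wt ?J w b"
    "\<And>w y. lie_monomial ?x ?wt ?J w y \<Longrightarrow> deg w \<le> N \<Longrightarrow> y \<in> lspan {b. (b, w) \<in> set bs}"
    "\<And>a c. a + c \<le> N \<Longrightarrow> log_series (gen_fun ?wt ?J) $ a $ c = (\<Sum>(b, w)\<leftarrow>bs. log_series (weight_series w) $ a $ c)"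
    using basis unfolding has_basis_def by blast
  have "lspan (fst ` set bs) \<subseteq> lie_gen (?x ` ?J)"
    using lie_monomial_in_gen[OF bs(3)] subalgebra_lie_gen[of "?x ` ?J"]
    by (intro complex_vs.span_minimal) (auto simp: subalgebra_def)
  then have new: "x i \<notin> lspan (fst ` set bs)"
    using not_in_elim_gen[OF free i] by blast
  show ?thesis
    unfolding has_basis_def
  proof (intro exI[of _ "(x i, wt i) # bs"] conjI allI impI)
    show "distinct (map fst ((x i, wt i) # bs))"
      using bs(1) new complex_vs.span_base[of "x i" "fst ` set bs"] by auto
    show "complex_vs.independent (fst ` set ((x i, wt i) # bs))"
      using bs(2) new complex_vs.span_base[of "x i" "fst ` set bs"] by (auto simp: complex_vs.independent_insert)
    show "\<forall>(b, w)\<in>set ((x i, wt i) # bs). lie_monomial x wt J w b"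
      using bs(3) i by (auto intro: lie_monomial_gen lie_monomial_elim_imp)
    show "y \<in> lspan {b. (b, w) \<in> set ((x i, wt i) # bs)}"
      if y: "lie_monomial x wt J w y" and w: "deg w \<le> N" for w y
    proof -
      let ?B = "lspan {b. (b, w) \<in> set ((x i, wt i) # bs)}"
      have "{z. z = x i \<and> w = wt i} \<union> {z. lie_monomial ?x ?wt ?J w z} \<subseteq> ?B"
        using bs(4)[OF _ w] complex_vs.span_mono[of "{b. (b, w) \<in> set bs}" "{b. (b, w) \<in> set ((x i, wt i) # bs)}"]
        by (auto intro: complex_vs.span_base)
      then have "lspan ({z. z = x i \<and> w = wt i} \<union> {z. lie_monomial ?x ?wt ?J w z}) \<subseteq> ?B"
        by (intro complex_vs.span_minimal complex_vs.subspace_span)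
      then show ?thesis using lie_monomial_elim_span[OF i y] by blast
    qed
    fix a c assume ac: "a + c \<le> N"
    have "weight_series (wt i) $ 0 = 0"
      using J i by (intro fps_ext) (auto simp: monomial2_nth locally_finite_def)
    then have "log_series (gen_fun wt J) = log_series (weight_series (wt i)) + log_series (gen_fun ?wt ?J)"
      by (intro log_series_mult gen_fun_elim gen_fun_nth_0 locally_finite_elim J i)
    then show "log_series (gen_fun wt J) $ a $ c
        = (\<Sum>(b, w)\<leftarrow>(x i, wt i) # bs. log_series (weight_series w) $ a $ c)"
      using bs(5)[OF ac] by simp
  qed
qed

text \<open>Induction on N + 1 - d, where d bounds the degrees of the generators from below, and
  inside it on the number of generators of degree exactly d. Eliminating one of these lowers the
  number by one, because each bracket with it raises the degree above d; when none is left, d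
  increases.\<close>

theorem free_family_has_basis:
  fixes x :: "nat \<Rightarrow> 'a :: complex_lie_algebra"
  assumes "free_family x J" "locally_finite wt J"
  shows "has_basis x wt J N"
proof -
  have "has_basis x wt J N"
    if "e = Suc N - d" "free_family x J" "locally_finite wt J" "\<And>j. j \<in> J \<Longrightarrow> d \<le> deg (wt j)"
    for e d J and x :: "nat \<Rightarrow> 'a" and wt :: "nat \<Rightarrow> 'w"
    using that
  proof (induction e arbitrary: d x J wt)
    case 0
    then show ?case by (intro has_basis_high_degree) fastforce+
  next
    case (Suc e)
    note IH = Suc.IH and e = Suc.prems(1)
    have "has_basis x wt J N"
      if "n = card {j \<in> J. deg (wt j) = d}" "free_family x J" "locally_finite wt J"
        "\<And>j. j \<in> J \<Longrightarrow> d \<le> deg (wt j)" for n J and x :: "nat \<Rightarrow> 'a" and wt :: "nat \<Rightarrow> 'w"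
      using that
    proof (induction n arbitrary: x J wt)
      case 0
      have "finite {j \<in> J. deg (wt j) = d}"
        using 0(3) unfolding locally_finite_def by (auto intro: finite_subset[of _ "{j \<in> J. deg (wt j) \<le> d}"])
      then have "\<And>j. j \<in> J \<Longrightarrow> Suc d \<le> deg (wt j)"
        using 0 by (metis (mono_tags, lifting) card_0_eq empty_Collect_eq le_antisym not_less_eq_eq)
      then show ?case using e 0 by (intro IH[of "Suc d"]) auto
    next
      case (Suc n)
      let ?wt = "\<lambda>i. elim (+) i wt"
      obtain i where i: "i \<in> J" "deg (wt i) = d"
        using Suc.prems(1) by (metis (mono_tags, lifting) Collect_empty_eq card.empty nat.distinct(1))
      have di: "1 \<le> deg (wt i)" using Suc.prems(3) i(1) by (auto simp: locally_finite_def deg_def)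
      have "{l \<in> elim_index i J. deg (?wt i l) = d} = (\<lambda>j. prod_encode (j, 0)) ` ({j \<in> J. deg (wt j) = d} - {i})"
      proof (intro equalityI subsetI)
        fix l assume "l \<in> {l \<in> elim_index i J. deg (?wt i l) = d}"
        then obtain j k where l: "l = prod_encode (j, k)" "j \<in> J" "j \<noteq> i" "deg (wt j) + k * deg (wt i) = d"
          by (force simp: elim_index_def deg_funpow)
        moreover have "k = 0" using l(4) i(2) di Suc.prems(4)[OF l(2)] by (cases k) auto
        ultimately show "l \<in> (\<lambda>j. prod_encode (j, 0)) ` ({j \<in> J. deg (wt j) = d} - {i})" by auto
      qed (auto simp: elim_index_def)
      moreover have "card (\<dots>) = card ({j \<in> J. deg (wt j) = d} - {i})"
        by (rule card_image) (auto simp: inj_on_def)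
      moreover have "card ({j \<in> J. deg (wt j) = d} - {i}) = n"
        using Suc.prems(1) i by (subst card_Diff_singleton) auto
      ultimately have "n = card {l \<in> elim_index i J. deg (?wt i l) = d}" by simp
      moreover have "d \<le> deg (?wt i l)" if "l \<in> elim_index i J" for l
        using that by (auto simp: elim_index_def deg_funpow intro!: trans_le_add1 Suc.prems(4))
      ultimately have "has_basis (elim lie i x) (?wt i) (elim_index i J) N"
        by (intro Suc.IH free_family_elim locally_finite_elim Suc.prems(2,3) i(1))
      then show ?case by (rule has_basis_elim[OF Suc.prems(2,3) i(1)])
    qed
    then show ?case using Suc.prems(2-4) by blast
  qed
  from this[of "Suc N" 0] assms show ?thesis by simp
qed

end

section \<open>Freeness of the root strings\<close>

locale one_real_root_algebra = one_real_root A r s \<mu> + borcherds_kac_moody_algebra A \<pi> D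
  for A :: "'i :: countable \<Rightarrow> 'i \<Rightarrow> real" and r :: 'i and s :: "'i \<Rightarrow> nat" and \<mu> :: "'i \<Rightarrow> real"
    and \<pi> :: "'i bkm_gen free_lie \<Rightarrow> 'g :: complex_lie_algebra" and D :: "'g set"
begin

definition string :: "'i \<times> nat \<Rightarrow> 'i bkm_gen free_lie" where
  "string = (\<lambda>(i, k). (lie (gen_e r) ^^ k) (gen_e i))"

definition strings :: "'i bkm_gen free_lie set" where
  "strings = string ` {a. valid a}"

text \<open>The scalar of \<open>ad_E_push\<close>, by which the image of a string under
  \<open>rep\<close> differs from its letter.\<close>

definition \<kappa> :: "'i \<times> nat \<Rightarrow> complex" where
  "\<kappa> = (\<lambda>(i, k). complex_of_nat (\<Prod>l<k. s i - l))"

lemma \<kappa>_nz: "valid a \<Longrightarrow> \<kappa> a \<noteq> 0"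
  by (auto simp: \<kappa>_def valid_def prod_zero_iff simp del: of_nat_prod)

lemma rep_string: "valid a \<Longrightarrow> rep (string a) = \<kappa> a *\<^sub>C push a"
  by (auto simp: string_def \<kappa>_def valid_def lie_hom_ad_pow[OF lie_hom_rep] rep_gen ad_E_push
      simp del: of_nat_prod)

lemma \<pi>_string: "\<pi> (string (i, k)) = (lie (e r) ^^ k) (e i)"
  by (simp add: string_def lie_hom_ad_pow[OF hom] e_def)

definition valid_words :: "('i \<times> nat) list set" where
  "valid_words = {w. w \<noteq> [] \<and> (\<forall>a\<in>set w. valid a)}"

text \<open>Operators that map the span of all valid words into the span of the nonempty ones form a
  subalgebra, and each string acts as a multiple of a valid letter.\<close>

lemma rep_vac_mem:
  assumes x: "x \<in> lie_gen strings"
  shows "app (rep x) (bas []) \<in> complex_vs.span (bas ` valid_words)"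
proof -
  let ?V = "complex_vs.span (bas ` valid_words)" and ?U = "complex_vs.span (bas ` (insert [] valid_words))"
  let ?K = "{X. \<forall>t\<in>?U. app X t \<in> ?V}"
  have VU: "?V \<subseteq> ?U" by (intro complex_vs.span_mono) auto
  have "rep x \<in> ?K"
  proof (rule lie_hom_on_image_mem[OF _ _ _ x])
    show "lie_hom_on (lie_gen strings) rep"
      using lie_hom_rep lie_hom_on_subset unfolding lie_hom_iff by blast
    show "subalgebra ?K"
      using VU by (auto simp: subalgebra_def complex_vs.subspace_def app_simps
          intro!: complex_vs.span_zero complex_vs.span_add complex_vs.span_scale complex_vs.span_diff)
    fix y assume "y \<in> strings"
    then obtain a where a: "valid a" "y = string a" by (auto simp: strings_def)
    have "app (push a) t \<in> ?V" if "t \<in> ?U" for t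
    proof (rule lin_mem_span[OF lin_app _ that])
      fix t assume "t \<in> bas ` (insert [] valid_words)"
      then show "app (push a) t \<in> ?V"
        using a(1) by (auto simp: valid_words_def intro!: complex_vs.span_base)
    qed
    then show "rep y \<in> ?K"
      using a by (auto simp: rep_string app_simps intro!: complex_vs.span_scale)
  qed
  then show ?thesis by (auto intro: complex_vs.span_base)
qed

lemma H_word:
  assumes "\<forall>a\<in>set w. valid a"
  shows "app (H j) (bas w) = complex_of_real (\<Sum>(i, k)\<leftarrow>w. A j i + real k * A j r) *\<^sub>C bas w"
  using assms
proof (induction w)
  case (Cons a w)
  obtain i k where a: "a = (i, k)" by force
  have "app (H j) (bas (a # w)) = app (lie (H j) (push a)) (bas w) + app (push a) (app (H j) (bas w))"
    by (simp add: app_simps)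
  then show ?case using Cons by (simp add: a lie_push app_simps scaleC_add_left algebra_simps)
qed simp

text \<open>The kernel of \<open>\<pi>\<close> is only known to be central modulo the relations. Central elements have
  weight zero, whereas all nonempty words have negative weight for some \<open>h\<^sub>i\<close>.\<close>

lemma vac_eq_0:
  assumes x: "x \<in> lie_gen strings" and \<pi>x: "\<pi> x = 0"
  shows "app (rep x) (bas []) = 0"
proof -
  define t where "t = app (rep x) (bas [])"
  have t: "t \<in> complex_vs.span (bas ` valid_words)" unfolding t_def by (rule rep_vac_mem[OF x])
  have Ht: "app (H j) t = 0" for j
  proof -
    \<comment> \<open>Here centrality of the kernel enters: the bracket, if not x itself, lies in
      the ideal of relations.\<close>
    have "rep (lie (gen_h j) x) = 0" by (intro rep_ideal central \<pi>x)
    then have "app (lie (H j) (rep x)) (bas []) = 0" by (simp add: rep_lie rep_gen app_simps)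
    then show ?thesis by (simp add: t_def app_simps)
  qed
  have coef: "(w \<notin> valid_words \<longrightarrow> coef t w = 0) \<and>
      coef (app (H j) t) w = complex_of_real (\<Sum>(i, k)\<leftarrow>w. A j i + real k * A j r) * coef t w" for w j
    using t
  proof (induction rule: complex_vs.span_induct_alt)
    case base
    then show ?case by (simp add: app_simps)
  next
    case (step c v t)
    then obtain w' where w': "v = bas w'" "w' \<in> valid_words" by auto
    then have "app (H j) v = complex_of_real (\<Sum>(i, k)\<leftarrow>w'. A j i + real k * A j r) *\<^sub>C bas w'"
      by (auto simp: valid_words_def intro!: H_word)
    then show ?case using step w'
      by (auto simp: app_simps lookup_add lookup_scaleC lookup_bas algebra_simps)
  qed
  have "coef t w = 0" for w
  proof (cases "w \<in> valid_words")
    case True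
    then obtain i k w' where w: "w = (i, k) # w'" "\<forall>a\<in>set w. valid a"
      unfolding valid_words_def by (cases w) auto
    \<comment> \<open>The root \<open>i\<close> is the one of the first letter. Entries between
      imaginary roots are negative, so every letter of the word, and hence the word, has negative
      weight for \<open>H i\<close>.\<close>
    have neg: "A i j + real l * A i r < 0" if "(j, l) \<in> set w" for j l
    proof -
      have "i \<noteq> r" "j \<noteq> r" using w that by (auto simp: valid_def)
      then have "A i j < 0" "A i r \<le> 0" using A_neg A_ir[of i] \<mu>_pos[of i] by auto
      then show ?thesis using mult_nonneg_nonpos[of "real l" "A i r"] by linarith
    qed
    have nonpos: "(\<Sum>(j, l)\<leftarrow>w''. A i j + real l * A i r) \<le> 0" if "set w'' \<subseteq> set w" for w''
      using that by (induction w'') (use neg in \<open>force simp: split_beta\<close>)+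
    have "set w' \<subseteq> set w" using w(1) by auto
    from nonpos[OF this] neg[of i k] have "(\<Sum>(j, l)\<leftarrow>w. A i j + real l * A i r) < 0"
      unfolding w(1) by simp
    moreover have "complex_of_real (\<Sum>(j, l)\<leftarrow>w. A i j + real l * A i r) * coef t w = 0"
      using coef[of w i] Ht[of i] by simp
    ultimately show ?thesis by (metis less_irrefl mult_eq_0_iff of_real_eq_0_iff)
  qed (use coef in blast)
  then show ?thesis unfolding t_def by (intro poly_mapping_eqI) simp
qed

text \<open>An element of the image is lifted to the free Lie algebra and evaluated there. The
  choice of the lift is harmless: \<open>op_eval\<close> looks only at the value at the empty word,
  which is 0 on the kernel of \<open>\<pi>\<close> by \<open>vac_eq_0\<close>.\<close>

theorem strings_free:
  fixes A' :: "'i \<times> nat \<Rightarrow> 'm :: complex_lie_algebra linop"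
  shows "\<exists>\<Phi>. lie_hom_on (lie_gen (\<pi> ` strings)) \<Phi> \<and> (\<forall>a. valid a \<longrightarrow> \<Phi> (\<pi> (string a)) = A' a)"
proof -
  \<comment> \<open>Strings act as \<open>\<kappa> a\<close> times the letter, so the prescribed
    operators are divided by \<open>\<kappa> a\<close>.\<close>
  let ?A = "\<lambda>a. inverse (\<kappa> a) *\<^sub>C A' a"
  define \<Psi> where "\<Psi> x = op_eval ?A (rep x)" for x
  have rep: "lie_hom_on (lie_gen strings) rep"
    using lie_hom_rep lie_hom_on_subset unfolding lie_hom_iff by blast
  have ev: "rep x \<in> evaluable ?A" if "x \<in> lie_gen strings" for x
  proof (rule lie_hom_on_image_mem[OF rep subalgebra_evaluable _ that])
    fix y assume "y \<in> strings"
    then obtain a where "valid a" "y = string a" by (auto simp: strings_def)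
    then show "rep y \<in> evaluable ?A"
      using subalgebra_evaluable[of ?A] push_evaluable[of a ?A]
      by (auto simp: rep_string subalgebra_def intro!: complex_vs.subspace_scale)
  qed
  have \<Psi>: "lie_hom_on (lie_gen strings) \<Psi>"
    unfolding \<Psi>_def[abs_def] by (rule lie_hom_on_comp[OF rep lie_hom_on_op_eval ev])
  have lin_\<pi>: "lin \<pi>" and \<pi>_lie: "\<pi> (lie x y) = lie (\<pi> x) (\<pi> y)" for x y
    using hom by (auto simp: lie_hom_def)
  have sub: "complex_vs.subspace (lie_gen strings)"
    using subalgebra_lie_gen by (auto simp: subalgebra_def)
  have well: "\<Psi> x = \<Psi> y" if xy: "x \<in> lie_gen strings" "y \<in> lie_gen strings" "\<pi> x = \<pi> y" for x y
  proof -
    have mem: "x - y \<in> lie_gen strings" using xy sub by (intro complex_vs.subspace_diff)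
    have "\<pi> (x - y) = 0" using xy by (simp add: lin_diff[OF lin_\<pi>])
    then have "\<Psi> (x - y) = 0"
      using vac_eq_0[OF mem] by (simp add: \<Psi>_def op_eval_def lin_0[OF lin_word_eval])
    moreover have "\<Psi> ((x - y) + y) = \<Psi> (x - y) + \<Psi> y"
      by (rule lie_hom_on_add[OF \<Psi> mem xy(2)])
    ultimately show ?thesis by simp
  qed
  define \<Phi> where "\<Phi> y = \<Psi> (SOME x. x \<in> lie_gen strings \<and> \<pi> x = y)" for y
  have \<Phi>\<pi>: "\<Phi> (\<pi> x) = \<Psi> x" if "x \<in> lie_gen strings" for x
    unfolding \<Phi>_def using that
    by (rule_tac someI2[of "\<lambda>x'. x' \<in> lie_gen strings \<and> \<pi> x' = \<pi> x" x]) (auto intro: well)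
  have "lie_gen (\<pi> ` strings) \<subseteq> \<pi> ` lie_gen strings"
  proof (rule lie_gen_least)
    show "subalgebra (\<pi> ` lie_gen strings)"
      unfolding subalgebra_def complex_vs.subspace_def
    proof (intro conjI ballI allI)
      show "0 \<in> \<pi> ` lie_gen strings"
        using lie_gen_zero lin_0[OF lin_\<pi>] by (metis imageI)
    qed (auto simp: lin_add[OF lin_\<pi>, symmetric] lin_scale[OF lin_\<pi>, symmetric] \<pi>_lie[symmetric]
        intro!: imageI lie_gen_add lie_gen_scale lie_gen_lie)
  qed (auto intro: lie_gen_base)
  moreover have "lie_hom_on (\<pi> ` lie_gen strings) \<Phi>"
    unfolding lie_hom_on_def
    by (auto simp: lin_add[OF lin_\<pi>, symmetric] lin_scale[OF lin_\<pi>, symmetric] \<pi>_lie[symmetric] \<Phi>\<pi>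
        lie_gen_add lie_gen_scale lie_gen_lie lie_hom_on_add[OF \<Psi>] lie_hom_on_scale[OF \<Psi>] lie_hom_on_lie[OF \<Psi>])
  ultimately have "lie_hom_on (lie_gen (\<pi> ` strings)) \<Phi>" using lie_hom_on_subset by blast
  moreover have "\<Phi> (\<pi> (string a)) = A' a" if a: "valid a" for a
  proof -
    have "string a \<in> lie_gen strings" using a by (auto simp: strings_def intro: lie_gen_base)
    then have "\<Phi> (\<pi> (string a)) = op_eval ?A (\<kappa> a *\<^sub>C push a)"
      by (simp add: \<Phi>\<pi> \<Psi>_def rep_string a)
    also have "\<dots> = \<kappa> a *\<^sub>C ?A a"
      by (simp add: lie_hom_on_scale[OF lie_hom_on_op_eval push_evaluable])
    also have "\<dots> = A' a" using \<kappa>_nz[OF a] by (simp add: scaleC_scaleC scaleC_one)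
    finally show ?thesis .
  qed
  ultimately show ?thesis by blast
qed

end

section \<open>The root space decomposition\<close>

lemma subalgebra_span:
  assumes "\<And>x y. x \<in> S \<Longrightarrow> y \<in> S \<Longrightarrow> lie x y \<in> lspan S"
  shows "subalgebra (lspan S)"
  unfolding subalgebra_def using lie_mem_span[of S S S, OF assms] by auto

text \<open>Here \<open>u\<close> raises, \<open>v\<close> lowers and \<open>K\<close> is diagonal.
  Let N be generated by the \<open>u i\<close>. The bracket of \<open>v i\<close> with a generator
  lies in \<open>K\<close>, and brackets of N + K with N stay in N, so the derivation by
  \<open>v i\<close> maps N into N + K. The roles of \<open>u\<close> and \<open>v\<close> are later
  played by e and f in both orders.\<close>

lemma ad_lowering:
  fixes u v :: "'i \<Rightarrow> 'g :: complex_lie_algebra" and K :: "'g set"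
  assumes Ku: "\<And>y i. y \<in> K \<Longrightarrow> \<exists>c. lie y (u i) = c *\<^sub>C u i" and vu: "\<And>i j. lie (v i) (u j) \<in> K"
  shows "k \<in> K \<Longrightarrow> y \<in> lie_gen (range u) \<Longrightarrow> lie k y \<in> lie_gen (range u)"
    and "y \<in> lie_gen (range u) \<Longrightarrow> lie (v i) y \<in> lspan (lie_gen (range u) \<union> K)"
proof -
  let ?N = "lie_gen (range u)"
  show Kn: "lie k y \<in> ?N" if "k \<in> K" "y \<in> ?N" for k y
    using that(2)
  proof induction
    case (lie_gen_base y)
    then show ?case using Ku[OF that(1)] by (metis lie_gen.lie_gen_base lie_gen_scale rangeE rangeI)
  next
    case (lie_gen_lie y z)
    show ?case unfolding lie_derivation[of k y z]
      by (rule lie_gen.intros(3)[OF lie_gen.intros(5)[OF lie_gen_lie.IH(1) lie_gen_lie.hyps(2)]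
        lie_gen.intros(5)[OF lie_gen_lie.hyps(1) lie_gen_lie.IH(2)]])
  qed (simp_all add: bracket_add_right lie_scaleC_right lie_gen.intros)
  have sub: "lspan ?N = ?N"
    using subalgebra_lie_gen[of "range u"] by (simp add: subalgebra_def complex_vs.span_eq_iff)
  show "lie (v i) y \<in> lspan (?N \<union> K)" if "y \<in> ?N"
    using that
  proof induction
    case (lie_gen_base y)
    then show ?case using vu by (auto intro: complex_vs.span_base)
  next
    case (lie_gen_lie y z)
    have "lie w x \<in> ?N" if "w \<in> lspan (?N \<union> K)" "x \<in> ?N" for w x
    proof -
      have "lie w x \<in> lspan ?N"
      proof (rule lie_mem_span[OF _ that(1)])
        show "x \<in> lspan ?N" by (rule complex_vs.span_base[OF that(2)])
        show "lie a b \<in> lspan ?N" if "a \<in> ?N \<union> K" "b \<in> ?N" for a b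
          unfolding sub using that Kn by (auto intro: lie_gen.intros)
      qed
      then show ?thesis unfolding sub .
    qed
    note ad = this
    have "lie (lie (v i) y) z \<in> ?N" by (rule ad) (use lie_gen_lie in auto)
    moreover have "- lie (lie (v i) z) y \<in> ?N"
      using ad[of "lie (v i) z" y] lie_gen_lie subalgebra_lie_gen[of "range u"]
      by (auto simp: subalgebra_def complex_vs.subspace_neg)
    then have "lie y (lie (v i) z) \<in> ?N" by (subst lie_anticommute)
    ultimately have "lie (v i) (lie y z) \<in> ?N" unfolding lie_derivation[of "v i" y z] by (rule lie_gen_add)
    then show ?case by (auto intro: complex_vs.span_base)
  qed (auto simp: bracket_add_right lie_scaleC_right
      intro: complex_vs.span_zero complex_vs.span_add complex_vs.span_scale)
qed

context borcherds_kac_moody_algebra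
begin

lemma lin_\<pi>: "lin \<pi>" and \<pi>_lie: "\<pi> (lie x y) = lie (\<pi> x) (\<pi> y)"
  using hom by (auto simp: lie_hom_def)

lemma \<pi>_relation: "x \<in> bkm_relations A \<Longrightarrow> \<pi> x = 0"
  by (rule relations) (auto simp: bkm_ideal_def lie_ideal_hull_def)

lemma lie_e_f: "lie (e i) (f j) = (if i = j then h i else 0)"
proof -
  have "\<pi> (lie (gen_e i) (gen_f j) - (if i = j then gen_h i else 0)) = 0"
    by (rule \<pi>_relation) (auto simp: bkm_relations_def)
  then show ?thesis
    by (simp add: lin_diff[OF lin_\<pi>] \<pi>_lie e_def f_def h_def lin_0[OF lin_\<pi>] split: if_splits)
qed

end

context fricke_lie_algebra
begin

abbreviation r :: 'i where "r \<equiv> real_index"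
abbreviation cc :: complex where "cc \<equiv> complex_of_real (q r * A r r)"

section \<open>Pairings of roots with the Weyl vector and the real simple root\<close>

lemma subspace_cartan: "complex_vs.subspace cartan"
  by (simp add: cartan_def)

lemmas cartan_add = complex_vs.subspace_add[OF subspace_cartan]
  and cartan_scale = complex_vs.subspace_scale[OF subspace_cartan]
  and cartan_diff = complex_vs.subspace_diff[OF subspace_cartan]
  and cartan_neg = complex_vs.subspace_neg[OF subspace_cartan]

lemma h_cartan: "h i \<in> cartan" and D_cartan: "D \<subseteq> cartan"
  by (auto simp: cartan_def intro: complex_vs.span_base)

lemma form_add_right: "x \<in> cartan \<Longrightarrow> y \<in> cartan \<Longrightarrow> z \<in> cartan \<Longrightarrow> form z (x + y) = form z x + form z y"
  by (metis form_add form_commute cartan_add)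

lemma form_scale_right: "x \<in> cartan \<Longrightarrow> z \<in> cartan \<Longrightarrow> form z (a *\<^sub>C x) = a * form z x"
  by (metis form_scaleC form_commute cartan_scale)

lemma form_minus: "x \<in> cartan \<Longrightarrow> y \<in> cartan \<Longrightarrow> form (- x) y = - form x y"
  using form_scaleC[of x y "- 1"] by (simp add: complex_vs.scale_minus_left scaleC_one)

lemma form_diff: "x \<in> cartan \<Longrightarrow> z \<in> cartan \<Longrightarrow> y \<in> cartan \<Longrightarrow> form (x - z) y = form x y - form z y"
  using form_add[of x "- z" y] by (simp add: form_minus cartan_neg)

lemma cc_pos: "0 < q r * A r r" and cc_nz: "cc \<noteq> 0"
proof -
  show *: "0 < q r * A r r"
    unfolding real_index_def using one_real_simple_root by (rule theI')
  then show "cc \<noteq> 0" by (simp only: of_real_eq_0_iff)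
qed

lemma q_pos: "0 < q i"
  using symmetrizer by (simp add: symmetrizer_def)

lemma A_rr_eq: "A r r = 2"
  using cc_pos q_pos[of r] cartan_matrix by (auto simp: generalized_cartan_matrix_def zero_less_mult_iff)

lemma form_simple: "form (simple_root i) (simple_root j) = complex_of_real (q i * A i j)"
  using form_simple_roots by (simp add: simple_root_def)

lemma form_simple_rho: "form (simple_root r) \<rho> = - cc / 2" "form \<rho> (simple_root r) = - cc / 2"
  using weyl_vector[of r] form_commute[OF simple_root_cartan weyl_vector_cartan]
  by (simp_all add: simple_root_def)

lemma degree_root_cartan: "degree_root m n \<in> cartan"
  unfolding degree_root_def
  by (intro cartan_diff cartan_scale cartan_neg weyl_vector_cartan simple_root_cartan)

lemma form_degree_root:
  assumes "y \<in> cartan"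
  shows "form (degree_root m n) y = - of_int (m + n) * form \<rho> y - of_int n * form (simple_root r) y"
  unfolding degree_root_def using assms
  by (simp only: form_diff form_scaleC form_minus cartan_scale cartan_neg weyl_vector_cartan simple_root_cartan)
    (simp add: algebra_simps)

lemma form_degree_root_add:
  "y \<in> cartan \<Longrightarrow> form (degree_root (m + m') (n + n')) y = form (degree_root m n) y + form (degree_root m' n') y"
  by (simp add: form_degree_root algebra_simps)

lemma form_degree_root_rho: "form (degree_root m n) \<rho> = of_int n * cc / 2"
  by (simp only: form_degree_root weyl_vector_cartan weyl_vector_null form_simple_rho) simp

lemma form_degree_root_simple: "form (degree_root m n) (simple_root r) = of_int (m - n) * cc / 2"
  by (simp only: form_degree_root simple_root_cartan form_simple form_simple_rho) (simp add: field_simps)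

definition level :: "'i \<Rightarrow> nat" where
  "level i = (SOME n. 1 \<le> n \<and> simple_root i = degree_root 1 (int n) \<and> e i \<in> graded_piece 1 (int n))"

lemma level:
  assumes "i \<noteq> r"
  shows "1 \<le> level i" "simple_root i = degree_root 1 (int (level i))"
    "e i \<in> graded_piece 1 (int (level i))"
proof -
  have "\<exists>n. 1 \<le> n \<and> simple_root i = degree_root 1 (int n) \<and> e i \<in> graded_piece 1 (int n)"
    using simple_root_degree[OF assms] by metis
  from someI_ex[OF this] show "1 \<le> level i" "simple_root i = degree_root 1 (int (level i))"
    "e i \<in> graded_piece 1 (int (level i))"
    unfolding level_def by blast+
qed

text \<open>On degrees the form is ((m, n), (m', n')) = - (m n' + n m') \<open>cc\<close> / 2; here
  m = m' = 1.\<close>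

lemma form_simple_imag:
  assumes "i \<noteq> r" "j \<noteq> r"
  shows "q i * A i j = - (q r * A r r) * (real (level i) + real (level j)) / 2"
proof -
  have "complex_of_real (q i * A i j) = form (degree_root 1 (int (level i))) (simple_root j)"
    using form_simple[of i j] level(2)[OF assms(1)] by simp
  also have "\<dots> = form (simple_root j) (degree_root 1 (int (level i)))"
    by (rule form_commute[OF degree_root_cartan simple_root_cartan])
  also have "\<dots> = form (degree_root 1 (int (level i))) (degree_root 1 (int (level j)))"
    using level(2)[OF assms(2)] form_commute[OF degree_root_cartan degree_root_cartan] by simp
  also have "\<dots> = - of_int (1 + int (level i)) * form (degree_root 1 (int (level j))) \<rho>
      - of_int (int (level i)) * form (degree_root 1 (int (level j))) (simple_root r)"
    unfolding form_degree_root[OF degree_root_cartan, of 1 "int (level i)"]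
    using form_commute[OF degree_root_cartan weyl_vector_cartan]
      form_commute[OF degree_root_cartan simple_root_cartan] by simp
  also have "\<dots> = complex_of_real (- (q r * A r r) * (real (level i) + real (level j)) / 2)"
    unfolding form_degree_root_rho form_degree_root_simple by (simp add: field_simps)
  finally show ?thesis by (simp only: of_real_eq_iff)
qed

text \<open>A root of degree (1, n) pairs with the real simple root to (1 - n) \<open>cc\<close> /
  2, which gives \<open>A r i = 1 - level i\<close> and a string with \<open>level i\<close>
  members. The ratio of the symmetrizing factors turns \<open>A r i\<close> into
  \<open>A i r\<close>.\<close>

lemma one_real_root: "one_real_root A r (\<lambda>i. level i - 1) (\<lambda>i. q r / q i)"
proof
  show "A r r = 2" by (rule A_rr_eq)
  show pos: "0 < q r / q i" for i using q_pos by simp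
  fix i assume i: "i \<noteq> r"
  have "complex_of_real (q r * A r i) = form (simple_root i) (simple_root r)"
    using form_simple[of r i] form_commute[OF simple_root_cartan simple_root_cartan] by simp
  also have "\<dots> = of_int (1 - int (level i)) * cc / 2"
    unfolding level(2)[OF i] form_degree_root_simple ..
  also have "\<dots> = complex_of_real (q r * (1 - real (level i)))"
    by (simp add: A_rr_eq)
  finally have "q r * A r i = q r * (1 - real (level i))" by (simp only: of_real_eq_iff)
  then show ri: "A r i = - real (level i - 1)"
    using q_pos[of r] level(1)[OF i] by (simp add: of_nat_diff)
  have "q i * A i r = q r * A r i" using symmetrizer by (simp add: symmetrizer_def)
  then show "A i r = - (q r / q i) * real (level i - 1)"
    using ri q_pos[of i] by (simp add: field_simps)
  fix j assume j: "j \<noteq> r"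
  have "q i * A i j < 0"
    unfolding form_simple_imag[OF i j] using cc_pos level(1)[OF i] by (simp add: mult_pos_pos)
  then show "A i j < 0" using q_pos[of i] by (simp add: mult_less_0_iff)
qed

lemma one_real_root_algebra: "one_real_root_algebra A r (\<lambda>i. level i - 1) (\<lambda>i. q r / q i) \<pi> D"
  by (intro one_real_root_algebra.intro one_real_root borcherds_kac_moody_algebra_axioms)

section \<open>Graded pieces and their generators\<close>

lemma graded_pieceD: "x \<in> graded_piece m n \<Longrightarrow> y \<in> cartan \<Longrightarrow> lie y x = form (degree_root m n) y *\<^sub>C x"
  by (simp add: graded_piece_def)

lemma subspace_graded_piece: "complex_vs.subspace (graded_piece m n)"
  by (auto simp: complex_vs.subspace_def graded_piece_def bracket_add_right lie_scaleC_right
      scaleC_add_right scaleC_scaleC mult.commute)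

lemma graded_piece_lie:
  assumes "a \<in> graded_piece m n" "b \<in> graded_piece m' n'"
  shows "lie a b \<in> graded_piece (m + m') (n + n')"
  unfolding graded_piece_def
proof (intro CollectI ballI)
  fix y assume y: "y \<in> cartan"
  show "lie y (lie a b) = form (degree_root (m + m') (n + n')) y *\<^sub>C lie a b"
    using assms by (simp add: lie_derivation[of y a b] graded_pieceD y form_degree_root_add
        lie_scaleC_left lie_scaleC_right scaleC_add_left)
qed

lemma e_r_graded: "e r \<in> graded_piece 1 (- 1)"
  unfolding graded_piece_def using cartan_e[of _ r] by (simp add: real_simple_root_degree simple_root_def)

lemma f_graded: "\<exists>n. f i \<in> graded_piece (- 1) n"
proof -
  obtain n where n: "simple_root i = degree_root 1 n"
    by (cases "i = r") (metis real_simple_root_degree, metis level(2))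
  have neg: "form (degree_root (- 1) (- n)) y = - form (degree_root 1 n) y" if "y \<in> cartan" for y
    using that by (simp add: form_degree_root algebra_simps)
  have "lie y (f i) = form (degree_root (- 1) (- n)) y *\<^sub>C f i" if y: "y \<in> cartan" for y
    using cartan_f[OF y, of i] unfolding neg[OF y] n[symmetric] simple_root_def
    by (simp add: complex_vs.scale_minus_left)
  then show ?thesis unfolding graded_piece_def by blast
qed

text \<open>Each \<open>h i\<close> is the bracket of \<open>e i\<close> and \<open>f i\<close>,
  whose weights cancel.\<close>

lemma cartan_commute:
  assumes "y \<in> cartan" "z \<in> cartan"
  shows "lie y z = 0"
proof -
  have yh: "lie y (h i) = 0" if "y \<in> cartan" for y i
  proof -
    have "lie y (h i) = lie y (lie (e i) (f i))" by (simp add: lie_e_f)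
    also have "\<dots> = 0"
      using that by (simp add: lie_derivation[of y] cartan_e cartan_f lie_scaleC_left lie_scaleC_right)
    finally show ?thesis .
  qed
  have hd: "lie a b = 0" if "a \<in> range h \<union> D" "b \<in> range h \<union> D" for a b
  proof (cases "b \<in> range h")
    case True
    then show ?thesis using that yh h_cartan D_cartan by auto
  next
    case False
    then show ?thesis
      using that commutative_D yh[of b] D_cartan lie_anticommute[of a b] by auto
  qed
  have "lie y z \<in> lspan {}"
    using assms unfolding cartan_def by (rule lie_mem_span[rotated]) (simp add: hd)
  then show ?thesis by simp
qed

lemma cartan_graded: "cartan \<subseteq> graded_piece 0 0"
  by (auto simp: graded_piece_def cartan_commute form_degree_root)

definition low :: "'g set" where
  "low = {x. \<exists>m n. m \<le> 0 \<and> x \<in> graded_piece m n}"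

text \<open>The span of the subalgebra of the f's, the Cartan subalgebra and the subalgebra of the
  e's is stable under brackets with all generators, hence contains \<open>range \<pi>\<close>;
  adding \<open>D\<close> gives everything. The first two lie in the span of pieces with m \<le>
  0.\<close>

lemma span_low_pos: "lspan (low \<union> lie_gen (range e)) = UNIV"
proof -
  let ?P = "lie_gen (range e)" and ?N = "lie_gen (range f)"
  let ?S = "?N \<union> cartan \<union> ?P"
  have ecart: "\<exists>c. lie y (e i) = c *\<^sub>C e i" if "y \<in> cartan" for y i using cartan_e[OF that] by blast
  have fcart: "\<exists>c. lie y (f i) = c *\<^sub>C f i" if "y \<in> cartan" for y i
    using cartan_f[OF that] by (metis complex_vs.scale_minus_left)
  have ef: "lie (e i) (f j) \<in> cartan" for i j
    using h_cartan complex_vs.subspace_0[OF subspace_cartan] by (simp add: lie_e_f)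
  have fe: "lie (f i) (e j) \<in> cartan" for i j
    using cartan_neg[OF ef] by (subst lie_anticommute)
  have low1: "k \<in> cartan \<Longrightarrow> y \<in> ?P \<Longrightarrow> lie k y \<in> ?P" "y \<in> ?P \<Longrightarrow> lie (f i) y \<in> lspan (?P \<union> cartan)" for k y i
    using ad_lowering[where K = cartan and u = e and v = f] ecart fe by blast+
  have low2: "k \<in> cartan \<Longrightarrow> y \<in> ?N \<Longrightarrow> lie k y \<in> ?N" "y \<in> ?N \<Longrightarrow> lie (e i) y \<in> lspan (?N \<union> cartan)" for k y i
    using ad_lowering[where K = cartan and u = f and v = e] fcart ef by blast+
  have mono: "x \<in> lspan ?S" if "x \<in> lspan T" "T \<subseteq> ?S" for x T
    using complex_vs.span_mono[OF that(2)] that(1) by blast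
  have closed: "lie g x \<in> lspan ?S" if g: "g \<in> range h \<union> range e \<union> range f" and x: "x \<in> lspan ?S" for g x
  proof (rule lin_mem_span[OF lin_lie _ x])
    fix u assume u: "u \<in> ?S"
    consider i where "g = h i" | i where "g = e i" | i where "g = f i" using g by blast
    then show "lie g u \<in> lspan ?S"
    proof cases
      case 1
      have "lie g u = 0 \<or> lie g u \<in> ?S" unfolding 1
        using u low1(1)[OF h_cartan] low2(1)[OF h_cartan] cartan_commute[OF h_cartan] by blast
      then show ?thesis by (auto intro: complex_vs.span_zero complex_vs.span_base)
    next
      case 2
      consider "u \<in> ?N" | "u \<in> cartan" | "u \<in> ?P" using u by blast
      then show ?thesis
      proof cases
        case 1
        then show ?thesis unfolding 2 using mono[OF low2(2)] by blast
      next
        case c: 2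
        then obtain c where "lie u (e i) = c *\<^sub>C e i" using ecart by blast
        then have "lie (e i) u = (- c) *\<^sub>C e i" by (subst lie_anticommute) (simp add: complex_vs.scale_minus_left)
        moreover have "e i \<in> ?S" by (auto intro: lie_gen_base)
        ultimately show ?thesis unfolding 2 by (simp only: complex_vs.span_scale complex_vs.span_base)
      next
        case 3
        then show ?thesis unfolding 2 by (intro complex_vs.span_base) (auto intro: lie_gen.intros)
      qed
    next
      case 2: 3
      consider "u \<in> ?P" | "u \<in> cartan" | "u \<in> ?N" using u by blast
      then show ?thesis
      proof cases
        case 1
        then show ?thesis unfolding 2 using mono[OF low1(2)] by blast
      next
        case c: 2
        then obtain c where "lie u (f i) = c *\<^sub>C f i" using fcart by blast
        then have "lie (f i) u = (- c) *\<^sub>C f i" by (subst lie_anticommute) (simp add: complex_vs.scale_minus_left)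
        moreover have "f i \<in> ?S" by (auto intro: lie_gen_base)
        ultimately show ?thesis unfolding 2 by (simp only: complex_vs.span_scale complex_vs.span_base)
      next
        case 3
        then show ?thesis unfolding 2 by (intro complex_vs.span_base) (auto intro: lie_gen.intros)
      qed
    qed
  qed
  \<comment> \<open>Requiring also that bracketing preserves the span makes this a subalgebra. It
    contains the images of the generators by \<open>closed\<close>, hence all of
    \<open>range \<pi>\<close>.\<close>
  let ?K = "{x \<in> lspan ?S. \<forall>u\<in>lspan ?S. lie x u \<in> lspan ?S}"
  have "subalgebra ?K"
    unfolding subalgebra_def complex_vs.subspace_def
    by (auto simp: bracket_add_left lie_scaleC_left lie_lie_left
        intro: complex_vs.span_zero complex_vs.span_add complex_vs.span_scale complex_vs.span_diff)
  moreover have "\<pi> y \<in> ?K" if "y \<in> range free_gen" for y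
  proof -
    from that obtain g where "y = free_gen g" by blast
    then have "\<pi> y \<in> range h \<union> range e \<union> range f"
      by (cases g) (auto simp: h_def e_def f_def)
    moreover from this have "\<pi> y \<in> lspan ?S"
      using h_cartan by (auto intro!: complex_vs.span_base lie_gen_base)
    ultimately show ?thesis using closed by blast
  qed
  ultimately have "\<pi> y \<in> ?K" for y
    using hom lie_hom_on_subset free_lie_gen unfolding lie_hom_iff
    by (intro lie_hom_on_image_mem[of "range free_gen" \<pi> ?K y]) blast+
  then have \<pi>S: "\<pi> y \<in> lspan ?S" for y by blast
  have "z \<in> lspan ?S" for z
  proof -
    obtain y d where "z = \<pi> y + d" "d \<in> D" using sum_D by blast
    then show ?thesis using D_cartan \<pi>S by (auto intro!: complex_vs.span_add intro: complex_vs.span_base)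
  qed
  moreover have "?S \<subseteq> lspan (low \<union> ?P)"
  proof -
    let ?L = "{x. \<exists>m n. m \<le> - 1 \<and> x \<in> graded_piece m n}"
    have L: "lie a b \<in> lspan ?L" if ab: "a \<in> ?L" "b \<in> ?L" for a b
    proof -
      obtain m n m' n' where mn: "m \<le> - 1" "a \<in> graded_piece m n" "m' \<le> - 1" "b \<in> graded_piece m' n'"
        using ab by blast
      have "lie a b \<in> ?L"
        using graded_piece_lie[OF mn(2,4)] mn(1,3) by (intro CollectI exI[of _ "m + m'"] exI[of _ "n + n'"]) simp
      then show ?thesis by (rule complex_vs.span_base)
    qed
    have "subalgebra (lspan ?L)"
      by (rule subalgebra_span) (rule L)
    moreover have "range f \<subseteq> lspan ?L"
      using f_graded by (auto intro!: complex_vs.span_base)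
    ultimately have "?N \<subseteq> lspan ?L" by (rule lie_gen_least)
    moreover have "?L \<subseteq> low \<union> ?P"
    proof
      fix x assume "x \<in> ?L"
      then obtain m n where "m \<le> - 1" "x \<in> graded_piece m n" by blast
      then have "m \<le> 0" "x \<in> graded_piece m n" by simp_all
      then show "x \<in> low \<union> ?P" unfolding low_def by blast
    qed
    then have "lspan ?L \<subseteq> lspan (low \<union> ?P)" by (rule complex_vs.span_mono)
    moreover have "cartan \<union> ?P \<subseteq> low \<union> ?P" using cartan_graded by (auto simp: low_def)
    then have "cartan \<union> ?P \<subseteq> lspan (low \<union> ?P)" using complex_vs.span_superset by blast
    ultimately show ?thesis by blast
  qed
  then have "lspan ?S \<subseteq> lspan (low \<union> ?P)" by (intro complex_vs.span_minimal complex_vs.subspace_span)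
  ultimately show ?thesis by blast
qed

text \<open>An element of the Cartan subalgebra that acts on \<open>graded_piece m n\<close> by the scalar
  \<open>m + i n\<close>, which determines the degree.\<close>

definition separator :: 'g where
  "separator = (2 / cc) *\<^sub>C (simple_root r + (1 + \<i>) *\<^sub>C \<rho>)"

lemma separator_cartan: "separator \<in> cartan"
  unfolding separator_def by (intro cartan_scale cartan_add simple_root_cartan weyl_vector_cartan)

text \<open>The root of degree (m, n) pairs to (m - n) \<open>cc\<close> / 2 with the real simple
  root and to n \<open>cc\<close> / 2 with \<open>\<rho>\<close>. The factor 1 + i cancels the -n
  and puts n into the imaginary part.\<close>

lemma lie_separator:
  assumes "x \<in> graded_piece m n"
  shows "lie separator x = Complex (of_int m) (of_int n) *\<^sub>C x"
proof -
  have "form (degree_root m n) separator = of_int m + \<i> * of_int n"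
    unfolding separator_def
    using cc_nz
    by (simp only: form_scale_right form_add_right cartan_scale cartan_add simple_root_cartan weyl_vector_cartan
        degree_root_cartan form_degree_root_rho form_degree_root_simple) (simp add: field_simps)
  also have "\<dots> = Complex (of_int m) (of_int n)" by (simp add: complex_eq_iff)
  finally show ?thesis using graded_pieceD[OF assms separator_cartan] by simp
qed

lemma graded_piece_disjoint:
  assumes "x \<in> graded_piece m n" "x \<in> graded_piece m' n'" "x \<noteq> 0"
  shows "m = m' \<and> n = n'"
proof -
  have "Complex (of_int m) (of_int n) *\<^sub>C x = Complex (of_int m') (of_int n') *\<^sub>C x"
    using lie_separator assms(1,2) by metis
  then show ?thesis using assms(3) by simp
qed

text \<open>The elements of \<open>low\<close> and \<open>Y\<close> are eigenvectors for bracketing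
  with \<open>separator\<close> and span the Lie algebra, so \<open>x\<close> is a combination of
  those with its own eigenvalue. Those from \<open>low\<close> have m \<le> 0 and drop out.\<close>

lemma graded_piece_span:
  assumes hom: "\<And>y. y \<in> Y \<Longrightarrow> \<exists>m n. y \<in> graded_piece m n" and pos: "lie_gen (range e) \<subseteq> lspan Y"
    and x: "x \<in> graded_piece m n" and m: "1 \<le> m"
  shows "x \<in> lspan (Y \<inter> graded_piece m n)"
proof -
  \<comment> \<open>The vector 0 has every degree and is removed, so that the degree of each
    remaining vector is unique.\<close>
  let ?Y = "(low \<union> Y) - {0}"
  define d where "d y = (SOME mn. y \<in> graded_piece (fst mn) (snd mn))" for y
  have d: "y \<in> graded_piece (fst (d y)) (snd (d y))" if y: "y \<in> ?Y" for y
  proof -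
    obtain m n where "y \<in> graded_piece m n" using y hom unfolding low_def by blast
    then show ?thesis unfolding d_def
      by (rule_tac someI[of "\<lambda>mn. y \<in> graded_piece (fst mn) (snd mn)" "(m, n)"]) simp
  qed
  let ?\<mu> = "\<lambda>y. Complex (of_int (fst (d y))) (of_int (snd (d y)))"
  have "lspan Y \<subseteq> lspan (low \<union> Y)" "low \<subseteq> lspan (low \<union> Y)"
    using complex_vs.span_mono[of Y "low \<union> Y"] complex_vs.span_superset[of "low \<union> Y"] by auto
  then have "lspan (low \<union> lie_gen (range e)) \<subseteq> lspan (low \<union> Y)"
    using pos by (intro complex_vs.span_minimal complex_vs.subspace_span) auto
  then have "x \<in> lspan (low \<union> Y)" unfolding span_low_pos by (rule subsetD) simp
  then have "x \<in> lspan ?Y" by (simp only: complex_vs.span_delete_0)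
  then have "x \<in> lspan {y \<in> ?Y. ?\<mu> y = Complex (of_int m) (of_int n)}"
    by (rule eigenvector_in_span[OF lin_lie[of separator], where \<mu> = ?\<mu>, rotated])
      (simp_all only: d lie_separator x)
  moreover have "{y \<in> ?Y. ?\<mu> y = Complex (of_int m) (of_int n)} \<subseteq> Y \<inter> graded_piece m n"
  proof
    fix y assume y: "y \<in> {y \<in> ?Y. ?\<mu> y = Complex (of_int m) (of_int n)}"
    then have "y \<in> graded_piece m n" using d[of y] by auto
    moreover have "y \<notin> low"
      using y m graded_piece_disjoint[OF \<open>y \<in> graded_piece m n\<close>, of _ _] by (fastforce simp: low_def)
    ultimately show "y \<in> Y \<inter> graded_piece m n" using y by blast
  qed
  ultimately show ?thesis using complex_vs.span_mono by blast
qed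

lemma e_graded: "\<exists>n. e i \<in> graded_piece 1 n"
  using e_r_graded level(3) by (cases "i = r") auto

text \<open>Brackets of elements with m \<ge> 1 have m \<ge> 2, so the e's together with all pieces
  with m \<ge> 2 span a subalgebra, in which only the e's contribute to m = 1.\<close>

lemma graded_piece_1: "graded_piece 1 n = lspan (range e \<inter> graded_piece 1 n)"
proof
  let ?T = "{x. \<exists>m n. 2 \<le> m \<and> x \<in> graded_piece m n}"
  show "graded_piece 1 n \<subseteq> lspan (range e \<inter> graded_piece 1 n)"
  proof
    fix x assume x: "x \<in> graded_piece 1 n"
    have pos: "lie_gen (range e) \<subseteq> lspan (range e \<union> ?T)"
    proof (rule lie_gen_least)
      have ge1: "\<exists>m n. 1 \<le> m \<and> a \<in> graded_piece m n" if a: "a \<in> range e \<union> ?T" for a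
      proof (cases "a \<in> range e")
        case True
        then show ?thesis using e_graded by blast
      next
        case False
        then obtain m n where "2 \<le> m" "a \<in> graded_piece m n" using a by blast
        then show ?thesis by (intro exI[of _ m] exI[of _ n]) simp
      qed
      have "lie a b \<in> lspan (range e \<union> ?T)" if ab: "a \<in> range e \<union> ?T" "b \<in> range e \<union> ?T" for a b
      proof -
        obtain m n m' n' where mn: "1 \<le> m" "a \<in> graded_piece m n" "1 \<le> m'" "b \<in> graded_piece m' n'"
          using ge1[OF ab(1)] ge1[OF ab(2)] by blast
        have "lie a b \<in> ?T"
          using graded_piece_lie[OF mn(2,4)] mn(1,3) by (intro CollectI exI[of _ "m + m'"] exI[of _ "n + n'"]) simp
        then show ?thesis by (intro complex_vs.span_base) blast
      qed
      then show "subalgebra (lspan (range e \<union> ?T))" by (rule subalgebra_span)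
    qed (auto intro: complex_vs.span_base)
    have "x \<in> lspan ((range e \<union> ?T) \<inter> graded_piece 1 n)"
      by (rule graded_piece_span[OF _ pos x]) (use e_graded in \<open>blast, simp\<close>)
    moreover have "(range e \<union> ?T) \<inter> graded_piece 1 n \<subseteq> insert 0 (range e \<inter> graded_piece 1 n)"
      using graded_piece_disjoint by fastforce
    ultimately have "x \<in> lspan (insert 0 (range e \<inter> graded_piece 1 n))"
      using complex_vs.span_mono by blast
    then show "x \<in> lspan (range e \<inter> graded_piece 1 n)" by (simp add: complex_vs.span_insert_0)
  qed
qed (intro complex_vs.span_minimal subspace_graded_piece, blast)

lemma graded_piece_e_r: "graded_piece 1 (- 1) = lspan {e r}"
proof
  \<comment> \<open>An \<open>e i\<close> with \<open>i \<noteq> r\<close> lies in a piece with n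
    \<ge> 1, so it can lie in this one only if it is 0.\<close>
  have "range e \<inter> graded_piece 1 (- 1) \<subseteq> {e r, 0}"
  proof
    fix y assume y: "y \<in> range e \<inter> graded_piece 1 (- 1)"
    then obtain i where i: "y = e i" by blast
    show "y \<in> {e r, 0}"
      using y level(1,3)[of i] graded_piece_disjoint[of y 1 "- 1" 1 "int (level i)"] i by (cases "i = r") auto
  qed
  then have "graded_piece 1 (- 1) \<subseteq> lspan {0, e r}"
    by (subst graded_piece_1) (intro complex_vs.span_mono, blast)
  then show "graded_piece 1 (- 1) \<subseteq> lspan {e r}" by (simp add: complex_vs.span_insert_0)
qed (intro complex_vs.span_minimal subspace_graded_piece, simp add: e_r_graded)

lemma graded_piece_imag: "1 \<le> n \<Longrightarrow> graded_piece 1 (int n) = lspan (e ` {i. i \<noteq> r \<and> level i = n})"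
proof
  assume n: "1 \<le> n"
  have "range e \<inter> graded_piece 1 (int n) \<subseteq> insert 0 (e ` {i. i \<noteq> r \<and> level i = n})"
  proof
    fix y assume y: "y \<in> range e \<inter> graded_piece 1 (int n)"
    then obtain i where i: "y = e i" by blast
    show "y \<in> insert 0 (e ` {i. i \<noteq> r \<and> level i = n})"
    proof (cases "i = r")
      case True
      then show ?thesis
        using y i n e_r_graded graded_piece_disjoint[of y 1 "int n" 1 "- 1"] by auto
    next
      case False
      then show ?thesis
        using y i level(3)[of i] graded_piece_disjoint[of y 1 "int n" 1 "int (level i)"] by auto
    qed
  qed
  then have "graded_piece 1 (int n) \<subseteq> lspan (insert 0 (e ` {i. i \<noteq> r \<and> level i = n}))"
    by (subst graded_piece_1) (intro complex_vs.span_mono)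
  then show "graded_piece 1 (int n) \<subseteq> lspan (e ` {i. i \<noteq> r \<and> level i = n})"
    by (simp add: complex_vs.span_insert_0)
  show "lspan (e ` {i. i \<noteq> r \<and> level i = n}) \<subseteq> graded_piece 1 (int n)"
    using level(3) by (intro complex_vs.span_minimal subspace_graded_piece) auto
qed

lemma finite_level: "finite {i. i \<noteq> r \<and> level i = n}"
proof (rule finite_subset)
  \<comment> \<open>A simple root of level n has (r, r) = - n \<open>cc\<close>; the summand 1 makes
    the bound positive and the inequality strict.\<close>
  let ?B = "q r * A r r * real n + 1"
  show "finite {i. - ?B < q i * A i i}"
    using cc_pos by (intro finitely_many_simple_roots) (simp add: add_nonneg_pos)
  show "{i. i \<noteq> r \<and> level i = n} \<subseteq> {i. - ?B < q i * A i i}"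
    by (auto simp: form_simple_imag)
qed

lemma serre_e: "i \<noteq> r \<Longrightarrow> (lie (e r) ^^ level i) (e i) = 0"
proof -
  assume i: "i \<noteq> r"
  interpret R: one_real_root A r "\<lambda>i. level i - 1" "\<lambda>i. q r / q i" by (rule one_real_root)
  have "nat \<lfloor>1 - A r i\<rfloor> = level i" using R.A_ri[OF i] level(1)[OF i] by (simp add: of_nat_diff)
  moreover have "(lie (gen_e r) ^^ nat \<lfloor>1 - A r i\<rfloor>) (gen_e i) \<in> bkm_relations A"
  proof -
    have "(lie (gen_e r) ^^ nat \<lfloor>1 - A r i\<rfloor>) (gen_e i)
      \<in> {(lie (gen_e i) ^^ nat \<lfloor>1 - A i j\<rfloor>) (gen_e j) | i j. 0 < A i i \<and> i \<noteq> j}"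
      using i A_rr_eq by (intro CollectI exI[of _ r] exI[of _ i]) simp
    then show ?thesis unfolding bkm_relations_def by (intro UnI1 UnI2)
  qed
  ultimately have "\<pi> ((lie (gen_e r) ^^ level i) (gen_e i)) = 0" using \<pi>_relation by simp
  then show ?thesis by (simp add: lie_hom_ad_pow[OF hom] e_def)
qed

end

section \<open>The trace identity\<close>

lemma trace_on_triangular_list:
  assumes f: "lin f" and us: "distinct us" "complex_vs.independent (set us)" "lspan (set us) = V"
    and tri: "\<And>j. j < length us \<Longrightarrow> f (us ! j) - la j *\<^sub>C us ! j \<in> lspan ((!) us ` {..<j})"
  shows "trace_on V f = (\<Sum>j<length us. la j)"
proof -
  define t where "t = inv_into {..<length us} ((!) us)"
  have bij: "bij_betw ((!) us) {..<length us} (set us)"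
    using us(1) by (intro bij_betw_nth) auto
  have t: "t (us ! j) = j" if "j < length us" for j
    unfolding t_def using bij that by (intro inv_into_f_f) (auto simp: bij_betw_def)
  have "trace_on V f = (\<Sum>c\<in>set us. la (t c))"
  proof (rule trace_on_triangular[OF f _ us(2,3), where t = t])
    fix c assume "c \<in> set us"
    then obtain j where j: "c = us ! j" "j < length us" by (auto simp: in_set_conv_nth)
    have "(!) us ` {..<j} \<subseteq> {c' \<in> set us. t c' < t c}" using j t by auto
    then have "lspan ((!) us ` {..<j}) \<subseteq> lspan {c' \<in> set us. t c' < t c}" by (rule complex_vs.span_mono)
    then show "f c - la (t c) *\<^sub>C c \<in> lspan {c' \<in> set us. t c' < t c}"
      using tri[OF j(2)] j t by auto
  qed simp
  also have "\<dots> = (\<Sum>j<length us. la (t (us ! j)))"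
    by (rule sum.reindex_bij_betw[OF bij, symmetric])
  also have "\<dots> = (\<Sum>j<length us. la j)" by (simp add: t)
  finally show ?thesis .
qed

text \<open>Free families are indexed by natural numbers, so triples are coded.\<close>

definition index3 :: "nat \<Rightarrow> nat \<Rightarrow> nat \<Rightarrow> nat" where
  "index3 n j k = prod_encode (prod_encode (n, j), k)"

definition case3 :: "(nat \<Rightarrow> nat \<Rightarrow> nat \<Rightarrow> 'b) \<Rightarrow> nat \<Rightarrow> 'b" where
  "case3 g l = (case prod_decode l of (p, k) \<Rightarrow> case prod_decode p of (n, j) \<Rightarrow> g n j k)"

lemma case3_index3 [simp]: "case3 g (index3 n j k) = g n j k"
  by (simp add: case3_def index3_def)

lemma index3_inject [simp]: "index3 n j k = index3 n' j' k' \<longleftrightarrow> n = n' \<and> j = j' \<and> k = k'"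
  by (simp add: index3_def)

text \<open>The list \<open>us n\<close> is a basis of the piece of degree (1, n) in which
  \<open>T\<close> is triangular with diagonal entries \<open>la n\<close>. Such data exist by
  \<open>exists_triangular\<close>.\<close>

locale fricke_triangular = fricke_lie_algebra A \<pi> D q form \<rho>
  for A :: "'i :: countable \<Rightarrow> 'i \<Rightarrow> real"
    and \<pi> :: "'i bkm_gen free_lie \<Rightarrow> 'g :: complex_lie_algebra"
    and D :: "'g set" and q :: "'i \<Rightarrow> real" and form :: "'g \<Rightarrow> 'g \<Rightarrow> complex" and \<rho> :: 'g +
  fixes T :: "'g \<Rightarrow> 'g" and us :: "nat \<Rightarrow> 'g list" and la :: "nat \<Rightarrow> nat \<Rightarrow> complex"
  assumes T: "homogeneous_automorphism T"
    and us_distinct: "1 \<le> n \<Longrightarrow> distinct (us n)"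
    and us_indep: "1 \<le> n \<Longrightarrow> complex_vs.independent (set (us n))"
    and us_span: "1 \<le> n \<Longrightarrow> lspan (set (us n)) = graded_piece 1 (int n)"
    and us_tri: "1 \<le> n \<Longrightarrow> j < length (us n) \<Longrightarrow> T (us n ! j) - la n j *\<^sub>C us n ! j \<in> lspan ((!) (us n) ` {..<j})"
begin

lemma lin_T: "lin T" and T_lie: "T (lie x y) = lie (T x) (T y)"
  using T by (auto simp: homogeneous_automorphism_def lie_hom_def)

lemma T_graded: "x \<in> graded_piece m n \<Longrightarrow> T x \<in> graded_piece m n"
  using T by (auto simp: homogeneous_automorphism_def)

definition lr :: complex where "lr = trace_on (graded_piece 1 (- 1)) T"

text \<open>The piece of degree (1, -1) is spanned by \<open>e r\<close>, so the trace is the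
  eigenvalue. The case \<open>e r = 0\<close>, in which the basis would be empty, is treated
  apart.\<close>

lemma T_e_r: "T (e r) = lr *\<^sub>C e r"
proof (cases "e r = 0")
  case True
  then show ?thesis by (simp add: lin_0[OF lin_T])
next
  case False
  have "T (e r) \<in> lspan {e r}"
    using T_graded[OF e_r_graded] by (simp add: graded_piece_e_r)
  then obtain c where c: "T (e r) = c *\<^sub>C e r" by (auto simp: complex_vs.span_singleton)
  have "trace_on (graded_piece 1 (- 1)) T = (\<Sum>x\<in>{e r}. c)"
    by (rule trace_on_triangular[OF lin_T _ _ graded_piece_e_r[symmetric], where t = "\<lambda>_. 0"])
      (simp_all add: False c complex_vs.independent_insert complex_vs.independent_empty)
  then show ?thesis using c by (simp add: lr_def)
qed

text \<open>The index \<open>index3 n j k\<close> belongs to \<open>ad(e\<^sub>r)\<^sup>k\<close> of the \<open>j\<close>-th vector in the triangular basis of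
  degree \<open>(1, n)\<close>.\<close>

definition J :: "nat set" where
  "J = {index3 n j k | n j k. 1 \<le> n \<and> j < length (us n) \<and> k < n}"

definition x :: "nat \<Rightarrow> 'g" where
  "x = case3 (\<lambda>n j k. (lie (e r) ^^ k) (us n ! j))"

text \<open>Weights are multidegrees in the generators. The bidegree and the eigenvalue of \<open>T\<close> are functions
  of the multidegree, and so is the height, with respect to which \<open>T\<close> is triangular.\<close>

abbreviation wt :: "nat \<Rightarrow> nat multiset" where "wt \<equiv> \<lambda>l. {#l#}"

definition md :: "nat multiset \<Rightarrow> nat" where "md w = (\<Sum>l\<in>#w. case3 (\<lambda>n j k. Suc k) l)"
definition nd :: "nat multiset \<Rightarrow> nat" where "nd w = (\<Sum>l\<in>#w. case3 (\<lambda>n j k. n - k) l)"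
definition ht :: "nat multiset \<Rightarrow> nat" where "ht w = (\<Sum>l\<in>#w. case3 (\<lambda>n j k. j) l)"
definition lam :: "nat multiset \<Rightarrow> complex" where "lam w = (\<Prod>l\<in>#w. case3 (\<lambda>n j k. lr ^ k * la n j) l)"

sublocale W: weights md nd lam
  by standard (simp_all add: md_def nd_def lam_def)

lemma ht_add: "ht (v + w) = ht v + ht w"
  by (simp add: ht_def)

lemma wt_index3: "md (wt (index3 n j k)) = Suc k" "nd (wt (index3 n j k)) = n - k"
  "ht (wt (index3 n j k)) = j" "lam (wt (index3 n j k)) = lr ^ k * la n j"
  by (simp_all add: md_def nd_def ht_def lam_def)

text \<open>The total degree of \<open>index3 n j k\<close> is (k + 1) + (n - k) = n + 1, whatever k
  is.\<close>

lemma locally_finite_J: "W.locally_finite wt J"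
  unfolding W.locally_finite_def
proof (intro conjI allI ballI)
  fix N
  have "{l \<in> J. W.deg (wt l) \<le> N} \<subseteq> (\<lambda>(n, j, k). index3 n j k) ` (SIGMA n:{..N}. {..<length (us n)} \<times> {..<n})"
  proof
    fix l assume "l \<in> {l \<in> J. W.deg (wt l) \<le> N}"
    then obtain n j k where l: "l = index3 n j k" "j < length (us n)" "k < n" "Suc k + (n - k) \<le> N"
      by (auto simp: J_def W.deg_def wt_index3)
    then have "(n, j, k) \<in> (SIGMA n:{..N}. {..<length (us n)} \<times> {..<n})" by auto
    then show "l \<in> (\<lambda>(n, j, k). index3 n j k) ` (SIGMA n:{..N}. {..<length (us n)} \<times> {..<n})"
      using l(1) by (intro rev_image_eqI) auto
  qed
  then show "finite {l \<in> J. W.deg (wt l) \<le> N}" by (rule finite_subset) auto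
next
  fix l assume "l \<in> J"
  then show "1 \<le> md (wt l)" by (auto simp: J_def wt_index3)
qed

section \<open>Monomials in the strings span the root spaces\<close>

lemma us_mem: "1 \<le> n \<Longrightarrow> j < length (us n) \<Longrightarrow> us n ! j \<in> graded_piece 1 (int n)"
  using us_span complex_vs.span_base[of "us n ! j" "set (us n)"] by simp

lemma lin_ad_pow: "lin (lie y ^^ k)"
  by (induction k) (auto simp: lin_iff bracket_add_right lie_scaleC_right)

lemma ad_pow_graded:
  assumes "y \<in> graded_piece 1 (int n)" "k \<le> n"
  shows "(lie (e r) ^^ k) y \<in> graded_piece (int (Suc k)) (int (n - k))"
  using assms(2)
proof (induction k)
  case (Suc k)
  then have "lie (e r) ((lie (e r) ^^ k) y) \<in> graded_piece (1 + int (Suc k)) (- 1 + int (n - k))"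
    by (intro graded_piece_lie e_r_graded) auto
  then show ?case using Suc(2) by (simp add: of_nat_diff algebra_simps)
qed (use assms(1) in simp)

lemma monomial_graded:
  assumes "lie_monomial x wt J w y"
  shows "y \<in> graded_piece (int (md w)) (int (nd w)) \<and> 1 \<le> md w \<and> 1 \<le> nd w"
  using assms
proof induction
  case (lie_monomial_gen l)
  then show ?case using us_mem ad_pow_graded by (auto simp: J_def x_def wt_index3)
next
  case (lie_monomial_lie w a w' b)
  then show ?case using graded_piece_lie[of a "int (md w)" "int (nd w)" b "int (md w')" "int (nd w')"]
    by (auto simp: W.md_add W.nd_add)
qed

lemma e_mem: "i \<noteq> r \<Longrightarrow> e i \<in> lspan (set (us (level i)))"
  using us_span level by simp

definition monomials :: "'g set" where
  "monomials = {y. \<exists>w. lie_monomial x wt J w y}"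

text \<open>Brackets with \<open>e r\<close> move along a string; at its last member, k = n - 1, the
  Serre relation gives 0.\<close>

lemma ad_e_r_monomials:
  assumes "y \<in> lspan monomials"
  shows "lie (e r) y \<in> lspan monomials"
proof (rule lin_mem_span[OF lin_lie _ assms])
  fix y assume "y \<in> monomials"
  then obtain w where "lie_monomial x wt J w y" by (auto simp: monomials_def)
  then show "lie (e r) y \<in> lspan monomials"
  proof induction
    case (lie_monomial_gen l)
    then obtain n j k where l: "l = index3 n j k" "1 \<le> n" "j < length (us n)" "k < n"
      by (auto simp: J_def)
    show ?case
    proof (cases "Suc k < n")
      case True
      then have "index3 n j (Suc k) \<in> J" using l by (auto simp: J_def)
      from lie_monomial.intros(1)[OF this, of x wt] show ?thesis
        using l(1) by (intro complex_vs.span_base) (auto simp: monomials_def x_def)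
    next
      case False
      then have n: "n = Suc k" using l by simp
      \<comment> \<open>The span of the empty set is 0: the Serre relation, known for each
        \<open>e i\<close> of level n, extends to linear combinations.\<close>
      have "(lie (e r) ^^ n) (us n ! j) \<in> lspan {}"
      proof (rule lin_mem_span[OF lin_ad_pow])
        show "us n ! j \<in> lspan (e ` {i. i \<noteq> r \<and> level i = n})"
          using us_mem l graded_piece_imag by blast
        show "(lie (e r) ^^ n) y \<in> lspan {}" if "y \<in> e ` {i. i \<noteq> r \<and> level i = n}" for y
          using that serre_e by auto
      qed
      then show ?thesis using l(1) by (simp add: x_def n complex_vs.span_zero)
    qed
  next
    case (lie_monomial_lie w a w' b)
    have ab: "a \<in> monomials" "b \<in> monomials" using lie_monomial_lie by (auto simp: monomials_def)
    have br: "lie u v \<in> lspan monomials" if "u \<in> lspan monomials" "v \<in> lspan monomials" for u v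
      by (rule lie_mem_span[OF _ that])
        (auto simp: monomials_def intro!: complex_vs.span_base intro: lie_monomial.intros(2))
    show ?case unfolding lie_derivation[of "e r" a b]
      by (intro complex_vs.span_add br lie_monomial_lie.IH complex_vs.span_base ab)
  qed
qed

lemma pos_span: "lie_gen (range e) \<subseteq> lspan (insert (e r) monomials)"
proof (rule lie_gen_least)
  have mono: "lspan monomials \<subseteq> lspan (insert (e r) monomials)" by (intro complex_vs.span_mono) auto
  show "subalgebra (lspan (insert (e r) monomials))"
  proof (rule subalgebra_span)
    fix a b assume ab: "a \<in> insert (e r) monomials" "b \<in> insert (e r) monomials"
    have ad: "lie (e r) y \<in> lspan (insert (e r) monomials)" if "y \<in> insert (e r) monomials" for y
      using that ad_e_r_monomials[OF complex_vs.span_base, of y] mono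
      by (auto simp: bracket_self complex_vs.span_zero)
    consider "a = e r" | "b = e r" | "a \<in> monomials" "b \<in> monomials" using ab by blast
    then show "lie a b \<in> lspan (insert (e r) monomials)"
    proof cases
      case 1
      then show ?thesis using ad ab by blast
    next
      case 2
      then show ?thesis using complex_vs.span_neg[OF ad[OF ab(1)]] by (subst lie_anticommute) simp
    next
      case 3
      then show ?thesis
        by (intro complex_vs.span_base) (auto simp: monomials_def intro: lie_monomial.intros(2))
    qed
  qed
  show "range e \<subseteq> lspan (insert (e r) monomials)"
  proof
    fix y assume "y \<in> range e"
    then obtain i where i: "y = e i" by blast
    show "y \<in> lspan (insert (e r) monomials)"
    proof (cases "i = r")
      case True
      then show ?thesis using i by (auto intro: complex_vs.span_base)
    next
      case False
      have "set (us (level i)) \<subseteq> monomials"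
      proof
        fix u assume "u \<in> set (us (level i))"
        then obtain j where j: "u = us (level i) ! j" "j < length (us (level i))"
          by (auto simp: in_set_conv_nth)
        then have "index3 (level i) j 0 \<in> J" using level(1)[OF False] by (auto simp: J_def)
        from lie_monomial.intros(1)[OF this, of x wt] show "u \<in> monomials"
          using j by (auto simp: monomials_def x_def)
      qed
      then have "lspan (set (us (level i))) \<subseteq> lspan (insert (e r) monomials)"
        by (intro complex_vs.span_mono) auto
      then show ?thesis using e_mem[OF False] i by blast
    qed
  qed
qed

text \<open>By \<open>pos_span\<close> only \<open>e r\<close> could contribute besides the
  monomials, and its degree has n = -1.\<close>

lemma graded_piece_monomials:
  assumes m: "1 \<le> m" and n: "1 \<le> n"
  shows "graded_piece (int m) (int n) = lspan {y. \<exists>w. lie_monomial x wt J w y \<and> md w = m \<and> nd w = n}"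
    (is "?G = lspan ?M")
proof
  show "lspan ?M \<subseteq> ?G"
    using monomial_graded by (intro complex_vs.span_minimal subspace_graded_piece) auto
  show "?G \<subseteq> lspan ?M"
  proof
    fix y assume y: "y \<in> ?G"
    have "y \<in> lspan (insert (e r) monomials \<inter> ?G)"
    proof (rule graded_piece_span[OF _ pos_span y])
      show "\<exists>m n. z \<in> graded_piece m n" if "z \<in> insert (e r) monomials" for z
        using that e_r_graded monomial_graded by (auto simp: monomials_def)
    qed (use m in simp)
    moreover have "insert (e r) monomials \<inter> ?G \<subseteq> insert 0 ?M"
    proof
      fix z assume z: "z \<in> insert (e r) monomials \<inter> ?G"
      show "z \<in> insert 0 ?M"
      proof (cases "z = 0")
        case False
        have "z \<noteq> e r"
          using graded_piece_disjoint[OF _ e_r_graded, of "int m" "int n"] z n False by auto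
        then obtain w where w: "lie_monomial x wt J w z" using z by (auto simp: monomials_def)
        then have "int (md w) = int m \<and> int (nd w) = int n"
          using z monomial_graded[OF w] False by (intro graded_piece_disjoint) auto
        then show ?thesis using w by auto
      qed simp
    qed
    ultimately have "y \<in> lspan (insert 0 ?M)" using complex_vs.span_mono by blast
    then show "y \<in> lspan ?M" by (simp add: complex_vs.span_insert_0)
  qed
qed

definition lower :: "nat \<Rightarrow> nat \<Rightarrow> nat \<Rightarrow> 'g set" where
  "lower m n t = {y. \<exists>w. lie_monomial x wt J w y \<and> md w = m \<and> nd w = n \<and> ht w < t}"

text \<open>Heights of factors add up, so replacing a factor by a lower one of the same bidegree
  lowers the bracket and keeps its bidegree. On a string, \<open>T\<close> commutes with bracketing
  by \<open>e r\<close> up to the scalar \<open>lr\<close>.\<close>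

lemma T_monomial:
  assumes "lie_monomial x wt J w y"
  shows "T y - lam w *\<^sub>C y \<in> lspan (lower (md w) (nd w) (ht w))"
  using assms
proof induction
  case (lie_monomial_gen l)
  then obtain n j k where l: "l = index3 n j k" "1 \<le> n" "j < length (us n)" "k < n"
    by (auto simp: J_def)
  let ?ad = "lie (e r) ^^ k"
  have Tad: "T (?ad y) = lr ^ k *\<^sub>C ?ad (T y)" for y
  proof (induction k)
    case (Suc k)
    then show ?case
      by (simp add: T_lie T_e_r lie_scaleC_left lie_scaleC_right scaleC_scaleC)
  qed (simp add: scaleC_one)
  have "lr ^ k *\<^sub>C ?ad (T (us n ! j) - la n j *\<^sub>C us n ! j) \<in> lspan (lower (Suc k) (n - k) j)"
  proof (intro complex_vs.span_scale lin_mem_span[OF lin_ad_pow _ us_tri[OF l(2,3)]])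
    fix y assume "y \<in> (!) (us n) ` {..<j}"
    then obtain j' where j': "y = us n ! j'" "j' < j" by blast
    then have "index3 n j' k \<in> J" using l by (auto simp: J_def)
    from lie_monomial.intros(1)[OF this, of x wt] have "?ad y \<in> lower (Suc k) (n - k) j"
      using j' by (auto simp: lower_def x_def wt_index3 intro!: exI[of _ "wt (index3 n j' k)"])
    then show "?ad y \<in> lspan (lower (Suc k) (n - k) j)" by (rule complex_vs.span_base)
  qed
  then show ?case
    by (simp add: l(1) wt_index3 x_def Tad lin_diff[OF lin_ad_pow] lin_scale[OF lin_ad_pow]
        complex_vs.scale_right_diff_distrib scaleC_scaleC)
next
  case (lie_monomial_lie w a w' b)
  let ?a = "T a - lam w *\<^sub>C a" and ?b = "T b - lam w' *\<^sub>C b"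
  let ?L = "lower (md (w + w')) (nd (w + w')) (ht (w + w'))"
  \<comment> \<open>The value needed is v = \<open>T b\<close>, which has the diagonal part
    \<open>lam w'\<close> times \<open>b\<close> besides lower terms; hence \<open>b\<close> is
    adjoined.\<close>
  have 1: "lie ?a v \<in> lspan ?L" if "v \<in> lspan (insert b (lower (md w') (nd w') (ht w')))" for v
  proof (rule lie_mem_span[OF _ lie_monomial_lie.IH(1) that])
    fix y z assume "y \<in> lower (md w) (nd w) (ht w)" "z \<in> insert b (lower (md w') (nd w') (ht w'))"
    then obtain v v' where v: "lie_monomial x wt J v y" "md v = md w" "nd v = nd w" "ht v < ht w"
      and v': "lie_monomial x wt J v' z" "md v' = md w'" "nd v' = nd w'" "ht v' \<le> ht w'"
      using lie_monomial_lie.hyps(2) by (auto simp: lower_def intro: less_imp_le)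
    have "lie_monomial x wt J (v + v') (lie y z)" by (rule lie_monomial.intros(2)[OF v(1) v'(1)])
    then have "lie y z \<in> ?L"
      using v v' unfolding lower_def by (auto simp: W.md_add W.nd_add ht_add intro!: exI[of _ "v + v'"])
    then show "lie y z \<in> lspan ?L" by (rule complex_vs.span_base)
  qed
  have 2: "lie a ?b \<in> lspan ?L"
  proof (rule lin_mem_span[OF lin_lie _ lie_monomial_lie.IH(2)])
    fix z assume "z \<in> lower (md w') (nd w') (ht w')"
    then obtain v' where v': "lie_monomial x wt J v' z" "md v' = md w'" "nd v' = nd w'" "ht v' < ht w'"
      by (auto simp: lower_def)
    have "lie_monomial x wt J (w + v') (lie a z)"
      by (rule lie_monomial.intros(2)[OF lie_monomial_lie.hyps(1) v'(1)])
    then have "lie a z \<in> ?L"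
      using v' unfolding lower_def by (auto simp: W.md_add W.nd_add ht_add intro!: exI[of _ "w + v'"])
    then show "lie a z \<in> lspan ?L" by (rule complex_vs.span_base)
  qed
  have "lspan (lower (md w') (nd w') (ht w')) \<subseteq> lspan (insert b (lower (md w') (nd w') (ht w')))"
    by (intro complex_vs.span_mono) auto
  then have Tb: "?b + lam w' *\<^sub>C b \<in> lspan (insert b (lower (md w') (nd w') (ht w')))"
    using lie_monomial_lie.IH(2)
    by (intro complex_vs.span_add complex_vs.span_scale) (auto intro: complex_vs.span_base)
  \<comment> \<open>[Ta, Tb] - \<lambda> \<lambda>' [a, b] = [Ta - \<lambda> a, Tb] + \<lambda>
    [a, Tb - \<lambda>' b].\<close>
  have "lie ?a (?b + lam w' *\<^sub>C b) + lam w *\<^sub>C lie a ?b \<in> lspan ?L"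
    by (intro complex_vs.span_add complex_vs.span_scale 1 2 Tb)
  also have "lie ?a (?b + lam w' *\<^sub>C b) + lam w *\<^sub>C lie a ?b = T (lie a b) - lam (w + w') *\<^sub>C lie a b"
    by (simp add: T_lie lie_diff_left lie_diff_right lie_scaleC_left lie_scaleC_right W.lam_add
        complex_vs.scale_right_diff_distrib scaleC_scaleC)
  finally show ?case .
qed

text \<open>Freeness is known for the strings of the \<open>e i\<close>, while the family
  \<open>x\<close> starts from the triangular bases. \<open>B' n k\<close> extends the prescribed
  operators linearly from the basis \<open>us n\<close>; a homomorphism with these values on the
  strings of the \<open>e i\<close> has the right values on the strings of every linear
  combination.\<close>

lemma free_J: "free_family x J"
  unfolding free_family_def
proof
  fix B :: "nat \<Rightarrow> nat list free_mod linop"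
  interpret R: one_real_root_algebra A r "\<lambda>i. level i - 1" "\<lambda>i. q r / q i" \<pi> D
    by (rule one_real_root_algebra)
  let ?rep = "\<lambda>n. complex_vs.representation (set (us n))"
  define B' where "B' n k v = (\<Sum>j<length (us n). ?rep n v (us n ! j) *\<^sub>C B (index3 n j k))" for n k v
  have valid: "R.valid (i, k) \<longleftrightarrow> i \<noteq> r \<and> k < level i" for i k
    using level(1)[of i] unfolding R.valid_def by auto
  let ?K = "lie_gen (\<pi> ` R.strings)"
  obtain \<Phi> where \<Phi>: "lie_hom_on ?K \<Phi>"
    and \<Phi>s: "\<And>a. R.valid a \<Longrightarrow> \<Phi> (\<pi> (R.string a)) = B' (level (fst a)) (snd a) (e (fst a))"
    using R.strings_free[of "\<lambda>a. B' (level (fst a)) (snd a) (e (fst a))"] by blast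
  have \<Phi>v: "v \<in> lspan (set (us n)) \<and> (lie (e r) ^^ k) v \<in> ?K \<and> \<Phi> ((lie (e r) ^^ k) v) = B' n k v"
    if v: "v \<in> lspan (e ` {i. i \<noteq> r \<and> level i = n})" and k: "k < n" for n k v
    using v
  proof (induction rule: complex_vs.span_induct_alt)
    case base
    then show ?case
      using lie_hom_on_0[OF \<Phi> subalgebra_lie_gen]
      by (simp add: lin_0[OF lin_ad_pow] B'_def complex_vs.representation_zero lie_gen_zero complex_vs.span_zero)
  next
    case (step c u v)
    then obtain i where i: "u = e i" "i \<noteq> r" "level i = n" by blast
    have va: "R.valid (i, k)" by (rule valid[THEN iffD2]) (use i k in simp)
    have uK: "(lie (e r) ^^ k) u \<in> ?K"
      using va unfolding i(1) R.\<pi>_string[symmetric] R.strings_def by (intro lie_gen_base imageI CollectI)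
    have \<Phi>u: "\<Phi> ((lie (e r) ^^ k) u) = B' n k u"
      using \<Phi>s[OF va] i by (simp add: R.\<pi>_string)
    have n: "1 \<le> n" using k by simp
    have mem: "u \<in> lspan (set (us n))" using e_mem i by auto
    have v: "v \<in> lspan (set (us n))" using step.IH by blast
    with mem have "?rep n (c *\<^sub>C u + v) b = c * ?rep n u b + ?rep n v b" for b
      using us_indep[OF n]
      by (simp add: complex_vs.representation_add complex_vs.representation_scale complex_vs.span_scale)
    then have "B' n k (c *\<^sub>C u + v) = c *\<^sub>C B' n k u + B' n k v"
      by (simp add: B'_def scaleC_add_left sum.distrib complex_vs.scale_sum_right scaleC_scaleC)
    then show ?case
      using step.IH uK \<Phi>u complex_vs.span_add[OF complex_vs.span_scale[OF mem] v]
      by (simp add: lin_add[OF lin_ad_pow] lin_scale[OF lin_ad_pow] lie_gen_add lie_gen_scale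
          lie_hom_on_add[OF \<Phi>] lie_hom_on_scale[OF \<Phi>])
  qed
  have main: "x l \<in> ?K \<and> \<Phi> (x l) = B l" if "l \<in> J" for l
  proof -
    from that obtain n j k where l: "l = index3 n j k" "1 \<le> n" "j < length (us n)" "k < n"
      by (auto simp: J_def)
    have "us n ! j \<in> lspan (e ` {i. i \<noteq> r \<and> level i = n})"
      using us_mem[OF l(2,3)] graded_piece_imag[OF l(2)] by simp
    from \<Phi>v[OF this l(4)] have "x l \<in> ?K" "\<Phi> (x l) = B' n k (us n ! j)"
      by (simp_all add: l(1) x_def)
    moreover have "B' n k (us n ! j) = (\<Sum>j'<length (us n). if j' = j then B (index3 n j k) else 0)"
      unfolding B'_def
      using us_distinct[OF l(2)] us_indep[OF l(2)] l(3)
      by (intro sum.cong) (auto simp: complex_vs.representation_basis nth_eq_iff_index_eq scaleC_one)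
    ultimately show ?thesis using l by simp
  qed
  have "lie_gen (x ` J) \<subseteq> ?K" using main by (intro lie_gen_least subalgebra_lie_gen) auto
  then have "lie_hom_on (lie_gen (x ` J)) \<Phi>" by (rule lie_hom_on_subset[OF \<Phi>])
  then show "\<exists>\<Phi>. lie_hom_on (lie_gen (x ` J)) \<Phi> \<and> (\<forall>j\<in>J. \<Phi> (x j) = B j)" using main by blast
qed

text \<open>The basis elements of bidegree (m, n) form a basis of that piece, in which
  \<open>T\<close> is triangular with respect to the height by \<open>T_monomial\<close>. The
  diagonal of \<open>T ^^ k\<close> then consists of the k-th powers.\<close>

lemma homogeneous_trace:
  assumes basis: "distinct (map fst bs)" "complex_vs.independent (fst ` set bs)"
    and mono: "\<And>b w. (b, w) \<in> set bs \<Longrightarrow> lie_monomial x wt J w b"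
    and span: "\<And>w y. lie_monomial x wt J w y \<Longrightarrow> W.deg w \<le> N \<Longrightarrow> y \<in> lspan {b. (b, w) \<in> set bs}"
    and m: "1 \<le> m" and n: "1 \<le> n" and mn: "m + n \<le> N"
  shows "trace_on (graded_piece (int m) (int n)) (T ^^ k)
    = (\<Sum>(b, w)\<in>{p \<in> set bs. md (snd p) = m \<and> nd (snd p) = n}. lam w ^ k)"
proof -
  let ?P = "{p \<in> set bs. md (snd p) = m \<and> nd (snd p) = n}"
  let ?C = "fst ` ?P"
  define weight where "weight b = the (map_of bs b)" for b
  have weight: "weight (fst p) = snd p" if "p \<in> set bs" for p
    using map_of_is_SomeI[OF basis(1), of "fst p" "snd p"] that by (simp add: weight_def)
  have lower: "lspan (lower m n t) \<subseteq> lspan {c \<in> ?C. ht (weight c) < t}" for t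
  proof (intro complex_vs.span_minimal complex_vs.subspace_span subsetI)
    fix y assume "y \<in> lower m n t"
    then obtain w where w: "lie_monomial x wt J w y" "md w = m" "nd w = n" "ht w < t"
      by (auto simp: lower_def)
    have "{b. (b, w) \<in> set bs} \<subseteq> {c \<in> ?C. ht (weight c) < t}"
      using weight w by force
    from subsetD[OF complex_vs.span_mono[OF this]] show "y \<in> lspan {c \<in> ?C. ht (weight c) < t}"
      using span[OF w(1)] w mn by (simp add: W.deg_def)
  qed
  have C: "lspan ?C = graded_piece (int m) (int n)"
  proof
    show "lspan ?C \<subseteq> graded_piece (int m) (int n)"
      using mono monomial_graded by (intro complex_vs.span_minimal subspace_graded_piece) fastforce
    show "graded_piece (int m) (int n) \<subseteq> lspan ?C"
      unfolding graded_piece_monomials[OF m n]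
    proof (intro complex_vs.span_minimal complex_vs.subspace_span subsetI)
      fix y assume "y \<in> {y. \<exists>w. lie_monomial x wt J w y \<and> md w = m \<and> nd w = n}"
      then obtain w where "lie_monomial x wt J w y" "md w = m" "nd w = n" by blast
      \<comment> \<open>Heights in \<open>lower\<close> are strictly below the bound, hence the
        successor.\<close>
      then have "y \<in> lower m n (Suc (ht w))" by (auto simp: lower_def)
      then have "y \<in> lspan {c \<in> ?C. ht (weight c) < Suc (ht w)}"
        using lower complex_vs.span_base by blast
      then show "y \<in> lspan ?C"
        using complex_vs.span_mono[of "{c \<in> ?C. ht (weight c) < Suc (ht w)}" ?C] by auto
    qed
  qed
  have tri: "T c - lam (weight c) *\<^sub>C c \<in> lspan {c' \<in> ?C. ht (weight c') < ht (weight c)}" if "c \<in> ?C" for c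
  proof -
    from that obtain p where p: "p \<in> set bs" "c = fst p" "md (snd p) = m" "nd (snd p) = n" by blast
    have "lie_monomial x wt J (snd p) c" using mono[of "fst p" "snd p"] p by simp
    from T_monomial[OF this] show ?thesis using lower p weight[OF p(1)] by auto
  qed
  have lin_pow: "lin (T ^^ k)" by (induction k) (auto simp: lin_iff lin_add[OF lin_T] lin_scale[OF lin_T])
  have "trace_on (graded_piece (int m) (int n)) (T ^^ k) = (\<Sum>c\<in>?C. lam (weight c) ^ k)"
  proof (rule trace_on_triangular[OF lin_pow _ _ C])
    show "complex_vs.independent ?C"
      by (rule complex_vs.independent_mono[OF basis(2)]) auto
    show "(T ^^ k) c - lam (weight c) ^ k *\<^sub>C c \<in> lspan {c' \<in> ?C. ht (weight c') < ht (weight c)}" if "c \<in> ?C" for c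
      by (rule triangular_power[OF lin_T that tri])
  qed simp
  also have "\<dots> = (\<Sum>p\<in>?P. lam (snd p) ^ k)"
  proof -
    have "inj_on fst ?P"
      using basis(1) by (auto simp: distinct_map intro: inj_on_subset)
    then show ?thesis using weight by (simp add: sum.reindex)
  qed
  finally show ?thesis by (simp add: split_beta)
qed

text \<open>Bidegree (a, c) of \<open>index3 n j k\<close> means k = a - 1 and n = a + c - 1, so one
  whole basis \<open>us n\<close> contributes, each member with the factor
  \<open>lr ^ (a - 1)\<close>.\<close>

lemma gen_fun_J:
  assumes "1 \<le> a" "1 \<le> c"
  shows "W.gen_fun wt J $ a $ c = trace_on (graded_piece 1 (int a + int c - 1)) T * lr ^ (a - 1)"
proof -
  let ?n = "a + c - 1"
  have n: "1 \<le> ?n" using assms by simp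
  have slice: "W.slice wt J a c = (\<lambda>j. index3 ?n j (a - 1)) ` {..<length (us ?n)}"
  proof (intro equalityI subsetI)
    fix l assume "l \<in> W.slice wt J a c"
    then obtain n j k where l: "l = index3 n j k" "j < length (us n)" "k < n" "Suc k = a" "n - k = c"
      by (auto simp: W.slice_def J_def wt_index3)
    then have "n = ?n" "k = a - 1" by auto
    then show "l \<in> (\<lambda>j. index3 ?n j (a - 1)) ` {..<length (us ?n)}" using l by blast
  next
    fix l assume "l \<in> (\<lambda>j. index3 ?n j (a - 1)) ` {..<length (us ?n)}"
    then obtain j where "l = index3 ?n j (a - 1)" "j < length (us ?n)" by blast
    moreover from this have "l \<in> J" using assms n unfolding J_def
      by (intro CollectI exI[of _ ?n] exI[of _ j] exI[of _ "a - 1"]) auto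
    ultimately show "l \<in> W.slice wt J a c" using assms by (simp add: W.slice_def wt_index3)
  qed
  have "trace_on (graded_piece 1 (int ?n)) T = (\<Sum>j<length (us ?n). la ?n j)"
    by (rule trace_on_triangular_list[OF lin_T us_distinct[OF n] us_indep[OF n] us_span[OF n] us_tri[OF n]])
  moreover have "int ?n = int a + int c - 1" using assms by simp
  moreover have "W.gen_fun wt J $ a $ c = (\<Sum>j<length (us ?n). lr ^ (a - 1) * la ?n j)"
    unfolding W.gen_fun_nth slice by (subst sum.reindex) (auto simp: inj_on_def wt_index3)
  ultimately show ?thesis by (simp add: sum_distrib_right[symmetric] sum_distrib_left[symmetric] mult.commute)
qed

lemma gen_fun_J_eq: "formal_sum ({1..} \<times> {1..}) (\<lambda>(m::nat, n::nat).
    monomial2 (trace_on (graded_piece 1 (int m + int n - 1)) T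
      * trace_on (graded_piece 1 (- 1)) T ^ (m - 1)) m n) = W.gen_fun wt J"
proof (intro fps_ext)
  fix a c
  let ?t = "\<lambda>m n. trace_on (graded_piece 1 (int m + int n - 1)) T * lr ^ (m - 1)"
  let ?F = "\<lambda>j. if j \<in> {1..} \<times> {1..} then (case j of (m, n) \<Rightarrow> monomial2 (?t m n) m n) $ a $ c else 0"
  have "Sum_any ?F = (\<Sum>j\<in>{(a, c)}. ?F j)"
    by (intro Sum_any.expand_superset) (auto simp: monomial2_nth split: if_splits)
  also have "\<dots> = W.gen_fun wt J $ a $ c"
  proof (cases "1 \<le> a \<and> 1 \<le> c")
    case True
    then show ?thesis by (simp add: gen_fun_J monomial2_nth)
  next
    case False
    \<comment> \<open>In \<open>J\<close>, k < n, so both degrees are at least 1.\<close>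
    then have "W.slice wt J a c = {}" by (auto simp: W.slice_def J_def wt_index3)
    then show ?thesis using False by (auto simp: W.gen_fun_nth)
  qed
  finally show "formal_sum ({1..} \<times> {1..}) (\<lambda>(m::nat, n::nat). monomial2 (trace_on (graded_piece 1 (int m + int n - 1)) T
      * trace_on (graded_piece 1 (- 1)) T ^ (m - 1)) m n) $ a $ c = W.gen_fun wt J $ a $ c"
    by (simp only: formal_sum_def fps_nth_Abs_fps lr_def)
qed

text \<open>For the coefficient of p^a q^c a basis up to total degree a + c is enough. A basis
  element of weight w contributes \<open>lam w ^ k / k\<close> whenever k times its bidegree is (a,
  c), and collecting equal bidegrees turns the sums of powers into traces.\<close>

theorem trace_identity:
  "formal_sum {1..} (\<lambda>k::nat. fps_const (fps_const (1 / of_nat k)) *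
     (formal_sum ({1..} \<times> {1..}) (\<lambda>(m::nat, n::nat).
       monomial2 (trace_on (graded_piece 1 (int m + int n - 1)) T
         * trace_on (graded_piece 1 (- 1)) T ^ (m - 1)) m n)) ^ k)
   = formal_sum ({1..} \<times> {1..}) (\<lambda>(m::nat, n::nat). formal_sum {1..} (\<lambda>k::nat.
       monomial2 (1 / of_nat k * trace_on (graded_piece (int m) (int n)) (T ^^ k)) (k * m) (k * n)))"
  unfolding gen_fun_J_eq formal_sum_powers[OF W.gen_fun_nth_0[OF locally_finite_J]]
proof (intro fps_ext)
  fix a c
  obtain bs where bs: "distinct (map fst bs)" "complex_vs.independent (fst ` set bs)"
    "\<And>b w. (b, w) \<in> set bs \<Longrightarrow> lie_monomial x wt J w b"
    "\<And>w y. lie_monomial x wt J w y \<Longrightarrow> W.deg w \<le> a + c \<Longrightarrow> y \<in> lspan {b. (b, w) \<in> set bs}"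
    "log_series (W.gen_fun wt J) $ a $ c = (\<Sum>(b, w)\<leftarrow>bs. log_series (W.weight_series w) $ a $ c)"
    using W.free_family_has_basis[OF free_J locally_finite_J, of "a + c"] unfolding W.has_basis_def by blast
  let ?t = "\<lambda>m n k. trace_on (graded_piece (int m) (int n)) (T ^^ k)"
  let ?P = "\<lambda>m n. {p \<in> set bs. md (snd p) = m \<and> nd (snd p) = n}"
  have pos: "1 \<le> md (snd p) \<and> 1 \<le> nd (snd p)" if "p \<in> set bs" for p
    using monomial_graded[OF bs(3), of "fst p" "snd p"] that by simp
  have "distinct bs" using bs(1) by (simp add: distinct_map)
  then have "log_series (W.gen_fun wt J) $ a $ c = (\<Sum>p\<in>set bs. log_series (W.weight_series (snd p)) $ a $ c)"
    unfolding bs(5) by (simp add: sum_list_distinct_conv_sum_set split_beta)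
  also have "\<dots> = (\<Sum>p\<in>set bs. \<Sum>k\<in>{1..a}.
      if k * md (snd p) = a \<and> k * nd (snd p) = c then lam (snd p) ^ k / of_nat k else 0)"
    using pos by (intro sum.cong HOL.refl log_series_monomial) auto
  \<comment> \<open>Summing over all bidegrees with an indicator for the bidegree of
    \<open>p\<close> decouples the ranges, so that the sums can be interchanged.\<close>
  also have "\<dots> = (\<Sum>p\<in>set bs. \<Sum>k\<in>{1..a}. \<Sum>(m, n)\<in>{1..a} \<times> {1..c}.
      if k * m = a \<and> k * n = c \<and> p \<in> ?P m n then lam (snd p) ^ k / of_nat k else 0)"
  proof (intro sum.cong HOL.refl)
    fix p k assume p: "p \<in> set bs" and k: "k \<in> {1..a}"
    let ?m = "md (snd p)" and ?n = "nd (snd p)" and ?v = "lam (snd p) ^ k / of_nat k"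
    have "(\<Sum>(m, n)\<in>{1..a} \<times> {1..c}. if k * m = a \<and> k * n = c \<and> p \<in> ?P m n then ?v else 0)
        = (\<Sum>j\<in>{1..a} \<times> {1..c}. if j = (?m, ?n) then (if k * ?m = a \<and> k * ?n = c then ?v else 0) else 0)"
      using p by (intro sum.cong) (auto split: if_splits)
    also have "\<dots> = (if k * ?m = a \<and> k * ?n = c then ?v else 0)"
      using pos[OF p] k by auto
    finally show "(if k * ?m = a \<and> k * ?n = c then ?v else 0)
      = (\<Sum>(m, n)\<in>{1..a} \<times> {1..c}. if k * m = a \<and> k * n = c \<and> p \<in> ?P m n then ?v else 0)" ..
  qed
  also have "\<dots> = (\<Sum>(m, n)\<in>{1..a} \<times> {1..c}. \<Sum>k\<in>{1..a}. \<Sum>p\<in>set bs.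
      if k * m = a \<and> k * n = c \<and> p \<in> ?P m n then lam (snd p) ^ k / of_nat k else 0)"
    unfolding split_beta
    by (subst sum.swap, subst (2) sum.swap, subst sum.swap) (rule HOL.refl)
  also have "\<dots> = (\<Sum>(m, n)\<in>{1..a} \<times> {1..c}. \<Sum>k\<in>{1..a}.
      if k * m = a \<and> k * n = c then 1 / of_nat k * ?t m n k else 0)"
  proof (intro sum.cong HOL.refl, clarify, intro sum.cong HOL.refl)
    fix m n k assume mn: "m \<in> {1..a}" "n \<in> {1..c}"
    have t: "?t m n k = (\<Sum>p\<in>?P m n. lam (snd p) ^ k)"
      using homogeneous_trace[OF bs(1-4), where m = m and n = n and k = k] mn by (simp add: split_beta)
    have "(\<Sum>p\<in>set bs. if p \<in> ?P m n then lam (snd p) ^ k / of_nat k else 0) = 1 / of_nat k * ?t m n k"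
      unfolding t sum_distrib_left by (subst sum.inter_restrict[symmetric]) (auto intro!: sum.cong)
    then show "(\<Sum>p\<in>set bs. if k * m = a \<and> k * n = c \<and> p \<in> ?P m n then lam (snd p) ^ k / of_nat k else 0)
        = (if k * m = a \<and> k * n = c then 1 / of_nat k * ?t m n k else 0)"
      by (cases "k * m = a \<and> k * n = c") (auto intro!: sum.neutral)
  qed
  also have "\<dots> = formal_sum ({1..} \<times> {1..}) (\<lambda>(m::nat, n::nat). formal_sum {1..} (\<lambda>k::nat.
       monomial2 (1 / of_nat k * ?t m n k) (k * m) (k * n))) $ a $ c"
  proof -
    let ?S = "\<lambda>m n. \<Sum>k\<in>{1..a}. if k * m = a \<and> k * n = c then 1 / of_nat k * ?t m n k else 0"
    have inner: "formal_sum {1..} (\<lambda>k::nat. monomial2 (1 / of_nat k * ?t m n k) (k * m) (k * n)) $ a $ c = ?S m n"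
      if m: "1 \<le> m" for m n
    proof -
      let ?f = "\<lambda>k::nat. if k \<in> {1..} then monomial2 (1 / of_nat k * ?t m n k) (k * m) (k * n) $ a $ c else 0"
      have "Sum_any ?f = (\<Sum>k\<in>{1..a}. ?f k)"
        using m by (intro Sum_any.expand_superset) (auto simp: monomial2_nth split: if_splits)
      also have "\<dots> = ?S m n" by (intro sum.cong) (auto simp: monomial2_nth)
      finally show ?thesis by (simp only: formal_sum_def fps_nth_Abs_fps)
    qed
    let ?F = "\<lambda>j. if j \<in> {1..} \<times> {1..} then (case j of (m, n) \<Rightarrow>
      formal_sum {1..} (\<lambda>k::nat. monomial2 (1 / of_nat k * ?t m n k) (k * m) (k * n))) $ a $ c else 0"
    have F: "?F (m, n) = (if 1 \<le> m \<and> 1 \<le> n then ?S m n else 0)" for m n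
      using inner by auto
    have "?S m n = 0" if "\<not> (m \<le> a \<and> n \<le> c)" for m n
      using that by (intro sum.neutral) auto
    then have zero: "?F (m, n) = 0" if "\<not> (1 \<le> m \<and> m \<le> a \<and> 1 \<le> n \<and> n \<le> c)" for m n
      using that unfolding F by auto
    have "Sum_any ?F = (\<Sum>j\<in>{1..a} \<times> {1..c}. ?F j)"
    proof (rule Sum_any.expand_superset)
      show "{j. ?F j \<noteq> 0} \<subseteq> {1..a} \<times> {1..c}"
      proof
        fix j assume nz: "j \<in> {j. ?F j \<noteq> 0}"
        obtain m n where j: "j = (m, n)" by (cases j)
        have "1 \<le> m \<and> m \<le> a \<and> 1 \<le> n \<and> n \<le> c"
          using nz zero[of m n] unfolding j mem_Collect_eq by blast
        then show "j \<in> {1..a} \<times> {1..c}" using j by auto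
      qed
    qed simp
    also have "\<dots> = (\<Sum>(m, n)\<in>{1..a} \<times> {1..c}. ?S m n)"
    proof (intro sum.cong HOL.refl)
      fix j assume mn: "j \<in> {1..a} \<times> {1..c}"
      obtain m n where j: "j = (m, n)" by (cases j)
      show "?F j = (case j of (m, n) \<Rightarrow> ?S m n)" unfolding j F using mn j by auto
    qed
    finally show ?thesis by (simp only: formal_sum_def fps_nth_Abs_fps)
  qed
  finally show "log_series (W.gen_fun wt J) $ a $ c
    = formal_sum ({1..} \<times> {1..}) (\<lambda>(m::nat, n::nat). formal_sum {1..} (\<lambda>k::nat.
       monomial2 (1 / of_nat k * ?t m n k) (k * m) (k * n))) $ a $ c" .
qed

end

context fricke_lie_algebra
begin

text \<open>Each piece of degree (1, n) with n \<ge> 1 is finite-dimensional by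
  \<open>finite_level\<close> and preserved by \<open>T\<close>, so
  \<open>exists_triangular_basis\<close> applies for every n separately.\<close>

lemma exists_triangular:
  assumes T: "homogeneous_automorphism T"
  shows "\<exists>us la. fricke_triangular A \<pi> D q form \<rho> T us la"
proof -
  have lin: "lin T" using T by (simp add: homogeneous_automorphism_def lie_hom_def)
  have "\<exists>us la. 1 \<le> n \<longrightarrow> distinct us \<and> complex_vs.independent (set us) \<and> lspan (set us) = graded_piece 1 (int n)
    \<and> (\<forall>j<length us. T (us ! j) - la j *\<^sub>C us ! j \<in> lspan ((!) us ` {..<j}))" for n
  proof (cases "1 \<le> n")
    case True
    have inv: "T y \<in> lspan (e ` {i. i \<noteq> real_index \<and> level i = n})"
      if "y \<in> lspan (e ` {i. i \<noteq> real_index \<and> level i = n})" for y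
      using that T unfolding graded_piece_imag[OF True, symmetric] homogeneous_automorphism_def by blast
    have "\<exists>us la. distinct us \<and> complex_vs.independent (set us)
      \<and> lspan (set us) = lspan (e ` {i. i \<noteq> real_index \<and> level i = n})
      \<and> (\<forall>j<length us. T (us ! j) - la j *\<^sub>C us ! j \<in> lspan ((!) us ` {..<j}))"
      by (rule exists_triangular_basis[OF lin inv finite_imageI[OF finite_level]])
    then show ?thesis unfolding graded_piece_imag[OF True] by blast
  qed auto
  then obtain us la where "\<And>n. 1 \<le> n \<Longrightarrow> distinct (us n) \<and> complex_vs.independent (set (us n))
      \<and> lspan (set (us n)) = graded_piece 1 (int n)
      \<and> (\<forall>j<length (us n). T (us n ! j) - la n j *\<^sub>C us n ! j \<in> lspan ((!) (us n) ` {..<j}))"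
    by metis
  then have "fricke_triangular A \<pi> D q form \<rho> T us la"
    using T by unfold_locales auto
  then show ?thesis by blast
qed

end

lemma group_action_pow:
  assumes act: "group_action H UNIV act" and h: "h \<in> carrier H"
  shows "act (h [^]\<^bsub>H\<^esub> k) = act h ^^ (k :: nat)"
proof
  interpret group_action H UNIV act by (rule act)
  interpret group H by (rule group_hom.axioms(1)[OF group_hom])
  show "act (h [^]\<^bsub>H\<^esub> k) y = (act h ^^ k) y" for y
  proof (induction k arbitrary: y)
    case 0
    then show ?case using id_eq_one by (simp add: fun_eq_iff restrict_def)
  next
    case (Suc k)
    have "act (h [^]\<^bsub>H\<^esub> k \<otimes>\<^bsub>H\<^esub> h) y = act (h [^]\<^bsub>H\<^esub> k) (act h y)"
      using composition_rule[of y "h [^]\<^bsub>H\<^esub> k" h] h by simp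
    then show ?case using Suc[of "act h y"] by (simp add: funpow_swap1)
  qed
qed

theorem proposition3p6:
  fixes A :: "'i :: countable \<Rightarrow> 'i \<Rightarrow> real"
    and \<pi> :: "'i bkm_gen free_lie \<Rightarrow> 'g :: complex_lie_algebra"
    and D :: "'g set"
    and q :: "'i \<Rightarrow> real"
    and form :: "'g \<Rightarrow> 'g \<Rightarrow> complex"
    and \<rho> :: 'g
    and G :: "int \<Rightarrow> int \<Rightarrow> 'g set"
    and H :: "('h, 'b) monoid_scheme"
    and act :: "'h \<Rightarrow> 'g \<Rightarrow> 'g"
    and h :: 'h
  assumes "fricke_lie_algebra A \<pi> D q form \<rho>"
    and "G = fricke_lie_algebra.graded_piece A \<pi> D q form \<rho>"
    and "group_action H UNIV act"
    and "\<And>x. x \<in> carrier H \<Longrightarrow>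
           fricke_lie_algebra.homogeneous_automorphism A \<pi> D q form \<rho> (act x)"
    and "h \<in> carrier H"
  shows
    "formal_sum {1..} (\<lambda>k::nat.
       fps_const (fps_const (1 / of_nat k)) *
       (formal_sum ({1..} \<times> {1..}) (\<lambda>(m::nat, n::nat).
          monomial2 (trace_on (G 1 (int m + int n - 1)) (act h)
                     * trace_on (G 1 (- 1)) (act h) ^ (m - 1)) m n)) ^ k)
     = formal_sum ({1..} \<times> {1..}) (\<lambda>(m::nat, n::nat).
         formal_sum {1..} (\<lambda>k::nat.
           monomial2 (1 / of_nat k * trace_on (G (int m) (int n)) (act (h [^]\<^bsub>H\<^esub> k)))
             (k * m) (k * n)))"
proof -
  obtain us la where "fricke_triangular A \<pi> D q form \<rho> (act h) us la"
    using fricke_lie_algebra.exists_triangular[OF assms(1) assms(4)[OF assms(5)]] by blast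
  from fricke_triangular.trace_identity[OF this] show ?thesis
    unfolding assms(2) group_action_pow[OF assms(3,5)] .
qed

end
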